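(* Let $\mathcal M$ be a finite von Neumann algebra with a faithful, normal, tracial state $\tau$. Let $\alpha$ be a normalized, unitarily invariant, $\|\cdot\|_1$-dominating, continuous norm on $\mathcal M$. If $\mathcal W$ is a closed subspace of $L^{\alpha}(\mathcal M,\tau)$ such that $\mathcal W\mathcal M\subseteq\mathcal W$, then there exists a projection $e$ in $\mathcal M$ such that $\mathcal W=eL^\alpha(\mathcal M,\tau)$.
   Context: $\|x\|_1=\tau(|x|)$ for $x\in\mathcal M$. A normalized, unitarily invariant, $\|\cdot\|_1$-dominating, continuous norm on $\mathcal M$ is a norm $\alpha:\mathcal M\to[0,\infty)$ such that: $\alpha(I)=1$; $\alpha(uxv)=\alpha(x)$ for all $x\in\mathcal M$ and all unitaries $u,v\in\mathcal M$; $\|x\|_1\le\alpha(x)$ for all $x\in\mathcal M$; and $\lim_{\tau(e)\to0}\alpha(e)=0$ as $e$ ranges over the projections in $\mathcal M$. $L^\alpha(\mathcal M,\tau)$ is the completion of $\mathcal M$ with respect to $\alpha$. One has $\alpha(axb)\le\|a\|\|b\|\alpha(x)$ for $a,b,x\in\mathcal M$, so $\mathcal M$ acts on $L^\alpha(\mathcal M,\tau)$ by left and right multiplication. "Closed subspace" is with respect to $\alpha$. *)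

theory Defs
  imports "HOL-Analysis.Analysis"
begin

section \<open>Complex Hilbert spaces and their bounded operators\<close>

text \<open>The real Banach space structure is inherited from \<^class>\<open>banach\<close>.
  The inner product is linear in its first argument; it is positive definite because it induces
  the norm.\<close>

class chilbert_space = banach +
  fixes scaleC :: "complex \<Rightarrow> 'a \<Rightarrow> 'a" (infixr "*\<^sub>C" 75)
    and cinner :: "'a \<Rightarrow> 'a \<Rightarrow> complex"
  assumes scaleC_add_right: "c *\<^sub>C (x + y) = c *\<^sub>C x + c *\<^sub>C y"
    and scaleC_add_left: "(c + d) *\<^sub>C x = c *\<^sub>C x + d *\<^sub>C x"
    and scaleC_scaleC: "c *\<^sub>C d *\<^sub>C x = (c * d) *\<^sub>C x"
    and scaleC_of_real: "complex_of_real r *\<^sub>C x = r *\<^sub>R x"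
    and cinner_commute: "cinner x y = cnj (cinner y x)"
    and cinner_add_left: "cinner (x + y) z = cinner x z + cinner y z"
    and cinner_scaleC_left: "cinner (c *\<^sub>C x) y = c * cinner x y"
    and cinner_self: "cinner x x = complex_of_real ((norm x)\<^sup>2)"

lemma norm_scaleC: "norm (c *\<^sub>C (x::'a::chilbert_space)) = cmod c * norm x"
proof -
  have "complex_of_real ((norm (c *\<^sub>C x))\<^sup>2) = c * (cnj c * cinner x x)"
    by (metis cinner_commute cinner_scaleC_left cinner_self complex_cnj_mult)
  also have "\<dots> = complex_of_real ((cmod c * norm x)\<^sup>2)"
    using complex_norm_square[of c]
    by (simp add: cinner_self power_mult_distrib flip: mult.assoc)
  finally show ?thesis
    by (simp add: power2_eq_iff_nonneg flip: of_real_power)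
qed

text \<open>Bounded operators are elements of the type of real-linear bounded maps; the complex-linear
  ones among them form the algebra \<open>B(H)\<close>. The norm of that type is the operator norm.\<close>

type_synonym 'h op = "('h, 'h) blinfun"

definition bounded_ops :: "'h::chilbert_space op set" where
  "bounded_ops = {T :: 'h op. \<forall>c x. T (c *\<^sub>C x) = c *\<^sub>C T x}"

definition scale_op :: "complex \<Rightarrow> 'h::chilbert_space op \<Rightarrow> 'h op" where
  "scale_op c T = Blinfun (\<lambda>x. c *\<^sub>C T x)"

lemma scale_op_apply [simp]: "scale_op c T x = c *\<^sub>C T x"
proof -
  have "bounded_linear (\<lambda>y::'a. c *\<^sub>C y)"
  proof (rule bounded_linear_intro[where K = "cmod c"])
    fix r and y :: 'a
    show "c *\<^sub>C r *\<^sub>R y = r *\<^sub>R c *\<^sub>C y"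
      by (metis scaleC_of_real scaleC_scaleC mult.commute)
  qed (simp_all add: scaleC_add_right norm_scaleC mult.commute)
  then have "bounded_linear (\<lambda>x. c *\<^sub>C T x)"
    by (rule bounded_linear_compose) (rule blinfun.bounded_linear_right)
  then show ?thesis
    unfolding scale_op_def by (rule bounded_linear_Blinfun_apply[THEN fun_cong])
qed

definition adj :: "'h::chilbert_space op \<Rightarrow> 'h op" where
  "adj T = (THE S :: 'h op. \<forall>x y. cinner (S x) y = cinner x (T y))"

definition selfadjoint :: "'h::chilbert_space op \<Rightarrow> bool" where
  "selfadjoint T \<longleftrightarrow> T \<in> bounded_ops \<and> adj T = T"

definition positive_op :: "'h::chilbert_space op \<Rightarrow> bool" where
  "positive_op T \<longleftrightarrow> selfadjoint T \<and> (\<forall>x. 0 \<le> Re (cinner (T x) x))"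

definition op_le :: "'h::chilbert_space op \<Rightarrow> 'h op \<Rightarrow> bool" where
  "op_le S T \<longleftrightarrow> positive_op (T - S)"

definition projection :: "'h::chilbert_space op \<Rightarrow> bool" where
  "projection e \<longleftrightarrow> selfadjoint e \<and> e o\<^sub>L e = e"

definition unitary_op :: "'h::chilbert_space op \<Rightarrow> bool" where
  "unitary_op u \<longleftrightarrow> u \<in> bounded_ops \<and> adj u o\<^sub>L u = id_blinfun \<and> u o\<^sub>L adj u = id_blinfun"

text \<open>The unique positive square root of \<open>T\<^sup>* T\<close>.\<close>

definition abs_op :: "'h::chilbert_space op \<Rightarrow> 'h op" where
  "abs_op T = (THE S :: 'h op. positive_op S \<and> S o\<^sub>L S = adj T o\<^sub>L T)"

section \<open>Von Neumann algebras and traces\<close>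

definition commutant :: "'h::chilbert_space op set \<Rightarrow> 'h op set" where
  "commutant M = {S \<in> bounded_ops. \<forall>T\<in>M. S o\<^sub>L T = T o\<^sub>L S}"

definition star_subalgebra :: "'h::chilbert_space op set \<Rightarrow> bool" where
  "star_subalgebra M \<longleftrightarrow>
     M \<subseteq> bounded_ops \<and> id_blinfun \<in> M \<and>
     (\<forall>x\<in>M. \<forall>y\<in>M. x + y \<in> M) \<and>
     (\<forall>c. \<forall>x\<in>M. scale_op c x \<in> M) \<and>
     (\<forall>x\<in>M. \<forall>y\<in>M. x o\<^sub>L y \<in> M) \<and>
     (\<forall>x\<in>M. adj x \<in> M)"

definition von_neumann_algebra :: "'h::chilbert_space op set \<Rightarrow> bool" where
  "von_neumann_algebra M \<longleftrightarrow> star_subalgebra M \<and> commutant (commutant M) = M"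

text \<open>Finiteness: the identity is not Murray--von Neumann equivalent to a proper subprojection,
  that is, every isometry in the algebra is unitary.\<close>

definition finite_von_neumann_algebra :: "'h::chilbert_space op set \<Rightarrow> bool" where
  "finite_von_neumann_algebra M \<longleftrightarrow>
     von_neumann_algebra M \<and>
     (\<forall>v\<in>M. adj v o\<^sub>L v = id_blinfun \<longrightarrow> v o\<^sub>L adj v = id_blinfun)"

definition state_on :: "'h::chilbert_space op set \<Rightarrow> ('h op \<Rightarrow> complex) \<Rightarrow> bool" where
  "state_on M \<tau> \<longleftrightarrow>
     (\<forall>x\<in>M. \<forall>y\<in>M. \<tau> (x + y) = \<tau> x + \<tau> y) \<and>
     (\<forall>c. \<forall>x\<in>M. \<tau> (scale_op c x) = c * \<tau> x) \<and>
     (\<forall>x\<in>M. positive_op x \<longrightarrow> \<tau> x \<in> \<real> \<and> 0 \<le> Re (\<tau> x)) \<and>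
     \<tau> id_blinfun = 1"

definition tracial_on :: "'h::chilbert_space op set \<Rightarrow> ('h op \<Rightarrow> complex) \<Rightarrow> bool" where
  "tracial_on M \<tau> \<longleftrightarrow> (\<forall>x\<in>M. \<forall>y\<in>M. \<tau> (x o\<^sub>L y) = \<tau> (y o\<^sub>L x))"

definition faithful_on :: "'h::chilbert_space op set \<Rightarrow> ('h op \<Rightarrow> complex) \<Rightarrow> bool" where
  "faithful_on M \<tau> \<longleftrightarrow> (\<forall>x\<in>M. positive_op x \<and> \<tau> x = 0 \<longrightarrow> x = 0)"

definition is_lub_in :: "'h::chilbert_space op set \<Rightarrow> 'h op set \<Rightarrow> 'h op \<Rightarrow> bool" where
  "is_lub_in M D s \<longleftrightarrow>
     s \<in> M \<and> selfadjoint s \<and> (\<forall>x\<in>D. op_le x s) \<and>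
     (\<forall>t\<in>M. selfadjoint t \<and> (\<forall>x\<in>D. op_le x t) \<longrightarrow> op_le s t)"

text \<open>Normality: suprema of upward directed sets (increasing nets) of self-adjoint elements are
  preserved.\<close>

definition normal_on :: "'h::chilbert_space op set \<Rightarrow> ('h op \<Rightarrow> complex) \<Rightarrow> bool" where
  "normal_on M \<tau> \<longleftrightarrow>
     (\<forall>D s. D \<subseteq> M \<and> D \<noteq> {} \<and> (\<forall>x\<in>D. selfadjoint x) \<and>
        (\<forall>x\<in>D. \<forall>y\<in>D. \<exists>z\<in>D. op_le x z \<and> op_le y z) \<and> is_lub_in M D s
        \<longrightarrow> Re (\<tau> s) = (SUP x\<in>D. Re (\<tau> x)))"

definition faithful_normal_tracial_state ::
    "'h::chilbert_space op set \<Rightarrow> ('h op \<Rightarrow> complex) \<Rightarrow> bool" where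
  "faithful_normal_tracial_state M \<tau> \<longleftrightarrow>
     state_on M \<tau> \<and> tracial_on M \<tau> \<and> faithful_on M \<tau> \<and> normal_on M \<tau>"

section \<open>Unitarily invariant norms\<close>

definition norm1 :: "('h::chilbert_space op \<Rightarrow> complex) \<Rightarrow> 'h op \<Rightarrow> real" where
  "norm1 \<tau> x = Re (\<tau> (abs_op x))"

definition norm_on :: "'h::chilbert_space op set \<Rightarrow> ('h op \<Rightarrow> real) \<Rightarrow> bool" where
  "norm_on M \<alpha> \<longleftrightarrow>
     (\<forall>x\<in>M. 0 \<le> \<alpha> x) \<and>
     (\<forall>x\<in>M. \<alpha> x = 0 \<longleftrightarrow> x = 0) \<and>
     (\<forall>c. \<forall>x\<in>M. \<alpha> (scale_op c x) = cmod c * \<alpha> x) \<and>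
     (\<forall>x\<in>M. \<forall>y\<in>M. \<alpha> (x + y) \<le> \<alpha> x + \<alpha> y)"

definition normalized_norm :: "('h::chilbert_space op \<Rightarrow> real) \<Rightarrow> bool" where
  "normalized_norm \<alpha> \<longleftrightarrow> \<alpha> id_blinfun = 1"

definition unitarily_invariant_on :: "'h::chilbert_space op set \<Rightarrow> ('h op \<Rightarrow> real) \<Rightarrow> bool" where
  "unitarily_invariant_on M \<alpha> \<longleftrightarrow>
     (\<forall>x\<in>M. \<forall>u\<in>M. \<forall>v\<in>M. unitary_op u \<and> unitary_op v \<longrightarrow> \<alpha> (u o\<^sub>L x o\<^sub>L v) = \<alpha> x)"

definition norm1_dominating_on ::
    "'h::chilbert_space op set \<Rightarrow> ('h op \<Rightarrow> complex) \<Rightarrow> ('h op \<Rightarrow> real) \<Rightarrow> bool" where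
  "norm1_dominating_on M \<tau> \<alpha> \<longleftrightarrow> (\<forall>x\<in>M. norm1 \<tau> x \<le> \<alpha> x)"

definition continuous_norm_on ::
    "'h::chilbert_space op set \<Rightarrow> ('h op \<Rightarrow> complex) \<Rightarrow> ('h op \<Rightarrow> real) \<Rightarrow> bool" where
  "continuous_norm_on M \<tau> \<alpha> \<longleftrightarrow>
     (\<forall>\<epsilon>>0. \<exists>\<delta>>0. \<forall>e\<in>M. projection e \<and> Re (\<tau> e) < \<delta> \<longrightarrow> \<alpha> e < \<epsilon>)"

section \<open>Completion with respect to a norm\<close>

text \<open>The completion of a carrier \<open>A\<close> with respect to a norm \<open>N\<close> on it: Cauchy sequences in \<open>A\<close>
  modulo null sequences.\<close>

definition cauchy_seqs :: "'a::ab_group_add set \<Rightarrow> ('a \<Rightarrow> real) \<Rightarrow> (nat \<Rightarrow> 'a) set" where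
  "cauchy_seqs A N =
     {X. (\<forall>n. X n \<in> A) \<and> (\<forall>\<epsilon>>0. \<exists>k. \<forall>m\<ge>k. \<forall>n\<ge>k. N (X m - X n) < \<epsilon>)}"

definition completion_rel ::
    "'a::ab_group_add set \<Rightarrow> ('a \<Rightarrow> real) \<Rightarrow> ((nat \<Rightarrow> 'a) \<times> (nat \<Rightarrow> 'a)) set" where
  "completion_rel A N =
     {(X, Y). X \<in> cauchy_seqs A N \<and> Y \<in> cauchy_seqs A N \<and> (\<lambda>n. N (X n - Y n)) \<longlonglongrightarrow> 0}"

definition completion ::
    "'a::ab_group_add set \<Rightarrow> ('a \<Rightarrow> real) \<Rightarrow> (nat \<Rightarrow> 'a) set set" where
  "completion A N = cauchy_seqs A N // completion_rel A N"

text \<open>Continuous extension of a map on \<open>A\<close> to the completion, acting termwise on representatives.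
  It is meaningful for maps that are Lipschitz with respect to \<open>N\<close>, such as those used below; all
  classes in the union are then equal.\<close>

definition completion_map ::
    "'a::ab_group_add set \<Rightarrow> ('a \<Rightarrow> real) \<Rightarrow> ('a \<Rightarrow> 'a) \<Rightarrow> (nat \<Rightarrow> 'a) set \<Rightarrow> (nat \<Rightarrow> 'a) set" where
  "completion_map A N f \<xi> = (\<Union>X\<in>\<xi>. completion_rel A N `` {\<lambda>n. f (X n)})"

definition completion_map2 ::
    "'a::ab_group_add set \<Rightarrow> ('a \<Rightarrow> real) \<Rightarrow> ('a \<Rightarrow> 'a \<Rightarrow> 'a) \<Rightarrow>
      (nat \<Rightarrow> 'a) set \<Rightarrow> (nat \<Rightarrow> 'a) set \<Rightarrow> (nat \<Rightarrow> 'a) set" where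
  "completion_map2 A N f \<xi> \<eta> = (\<Union>X\<in>\<xi>. \<Union>Y\<in>\<eta>. completion_rel A N `` {\<lambda>n. f (X n) (Y n)})"

definition completion_norm :: "('a::ab_group_add \<Rightarrow> real) \<Rightarrow> (nat \<Rightarrow> 'a) set \<Rightarrow> real" where
  "completion_norm N \<xi> = (THE r. \<forall>X\<in>\<xi>. (\<lambda>n. N (X n)) \<longlonglongrightarrow> r)"

section \<open>The space \<open>L\<^sup>\<alpha>(M, \<tau>)\<close>\<close>

text \<open>The trace enters only through the hypotheses on \<open>\<alpha>\<close>.\<close>

type_synonym 'h Lelem = "(nat \<Rightarrow> 'h op) set"

definition Lalpha :: "'h::chilbert_space op set \<Rightarrow> ('h op \<Rightarrow> real) \<Rightarrow> 'h Lelem set" where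
  "Lalpha M \<alpha> = completion M \<alpha>"

definition Lzero :: "'h::chilbert_space op set \<Rightarrow> ('h op \<Rightarrow> real) \<Rightarrow> 'h Lelem" where
  "Lzero M \<alpha> = completion_rel M \<alpha> `` {\<lambda>n. 0}"

definition Ladd ::
    "'h::chilbert_space op set \<Rightarrow> ('h op \<Rightarrow> real) \<Rightarrow> 'h Lelem \<Rightarrow> 'h Lelem \<Rightarrow> 'h Lelem" where
  "Ladd M \<alpha> = completion_map2 M \<alpha> (+)"

definition Ldiff ::
    "'h::chilbert_space op set \<Rightarrow> ('h op \<Rightarrow> real) \<Rightarrow> 'h Lelem \<Rightarrow> 'h Lelem \<Rightarrow> 'h Lelem" where
  "Ldiff M \<alpha> = completion_map2 M \<alpha> (-)"

definition Lscale ::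
    "'h::chilbert_space op set \<Rightarrow> ('h op \<Rightarrow> real) \<Rightarrow> complex \<Rightarrow> 'h Lelem \<Rightarrow> 'h Lelem" where
  "Lscale M \<alpha> c = completion_map M \<alpha> (scale_op c)"

definition left_mult ::
    "'h::chilbert_space op set \<Rightarrow> ('h op \<Rightarrow> real) \<Rightarrow> 'h op \<Rightarrow> 'h Lelem \<Rightarrow> 'h Lelem" where
  "left_mult M \<alpha> a = completion_map M \<alpha> (\<lambda>x. a o\<^sub>L x)"

definition right_mult ::
    "'h::chilbert_space op set \<Rightarrow> ('h op \<Rightarrow> real) \<Rightarrow> 'h Lelem \<Rightarrow> 'h op \<Rightarrow> 'h Lelem" where
  "right_mult M \<alpha> \<xi> a = completion_map M \<alpha> (\<lambda>x. x o\<^sub>L a) \<xi>"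

definition Lsubspace ::
    "'h::chilbert_space op set \<Rightarrow> ('h op \<Rightarrow> real) \<Rightarrow> 'h Lelem set \<Rightarrow> bool" where
  "Lsubspace M \<alpha> W \<longleftrightarrow>
     W \<subseteq> Lalpha M \<alpha> \<and> Lzero M \<alpha> \<in> W \<and>
     (\<forall>\<xi>\<in>W. \<forall>\<eta>\<in>W. Ladd M \<alpha> \<xi> \<eta> \<in> W) \<and>
     (\<forall>c. \<forall>\<xi>\<in>W. Lscale M \<alpha> c \<xi> \<in> W)"

definition Lclosed ::
    "'h::chilbert_space op set \<Rightarrow> ('h op \<Rightarrow> real) \<Rightarrow> 'h Lelem set \<Rightarrow> bool" where
  "Lclosed M \<alpha> W \<longleftrightarrow>
     (\<forall>\<xi>\<in>Lalpha M \<alpha>. (\<forall>\<epsilon>>0. \<exists>\<eta>\<in>W. completion_norm \<alpha> (Ldiff M \<alpha> \<xi> \<eta>) < \<epsilon>) \<longrightarrow> \<xi> \<in> W)"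

end

theory Submission
  imports Defs
begin

text \<open>The projection \<open>e\<close> is the largest one that \<open>W\<close> contains. Three facts make this work.

  First, a projection \<open>e \<in> W\<close> satisfies \<open>e L\<^sup>\<alpha> \<subseteq> W\<close>, because \<open>e M \<subseteq> W\<close> by right invariance and \<open>W\<close> is
  closed (\<open>principal_right_ideal_in_W\<close>).

  Secondly, there is a projection \<open>e \<in> W\<close> to which no nonzero projection in \<open>W\<close> is orthogonal
  (\<open>ex_maximal_projection\<close>). It is the limit of an increasing sequence of projections in \<open>W\<close> obtained
  by exhaustion; normality of the trace and the continuity of \<open>\<alpha>\<close> turn the strong limit into a limit
  for \<open>\<alpha>\<close>.

  Thirdly, a nonzero closed right-invariant subspace contains a nonzero projection. An element
  \<open>\<eta> \<noteq> 0\<close> of \<open>L\<^sup>\<alpha>\<close> can be cut down to a nonzero bounded element \<open>y = \<eta> q\<close> by a projection \<open>q\<close> of \<open>M\<close>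
  (\<open>ex_nonzero_bounded_cut\<close>), and the spectral projections of \<open>y y\<^sup>*\<close> away from \<open>0\<close> lie in the norm
  closure of \<open>y M\<close> (\<open>ex_nonzero_projection\<close>). Applied to \<open>\<eta> = \<xi> - e \<xi>\<close> with \<open>\<xi> \<in> W\<close>, this produces a
  projection in \<open>W\<close> orthogonal to \<open>e\<close> unless \<open>\<xi> = e \<xi>\<close>.

  The cut is an Egorov argument on a rapidly convergent sequence \<open>X n\<close> in \<open>M\<close> that represents \<open>\<eta>\<close>, so
  that no unbounded operators occur. Since \<open>\<parallel>\<cdot>\<parallel>\<^sub>1 \<le> \<alpha>\<close>, Chebyshev's inequality makes the steps
  \<open>X (n + 1) - X n\<close> small in operator norm off projections of small trace; their join still has small
  trace (\<open>ex_projection_avoiding\<close>), and off the join the sequence converges in operator norm. As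
  \<open>\<alpha>\<close> is small on projections of small trace, the cuts approximate \<open>\<eta>\<close>.

  The operator theory behind this rests on two constructions: positive square roots by a norm
  convergent iteration, and the projection onto the kernel of a positive contraction \<open>s\<close> as the
  decreasing strong limit of \<open>(1 - s)\<^sup>N\<close>. Applied to \<open>(\<bar>s - d\<bar> + (s - d))\<^sup>2\<close> the latter gives spectral
  projections, and applied to a weighted sum of projections it gives their join together with the
  estimate of its trace.\<close>

section \<open>The real inner product and adjoints\<close>

text \<open>Adjoints, positivity and projections are determined by the real part of the inner product
  together with complex linearity, so that conjugates do not appear in the estimates below.\<close>

definition rin :: "'h::chilbert_space \<Rightarrow> 'h \<Rightarrow> real" where
  "rin x y = Re (cinner x y)"

lemma rin_commute: "rin x y = rin y x"
  unfolding rin_def using cinner_commute[of x y] by simp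

lemma rin_add_left: "rin (x + y) z = rin x z + rin y z"
  by (simp add: rin_def cinner_add_left)

lemma rin_scaleR_left: "rin (r *\<^sub>R x) y = r * rin x y"
  unfolding rin_def scaleC_of_real[symmetric] by (simp add: cinner_scaleC_left)

lemma rin_self: "rin x x = (norm x)\<^sup>2"
  by (simp add: rin_def cinner_self flip: of_real_power)

lemma rin_ii_left: "rin (\<i> *\<^sub>C x) y = - Im (cinner x y)"
  by (simp add: rin_def cinner_scaleC_left)

lemma rin_ii_right: "rin x (\<i> *\<^sub>C y) = Im (cinner x y)"
  using rin_ii_left[of y x] cinner_commute[of x y] by (simp add: rin_commute)

lemma cinner_eq_rin: "cinner x y = Complex (rin x y) (rin x (\<i> *\<^sub>C y))"
  by (simp add: rin_ii_right) (simp add: rin_def)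

lemma rin_add_right: "rin x (y + z) = rin x y + rin x z"
  by (metis rin_add_left rin_commute)

lemma rin_scaleR_right: "rin x (r *\<^sub>R y) = r * rin x y"
  by (metis rin_commute rin_scaleR_left)

text \<open>The common source of the Cauchy--Schwarz inequalities and of the Euler equation for the
  minimizer in the Riesz representation.\<close>

lemma quadratic_nonneg_discriminant:
  fixes a b r :: real
  assumes "\<And>t. 0 \<le> a + 2 * t * r + t\<^sup>2 * b" and "0 \<le> b"
  shows "r\<^sup>2 \<le> a * b"
proof (cases "b = 0")
  case True
  have "r = 0"
  proof (rule ccontr)
    assume r: "r \<noteq> 0"
    have "0 \<le> a + 2 * (- (a + 1) / (2 * r)) * r" using assms(1)[of "- (a + 1) / (2 * r)"] True by simp
    then show False using r by (simp add: field_simps)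
  qed
  then show ?thesis using True by simp
next
  case False
  then have "b > 0" using assms(2) by simp
  then show ?thesis using assms(1)[of "- r / b"]
    by (simp add: field_simps power2_eq_square)
qed

lemma rin_cauchy_schwarz: "\<bar>rin x y\<bar> \<le> norm x * norm y"
proof -
  have "(rin x y)\<^sup>2 \<le> (norm x)\<^sup>2 * (norm y)\<^sup>2"
  proof (rule quadratic_nonneg_discriminant)
    fix t :: real
    have "rin (x + t *\<^sub>R y) (x + t *\<^sub>R y) = (norm x)\<^sup>2 + 2 * t * rin x y + t\<^sup>2 * (norm y)\<^sup>2"
      unfolding rin_self[symmetric]
      by (simp add: rin_add_left rin_add_right rin_scaleR_left rin_scaleR_right
          rin_commute[of y x] power2_eq_square algebra_simps)
    then show "0 \<le> (norm x)\<^sup>2 + 2 * t * rin x y + t\<^sup>2 * (norm y)\<^sup>2"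
      by (metis rin_self zero_le_power2)
  qed simp
  then show ?thesis by (simp add: abs_le_square_iff[symmetric] flip: power_mult_distrib)
qed

lemma bounded_bilinear_rin: "bounded_bilinear rin"
  by (rule bounded_bilinear.intro)
    (auto simp: rin_add_left rin_add_right rin_scaleR_left rin_scaleR_right rin_cauchy_schwarz
      intro!: exI[of _ 1])

interpretation rin: bounded_bilinear rin
  by (rule bounded_bilinear_rin)

lemmas rin_simps = rin.add_left rin.add_right rin.diff_left rin.diff_right rin.minus_left
  rin.minus_right rin.scaleR_left rin.scaleR_right rin.zero_left rin.zero_right

lemma rin_ext: "(\<And>y. rin x y = rin x' y) \<Longrightarrow> x = x'"
proof -
  assume "\<And>y. rin x y = rin x' y"
  then have "rin (x - x') (x - x') = 0" by (simp add: rin.diff_left)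
  then show ?thesis by (simp add: rin_self)
qed

lemma norm_add_scaleR_sq:
  "(norm (x + t *\<^sub>R y))\<^sup>2 = (norm x)\<^sup>2 + 2 * t * rin x y + t\<^sup>2 * (norm y)\<^sup>2"
  unfolding rin_self[symmetric]
  by (simp add: rin_simps rin_commute[of y x] power2_eq_square algebra_simps)

text \<open>The representing vector minimizes \<open>\<parallel>y\<parallel>\<^sup>2 - 2 f y\<close>: the parallelogram identity makes every
  minimizing sequence Cauchy, and the derivative at the minimum vanishes in all directions.\<close>

lemma riesz_representation:
  fixes f :: "'h::chilbert_space \<Rightarrow> real"
  assumes f: "bounded_linear f"
  shows "\<exists>z. \<forall>y. f y = rin y z"
proof -
  interpret f: bounded_linear f by (rule f)
  obtain K where K: "\<And>y. \<bar>f y\<bar> \<le> norm y * K" using f.bounded by auto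
  define J where "J y = (norm y)\<^sup>2 - 2 * f y" for y
  have lb: "- K\<^sup>2 \<le> J y" for y
  proof -
    have "0 \<le> (norm y - K)\<^sup>2" by simp
    moreover have "f y \<le> norm y * K" using K[of y] by simp
    ultimately show ?thesis unfolding J_def by (simp add: power2_eq_square algebra_simps)
  qed
  define d where "d = Inf (range J)"
  have bdd: "bdd_below (range J)" using lb by (auto intro!: bdd_belowI)
  have d_le: "d \<le> J y" for y unfolding d_def using bdd by (auto intro: cInf_lower)
  have "\<exists>y. J y < d + 1 / real (Suc n)" for n
    using cInf_lessD[of "range J" "d + 1 / real (Suc n)"] unfolding d_def by auto
  then obtain Y where Y: "\<And>n. J (Y n) < d + 1 / real (Suc n)" by metis
  have par: "(norm (y - y'))\<^sup>2 \<le> 2 * (J y - d) + 2 * (J y' - d)" for y y'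
  proof -
    have "(norm (y - y'))\<^sup>2 = 2 * J y + 2 * J y' - 4 * J ((1/2) *\<^sub>R (y + y'))"
      unfolding J_def f.scaleR f.add
      by (simp add: rin_simps algebra_simps flip: rin_self)
    then show ?thesis using d_le[of "(1/2) *\<^sub>R (y + y')"] by simp
  qed
  have "Cauchy Y"
  proof (rule metric_CauchyI)
    fix e :: real assume e: "0 < e"
    obtain N where N: "1 / real (Suc N) < e\<^sup>2 / 4"
      using e nat_approx_posE[of "e\<^sup>2 / 4"] by auto
    have "dist (Y m) (Y n) < e" if "N \<le> m" "N \<le> n" for m n
    proof -
      have "1 / real (Suc k) \<le> 1 / real (Suc N)" if "N \<le> k" for k
        using that by (simp add: frac_le)
      then have "J (Y m) - d < e\<^sup>2 / 4" "J (Y n) - d < e\<^sup>2 / 4"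
        using Y[of m] Y[of n] N that by (smt (verit, best))+
      then have "(norm (Y m - Y n))\<^sup>2 < e\<^sup>2" using par[of "Y m" "Y n"] by argo
      then show ?thesis unfolding dist_norm by (rule power2_less_imp_less) (use e in simp)
    qed
    then show "\<exists>N. \<forall>m\<ge>N. \<forall>n\<ge>N. dist (Y m) (Y n) < e" by blast
  qed
  then obtain z where z: "Y \<longlonglongrightarrow> z" using Cauchy_convergent convergent_def by blast
  have "(\<lambda>n. J (Y n)) \<longlonglongrightarrow> J z"
    unfolding J_def by (intro tendsto_intros z f.tendsto)
  moreover have "(\<lambda>n. d + 1 / real (Suc n)) \<longlonglongrightarrow> d + 0"
    by (intro tendsto_intros LIMSEQ_Suc lim_1_over_n)
  ultimately have "J z \<le> d + 0"
    by (rule LIMSEQ_le) (use Y in \<open>auto intro!: less_imp_le\<close>)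
  then have "J z \<le> d" by simp
  have "f y = rin y z" for y
  proof -
    have "(rin z y - f y)\<^sup>2 \<le> 0 * (norm y)\<^sup>2"
    proof (rule quadratic_nonneg_discriminant)
      fix t :: real
      have "J z \<le> J (z + t *\<^sub>R y)" using \<open>J z \<le> d\<close> d_le order_trans by blast
      then show "0 \<le> 0 + 2 * t * (rin z y - f y) + t\<^sup>2 * (norm y)\<^sup>2"
        unfolding J_def norm_add_scaleR_sq f.add f.scaleR by (simp add: algebra_simps)
    qed simp
    then show ?thesis by (simp add: rin_commute)
  qed
  then show ?thesis by blast
qed

lemma scaleC_conv_scaleR: "c *\<^sub>C x = Re c *\<^sub>R x + Im c *\<^sub>R (\<i> *\<^sub>C (x::'h::chilbert_space))"
proof -
  have "c *\<^sub>C x = (complex_of_real (Re c) + complex_of_real (Im c) * \<i>) *\<^sub>C x"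
    by (metis complex_eq mult.commute)
  then show ?thesis
    by (simp only: scaleC_add_left scaleC_scaleC[symmetric] scaleC_of_real)
qed

text \<open>\<open>c x = Re c x + Im c (\<i> x)\<close> reduces complex linearity to the imaginary unit.\<close>

lemma bounded_opsI:
  fixes T :: "'h::chilbert_space op"
  assumes "\<And>x. T (\<i> *\<^sub>C x) = \<i> *\<^sub>C T x"
  shows "T \<in> bounded_ops"
proof -
  have "T (c *\<^sub>C x) = c *\<^sub>C T x" for c x
    unfolding scaleC_conv_scaleR[of c x] scaleC_conv_scaleR[of c "T x"]
    by (simp add: blinfun.bilinear_simps assms)
  then show ?thesis by (simp add: bounded_ops_def)
qed

lemma bounded_opsD: "T \<in> bounded_ops \<Longrightarrow> T (c *\<^sub>C x) = c *\<^sub>C T x"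
  by (simp add: bounded_ops_def)

lemma scaleC_zero: "c *\<^sub>C 0 = (0::'h::chilbert_space)"
  by (metis norm_scaleC norm_eq_zero mult_zero_right)

lemma scaleC_minus: "c *\<^sub>C (- x) = - (c *\<^sub>C (x::'h::chilbert_space))"
  by (metis add.right_inverse add_eq_0_iff scaleC_add_right scaleC_zero)

lemma scaleC_diff: "c *\<^sub>C (x - y) = c *\<^sub>C x - c *\<^sub>C (y::'h::chilbert_space)"
  by (metis scaleC_add_right scaleC_minus diff_conv_add_uminus)

lemma scaleC_scaleR: "c *\<^sub>C r *\<^sub>R x = r *\<^sub>R c *\<^sub>C (x::'h::chilbert_space)"
  by (metis mult.commute scaleC_of_real scaleC_scaleC)

lemmas scaleC_simps = scaleC_add_right scaleC_diff scaleC_minus scaleC_zero scaleC_scaleR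

lemma bounded_ops_add: "S \<in> bounded_ops \<Longrightarrow> T \<in> bounded_ops \<Longrightarrow> S + T \<in> bounded_ops"
  by (auto simp: bounded_ops_def blinfun.bilinear_simps scaleC_simps)

lemma bounded_ops_diff: "S \<in> bounded_ops \<Longrightarrow> T \<in> bounded_ops \<Longrightarrow> S - T \<in> bounded_ops"
  by (auto simp: bounded_ops_def blinfun.bilinear_simps scaleC_simps)

lemma bounded_ops_scaleR: "T \<in> bounded_ops \<Longrightarrow> r *\<^sub>R T \<in> bounded_ops"
  by (auto simp: bounded_ops_def blinfun.bilinear_simps scaleC_simps)

lemma bounded_ops_compose: "S \<in> bounded_ops \<Longrightarrow> T \<in> bounded_ops \<Longrightarrow> S o\<^sub>L T \<in> bounded_ops"
  by (auto simp: bounded_ops_def)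

lemma bounded_ops_id: "id_blinfun \<in> bounded_ops"
  by (auto simp: bounded_ops_def)

lemma bounded_ops_0: "0 \<in> bounded_ops"
  by (auto simp: bounded_ops_def scaleC_zero)

lemma rin_ii_swap: "rin (\<i> *\<^sub>C x) y = - rin x (\<i> *\<^sub>C y)"
  by (simp add: rin_ii_left rin_ii_right)

text \<open>The imaginary part of \<open>\<langle>x, y\<rangle>\<close> is the real part of \<open>\<langle>x, \<i> y\<rangle>\<close>, and \<open>T\<close> commutes with \<open>\<i>\<close>.\<close>

lemma cinner_eq_iff_rin:
  fixes S T :: "'h::chilbert_space op"
  assumes "T \<in> bounded_ops"
  shows "(\<forall>x y. cinner (S x) y = cinner x (T y)) \<longleftrightarrow> (\<forall>x y. rin (S x) y = rin x (T y))"
  using assms by (auto simp: cinner_eq_rin complex_eq_iff bounded_opsD[symmetric])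

lemma ex_adjoint:
  fixes T :: "'h::chilbert_space op"
  shows "\<exists>S :: 'h op. \<forall>x y. rin (S x) y = rin x (T y)"
proof -
  have "\<exists>z. \<forall>y. rin x (T y) = rin y z" for x
    by (rule riesz_representation)
      (intro bounded_linear_compose[OF rin.bounded_linear_right] blinfun.bounded_linear_right)
  then obtain S where "\<And>x y. rin x (T y) = rin y (S x)" by metis
  then have S: "rin (S x) y = rin x (T y)" for x y by (simp add: rin_commute)
  have "bounded_linear S"
  proof (rule bounded_linear_intro[where K = "norm T"])
    show "S (x + y) = S x + S y" for x y by (rule rin_ext) (simp add: S rin_simps)
    show "S (r *\<^sub>R x) = r *\<^sub>R S x" for r x by (rule rin_ext) (simp add: S rin_simps)
    fix x
    have "(norm (S x))\<^sup>2 \<le> norm x * (norm T * norm (S x))"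
      unfolding rin_self[symmetric] S
      by (rule order_trans[OF abs_ge_self], rule order_trans[OF rin_cauchy_schwarz])
        (simp add: mult_left_mono norm_blinfun)
    then show "norm (S x) \<le> norm x * norm T"
      by (cases "S x = 0") (auto simp: power2_eq_square mult.assoc[symmetric])
  qed
  then show ?thesis using S by (intro exI[of _ "Blinfun S"]) (simp add: bounded_linear_Blinfun_apply)
qed

lemma op_ext_rin:
  fixes S T :: "'h::chilbert_space op"
  assumes "\<And>x y. rin (S x) y = rin (T x) y" shows "S = T"
  by (rule blinfun_eqI, rule rin_ext, rule assms)

lemma adj_eqI:
  fixes S T :: "'h::chilbert_space op"
  assumes "T \<in> bounded_ops" and "\<And>x y. rin (S x) y = rin x (T y)"
  shows "adj T = S"
  unfolding adj_def cinner_eq_iff_rin[OF assms(1)]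
  by (rule the_equality) (auto simp: assms(2) intro: op_ext_rin)

lemma rin_adj_left:
  fixes T :: "'h::chilbert_space op"
  assumes "T \<in> bounded_ops"
  shows "rin (adj T x) y = rin x (T y)"
  using ex_adjoint[of T] adj_eqI[OF assms] by metis

lemma rin_adj_right: "T \<in> bounded_ops \<Longrightarrow> rin x (adj T y) = rin (T x) y"
  by (metis rin_adj_left rin_commute)

lemma adj_bounded_ops: "T \<in> bounded_ops \<Longrightarrow> adj T \<in> bounded_ops"
  by (rule bounded_opsI, rule rin_ext)
    (simp add: rin_adj_left rin_ii_swap bounded_opsD)

lemma adj_adj: "T \<in> bounded_ops \<Longrightarrow> adj (adj T) = T"
  by (rule adj_eqI) (auto simp: adj_bounded_ops rin_adj_right)

lemma norm_adj_le:
  fixes T :: "'h::chilbert_space op"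
  assumes T: "T \<in> bounded_ops" shows "norm (adj T) \<le> norm T"
proof (rule norm_blinfun_bound)
  fix x
  have "(norm (adj T x))\<^sup>2 \<le> norm x * (norm T * norm (adj T x))"
    unfolding rin_self[symmetric] rin_adj_left[OF T]
    by (rule order_trans[OF abs_ge_self], rule order_trans[OF rin_cauchy_schwarz])
      (simp add: mult_left_mono norm_blinfun)
  then show "norm (adj T x) \<le> norm T * norm x"
    by (cases "adj T x = 0") (auto simp: power2_eq_square mult.assoc[symmetric] mult.commute)
qed simp

section \<open>Self-adjoint and positive operators\<close>

lemma selfadjoint_iff:
  "selfadjoint T \<longleftrightarrow> T \<in> bounded_ops \<and> (\<forall>x y. rin (T x) y = rin x (T y))"
  unfolding selfadjoint_def using adj_eqI[of T T] rin_adj_left[of T] by metis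

lemma selfadjoint_rin: "selfadjoint T \<Longrightarrow> rin (T x) y = rin x (T y)"
  by (simp add: selfadjoint_iff)

lemma positive_op_iff: "positive_op T \<longleftrightarrow> selfadjoint T \<and> (\<forall>x. 0 \<le> rin (T x) x)"
  by (simp add: positive_op_def rin_def)

lemma selfadjoint_add: "selfadjoint S \<Longrightarrow> selfadjoint T \<Longrightarrow> selfadjoint (S + T)"
  by (auto simp: selfadjoint_iff bounded_ops_add blinfun.bilinear_simps rin_simps)

lemma selfadjoint_diff: "selfadjoint S \<Longrightarrow> selfadjoint T \<Longrightarrow> selfadjoint (S - T)"
  by (auto simp: selfadjoint_iff bounded_ops_diff blinfun.bilinear_simps rin_simps)

lemma selfadjoint_scaleR: "selfadjoint T \<Longrightarrow> selfadjoint (r *\<^sub>R T)"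
  by (auto simp: selfadjoint_iff bounded_ops_scaleR blinfun.bilinear_simps rin_simps)

lemma selfadjoint_id: "selfadjoint id_blinfun"
  by (auto simp: selfadjoint_iff bounded_ops_id)

lemma selfadjoint_0: "selfadjoint 0"
  by (auto simp: selfadjoint_iff bounded_ops_0 rin_simps)

lemma selfadjoint_compose_commute:
  "selfadjoint S \<Longrightarrow> selfadjoint T \<Longrightarrow> S o\<^sub>L T = T o\<^sub>L S \<Longrightarrow> selfadjoint (S o\<^sub>L T)"
  unfolding selfadjoint_iff
  by (auto simp: bounded_ops_compose) (metis blinfun_apply_blinfun_compose)

lemma op_le_iff:
  assumes "selfadjoint S" "selfadjoint T"
  shows "op_le S T \<longleftrightarrow> (\<forall>x. rin (S x) x \<le> rin (T x) x)"
  using selfadjoint_diff[OF assms(2,1)]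
  by (auto simp: op_le_def positive_op_iff blinfun.bilinear_simps rin_simps)

lemma positive_adj_compose: "T \<in> bounded_ops \<Longrightarrow> positive_op (adj T o\<^sub>L T)"
  by (auto simp: positive_op_iff selfadjoint_iff bounded_ops_compose adj_bounded_ops
      rin_adj_left rin_adj_right rin_self)

lemma positive_cauchy_schwarz:
  assumes "positive_op T"
  shows "(rin (T x) y)\<^sup>2 \<le> rin (T x) x * rin (T y) y"
proof (rule quadratic_nonneg_discriminant)
  fix t :: real
  have "rin (T y) x = rin (T x) y" using assms by (metis positive_op_iff rin_commute selfadjoint_rin)
  then have "rin (T (x + t *\<^sub>R y)) (x + t *\<^sub>R y) = rin (T x) x + 2 * t * rin (T x) y + t\<^sup>2 * rin (T y) y"
    by (simp add: blinfun.bilinear_simps rin_simps power2_eq_square algebra_simps)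
  then show "0 \<le> rin (T x) x + 2 * t * rin (T x) y + t\<^sup>2 * rin (T y) y"
    using assms by (metis positive_op_iff)
qed (use assms in \<open>simp add: positive_op_iff\<close>)

lemma positive_null: "positive_op T \<Longrightarrow> rin (T x) x = 0 \<Longrightarrow> T x = 0"
  using positive_cauchy_schwarz[of T x "T x"] by (simp add: rin_self)

text \<open>Cauchy--Schwarz for the form \<open>\<langle>T x, y\<rangle>\<close> at \<open>y = T x\<close>.\<close>

lemma positive_norm_sq_le:
  assumes T: "positive_op T" and c: "0 \<le> c" "\<And>x. rin (T x) x \<le> c * (norm x)\<^sup>2"
  shows "(norm (T x))\<^sup>2 \<le> c * rin (T x) x"
proof -
  have nn: "0 \<le> rin (T x) x" using T by (simp add: positive_op_iff)
  have "((norm (T x))\<^sup>2)\<^sup>2 \<le> rin (T x) x * (c * (norm (T x))\<^sup>2)"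
    using positive_cauchy_schwarz[OF T, of x "T x"] mult_left_mono[OF c(2)[of "T x"] nn]
    by (simp add: rin_self)
  then have *: "(norm (T x))\<^sup>2 * (norm (T x))\<^sup>2 \<le> (c * rin (T x) x) * (norm (T x))\<^sup>2"
    by (simp only: power2_eq_square[of "(norm (T x))\<^sup>2"] mult_ac)
  show ?thesis
  proof (cases "T x = 0")
    case True then show ?thesis using nn c(1) by simp
  next
    case False
    then have "0 < (norm (T x))\<^sup>2" by simp
    then show ?thesis using * by (rule mult_right_le_imp_le[rotated])
  qed
qed

lemma positive_norm_le:
  assumes T: "positive_op T" and c: "0 \<le> c" "\<And>x. rin (T x) x \<le> c * (norm x)\<^sup>2"
  shows "norm T \<le> c"
proof (rule norm_blinfun_bound)
  fix x
  have "(norm (T x))\<^sup>2 \<le> c * (c * (norm x)\<^sup>2)"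
    using positive_norm_sq_le[OF T c, of x] mult_left_mono[OF c(2)[of x] c(1)] by linarith
  also have "\<dots> = (c * norm x)\<^sup>2" by (simp add: power2_eq_square)
  finally show "norm (T x) \<le> c * norm x"
    by (rule power2_le_imp_le) (simp add: c(1))
qed (rule c)

lemma rin_le_norm:
  fixes T :: "'h::chilbert_space op"
  shows "\<bar>rin (T x) x\<bar> \<le> norm T * (norm x)\<^sup>2"
  using order_trans[OF rin_cauchy_schwarz[of "T x" x] mult_right_mono[OF norm_blinfun[of T x] norm_ge_zero[of x]]]
  by (simp add: power2_eq_square mult.assoc)

lemma positive_scaleR: "positive_op T \<Longrightarrow> 0 \<le> r \<Longrightarrow> positive_op (r *\<^sub>R T)"
  by (auto simp: positive_op_iff selfadjoint_scaleR blinfun.bilinear_simps rin_simps)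

lemma projection_iff:
  "projection e \<longleftrightarrow> selfadjoint e \<and> (\<forall>x. e (e x) = e x)"
  unfolding projection_def by (metis blinfun_apply_blinfun_compose blinfun_eqI)

lemma projection_rin: "projection e \<Longrightarrow> rin (e x) x = (norm (e x))\<^sup>2"
  by (metis projection_iff rin_self selfadjoint_rin)

lemma projection_positive: "projection e \<Longrightarrow> positive_op e"
  using projection_rin[of e] by (simp add: positive_op_iff) (simp add: projection_iff)

lemma projection_complement: "projection e \<Longrightarrow> projection (id_blinfun - e)"
  by (auto simp: projection_iff selfadjoint_diff selfadjoint_id blinfun.bilinear_simps)

lemma projection_rin_le: "projection e \<Longrightarrow> rin (e x) x \<le> (norm x)\<^sup>2"
  using projection_rin[OF projection_complement, of e x]
  by (simp add: blinfun.bilinear_simps rin_simps rin_self) (smt (verit) zero_le_power2)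

lemma projection_norm_le: "projection e \<Longrightarrow> norm e \<le> 1"
  by (rule positive_norm_le) (auto simp: projection_positive projection_rin_le)

section \<open>Positive square roots\<close>

lemmas tendsto_compose = bounded_bilinear.tendsto[OF bounded_bilinear_blinfun_compose]

lemma tendsto_apply: "T \<longlonglongrightarrow> T' \<Longrightarrow> (\<lambda>n. blinfun_apply (T n) x) \<longlonglongrightarrow> blinfun_apply T' x"
  by (intro tendsto_intros)

lemma commute_strong_limit:
  fixes T :: "nat \<Rightarrow> 'h::chilbert_space op" and T' :: "'h op"
  assumes lim: "\<And>x. (\<lambda>n. T n x) \<longlonglongrightarrow> T' x" and S: "\<And>n. S o\<^sub>L T n = T n o\<^sub>L S"
  shows "S o\<^sub>L T' = T' o\<^sub>L S"
proof (rule blinfun_eqI)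
  fix x
  have "(\<lambda>n. S (T n x)) \<longlonglongrightarrow> S (T' x)" by (intro tendsto_intros lim)
  moreover have "S (T n x) = T n (S x)" for n using S[of n] by (metis blinfun_apply_blinfun_compose)
  ultimately show "(S o\<^sub>L T') x = (T' o\<^sub>L S) x"
    using lim[of "S x"] LIMSEQ_unique by auto
qed

lemma tendsto_scaleC: "f \<longlonglongrightarrow> (l::'h::chilbert_space) \<Longrightarrow> (\<lambda>n. c *\<^sub>C f n) \<longlonglongrightarrow> c *\<^sub>C l"
  using blinfun.tendsto[OF tendsto_const[of "scale_op c id_blinfun"], of f l sequentially] by simp

lemma bounded_ops_strong_limit:
  fixes T :: "nat \<Rightarrow> 'h::chilbert_space op" and T' :: "'h op"
  assumes lim: "\<And>x. (\<lambda>n. T n x) \<longlonglongrightarrow> T' x" and T: "\<And>n. T n \<in> bounded_ops"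
  shows "T' \<in> bounded_ops"
proof (rule bounded_opsI)
  fix x
  show "T' (\<i> *\<^sub>C x) = \<i> *\<^sub>C T' x"
    by (rule LIMSEQ_unique[OF lim]) (simp add: bounded_opsD[OF T] tendsto_scaleC lim)
qed

lemma selfadjoint_strong_limit:
  fixes T :: "nat \<Rightarrow> 'h::chilbert_space op" and T' :: "'h op"
  assumes lim: "\<And>x. (\<lambda>n. T n x) \<longlonglongrightarrow> T' x" and T: "\<And>n. selfadjoint (T n)"
  shows "selfadjoint T'"
  unfolding selfadjoint_iff
proof (intro conjI allI)
  show "T' \<in> bounded_ops"
    using bounded_ops_strong_limit[OF lim] T by (simp add: selfadjoint_iff)
  fix x y
  have "(\<lambda>n. rin (T n x) y) \<longlonglongrightarrow> rin (T' x) y" by (intro rin.tendsto lim tendsto_const)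
  moreover have "(\<lambda>n. rin x (T n y)) \<longlonglongrightarrow> rin x (T' y)" by (intro rin.tendsto lim tendsto_const)
  ultimately show "rin (T' x) y = rin x (T' y)"
    using LIMSEQ_unique by (simp add: selfadjoint_rin[OF T])
qed

text \<open>The root is \<open>1 - Y\<close>, where \<open>Y\<close> solves \<open>Y = (X + Y\<^sup>2) / 2\<close> and is reached by iterating the right-hand
  side from \<open>0\<close>. Each step is dominated in norm by the same step of the scalar iteration
  \<open>t \<mapsto> (1 + t\<^sup>2) / 2\<close>, which increases and is bounded by \<open>1\<close>; hence the iteration converges in
  norm as soon as \<open>\<parallel>X\<parallel> \<le> 1\<close>. The iterates are polynomials in \<open>X\<close>, so the root commutes with
  everything that commutes with \<open>X\<close>. This places roots of elements of a von Neumann algebra in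
  the algebra and yields the uniqueness of positive roots.\<close>

lemma sqrt_one_minus:
  fixes X :: "'h::chilbert_space op"
  assumes X: "selfadjoint X" and nX: "norm X \<le> 1"
  shows "\<exists>R. positive_op R \<and> R o\<^sub>L R = id_blinfun - X \<and> (\<forall>S. S o\<^sub>L X = X o\<^sub>L S \<longrightarrow> S o\<^sub>L R = R o\<^sub>L S)"
proof -
  define y where "y = rec_nat 0 (\<lambda>_ Y. (1/2) *\<^sub>R (X + (Y o\<^sub>L Y)))"
  define t where "t = rec_nat 0 (\<lambda>_ s::real. (1 + s * s) / 2)"
  have y_simps: "y 0 = 0" "\<And>n. y (Suc n) = (1/2) *\<^sub>R (X + (y n o\<^sub>L y n))"
    and t_simps: "t 0 = 0" "\<And>n. t (Suc n) = (1 + t n * t n) / 2"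
    by (simp_all add: y_def t_def)
  have t01: "0 \<le> t n \<and> t n \<le> 1" for n
  proof (induction n)
    case (Suc n)
    then show ?case using mult_le_one[of "t n" "t n"] by (simp add: t_simps)
  qed (simp add: t_simps)
  have tmono: "t n \<le> t (Suc n)" for n
    using zero_le_power2[of "1 - t n"] by (simp add: t_simps power2_eq_square algebra_simps)
  have ynorm: "norm (y n) \<le> t n" for n
  proof (induction n)
    case (Suc n)
    have "norm (y n o\<^sub>L y n) \<le> t n * t n"
      using norm_blinfun_compose[of "y n" "y n"] mult_mono[OF Suc Suc] t01[of n] by simp
    then have "norm (X + (y n o\<^sub>L y n)) \<le> 1 + t n * t n"
      using norm_triangle_ineq[of X "y n o\<^sub>L y n"] nX by linarith
    then show ?case by (simp add: y_simps t_simps)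
  qed (simp add: y_simps t_simps)
  have ystep: "norm (y (Suc n) - y n) \<le> t (Suc n) - t n" for n
  proof (induction n)
    case 0
    show ?case using ynorm[of 1] by (simp add: y_simps(1) t_simps(1))
  next
    case (Suc n)
    let ?d = "y (Suc n) - y n"
    have "y (Suc (Suc n)) - y (Suc n) = (1/2) *\<^sub>R ((y (Suc n) o\<^sub>L ?d) + (?d o\<^sub>L y n))"
      unfolding y_simps(2)[of "Suc n"] y_simps(2)[of n, THEN arg_cong[where f = "\<lambda>z. _ - z"]]
      by (rule blinfun_eqI) (simp add: blinfun.bilinear_simps algebra_simps)
    moreover have "norm (y (Suc n) o\<^sub>L ?d) \<le> t (Suc n) * (t (Suc n) - t n)"
      using norm_blinfun_compose[of "y (Suc n)" ?d] mult_mono[OF ynorm[of "Suc n"] Suc] t01[of "Suc n"]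
      by simp
    moreover have "norm (?d o\<^sub>L y n) \<le> (t (Suc n) - t n) * t n"
      using norm_blinfun_compose[of ?d "y n"] mult_mono[OF Suc ynorm[of n]] tmono[of n] by simp
    ultimately have "norm (y (Suc (Suc n)) - y (Suc n))
        \<le> (1/2) * (t (Suc n) * (t (Suc n) - t n) + (t (Suc n) - t n) * t n)"
      using norm_triangle_ineq[of "y (Suc n) o\<^sub>L ?d" "?d o\<^sub>L y n"] by simp
    also have "\<dots> = t (Suc (Suc n)) - t (Suc n)"
      by (simp add: t_simps(2)[of "Suc n"] t_simps(2)[of n, THEN arg_cong[where f = "\<lambda>z. _ - z"]] algebra_simps)
    finally show ?case .
  qed
  have ydiff: "norm (y (n + k) - y n) \<le> t (n + k) - t n" for n k
  proof (induction k)
    case (Suc k)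
    then show ?case using ystep[of "n + k"] norm_triangle_ineq[of "y (Suc (n + k)) - y (n + k)" "y (n + k) - y n"]
      by simp
  qed simp
  have "incseq t" using tmono by (rule incseq_SucI)
  then have "convergent t"
    by (rule incseq_convergent[of t 1]) (use t01 in \<open>auto simp: convergent_def\<close>)
  then have tC: "Cauchy t" by (rule convergent_Cauchy)
  have "Cauchy y"
  proof (rule CauchyI')
    fix e :: real assume "0 < e"
    with tC obtain N where N: "\<And>m n. m \<ge> N \<Longrightarrow> n \<ge> N \<Longrightarrow> norm (t m - t n) < e"
      using CauchyD by metis
    have "norm (y m - y n) < e" if "N \<le> m" "m < n" for m n
      using ydiff[of m "n - m"] N[of n m] that by (simp add: norm_minus_commute)
    then show "\<exists>M. \<forall>m\<ge>M. \<forall>n>m. dist (y m) (y n) < e" unfolding dist_norm by blast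
  qed
  then obtain Y where Y: "y \<longlonglongrightarrow> Y" using Cauchy_convergent convergent_def by blast
  have "(\<lambda>n. (1/2) *\<^sub>R (X + (y n o\<^sub>L y n))) \<longlonglongrightarrow> (1/2) *\<^sub>R (X + (Y o\<^sub>L Y))"
    by (intro tendsto_intros tendsto_compose Y)
  then have Yeq: "Y = (1/2) *\<^sub>R (X + (Y o\<^sub>L Y))"
    by (intro LIMSEQ_unique[OF LIMSEQ_Suc[OF Y]]) (simp only: y_simps)
  have "selfadjoint (y n)" for n
    by (induction n)
      (auto simp: y_simps intro!: selfadjoint_0 selfadjoint_scaleR selfadjoint_add X selfadjoint_compose_commute)
  then have sY: "selfadjoint Y" by (rule selfadjoint_strong_limit[OF tendsto_apply[OF Y]])
  have "norm (y n) \<le> 1" for n using ynorm[of n] t01[of n] by linarith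
  then have nY: "norm Y \<le> 1" using LIMSEQ_le_const2[OF tendsto_norm[OF Y]] by blast
  have "positive_op (id_blinfun - Y)"
    unfolding positive_op_iff
  proof (intro conjI allI)
    fix x
    have "rin (Y x) x \<le> norm Y * (norm x)\<^sup>2" using rin_le_norm[of Y x] by linarith
    also have "\<dots> \<le> (norm x)\<^sup>2" using mult_right_mono[OF nY, of "(norm x)\<^sup>2"] by simp
    finally show "0 \<le> rin ((id_blinfun - Y) x) x"
      by (simp add: blinfun.bilinear_simps rin_simps rin_self)
  qed (simp add: selfadjoint_diff selfadjoint_id sY)
  moreover have "(id_blinfun - Y) o\<^sub>L (id_blinfun - Y) = id_blinfun - X"
  proof (rule blinfun_eqI)
    fix x
    have "2 *\<^sub>R Y = X + (Y o\<^sub>L Y)" using arg_cong[OF Yeq, of "\<lambda>Z. 2 *\<^sub>R Z"] by simp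
    then have "2 *\<^sub>R Y x = X x + Y (Y x)"
      by (metis blinfun.scaleR_left blinfun.add_left blinfun_apply_blinfun_compose)
    then have "Y x + Y x = X x + Y (Y x)" by (simp add: scaleR_2)
    then show "((id_blinfun - Y) o\<^sub>L (id_blinfun - Y)) x = (id_blinfun - X) x"
      by (simp add: blinfun.bilinear_simps algebra_simps)
  qed
  moreover have "S o\<^sub>L (id_blinfun - Y) = (id_blinfun - Y) o\<^sub>L S" if S: "S o\<^sub>L X = X o\<^sub>L S" for S
  proof -
    have *: "S (X x) = X (S x)" for x using S by (metis blinfun_apply_blinfun_compose)
    have "\<forall>x. S (y n x) = y n (S x)" for n
      by (induction n) (simp_all add: y_simps blinfun.bilinear_simps *)
    then have "S o\<^sub>L Y = Y o\<^sub>L S"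
      by (intro commute_strong_limit[OF tendsto_apply[OF Y]]) (auto intro!: blinfun_eqI)
    then have "S (Y x) = Y (S x)" for x by (metis blinfun_apply_blinfun_compose)
    then show ?thesis by (intro blinfun_eqI) (simp add: blinfun.bilinear_simps)
  qed
  ultimately show ?thesis by blast
qed

lemma ex_positive_sqrt:
  fixes T :: "'h::chilbert_space op"
  assumes T: "positive_op T"
  shows "\<exists>R. positive_op R \<and> R o\<^sub>L R = T \<and> (\<forall>S. S o\<^sub>L T = T o\<^sub>L S \<longrightarrow> S o\<^sub>L R = R o\<^sub>L S)"
proof -
  define c where "c = norm T + 1"
  have c: "0 < c" by (simp add: c_def add_nonneg_pos)
  define X where "X = id_blinfun - (1/c) *\<^sub>R T"
  have saX: "selfadjoint X" using T unfolding X_def positive_op_iff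
    by (intro selfadjoint_diff selfadjoint_id selfadjoint_scaleR) simp
  have le: "rin (T x) x \<le> c * (norm x)\<^sup>2" for x
    using rin_le_norm[of T x] zero_le_power2[of "norm x"]
    unfolding c_def distrib_right by linarith
  have "norm X \<le> 1"
  proof (rule positive_norm_le)
    show "positive_op X" unfolding positive_op_iff using saX le c
      by (auto simp: X_def blinfun.bilinear_simps rin_simps rin_self field_simps)
    show "rin (X x) x \<le> 1 * (norm x)\<^sup>2" for x
      using T c by (auto simp: X_def positive_op_iff blinfun.bilinear_simps rin_simps rin_self)
  qed simp
  then obtain R where R: "positive_op R" "R o\<^sub>L R = id_blinfun - X"
    and comm: "\<And>S. S o\<^sub>L X = X o\<^sub>L S \<Longrightarrow> S o\<^sub>L R = R o\<^sub>L S"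
    using sqrt_one_minus[OF saX] by blast
  have RR: "R (R x) = (1/c) *\<^sub>R T x" for x
    using arg_cong[OF R(2), of "\<lambda>Z. blinfun_apply Z x"] by (simp add: X_def blinfun.bilinear_simps)
  show ?thesis
  proof (intro exI[of _ "sqrt c *\<^sub>R R"] conjI allI impI)
    show "positive_op (sqrt c *\<^sub>R R)" using R c by (simp add: positive_scaleR)
    show "(sqrt c *\<^sub>R R) o\<^sub>L (sqrt c *\<^sub>R R) = T"
      using c by (intro blinfun_eqI) (simp add: blinfun.bilinear_simps RR)
    fix S assume "S o\<^sub>L T = T o\<^sub>L S"
    then have *: "S (T x) = T (S x)" for x by (metis blinfun_apply_blinfun_compose)
    have "S o\<^sub>L R = R o\<^sub>L S"
      by (rule comm, rule blinfun_eqI) (simp add: X_def blinfun.bilinear_simps *)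
    then have "S (R x) = R (S x)" for x by (metis blinfun_apply_blinfun_compose)
    then show "S o\<^sub>L sqrt c *\<^sub>R R = sqrt c *\<^sub>R R o\<^sub>L S"
      by (intro blinfun_eqI) (simp add: blinfun.bilinear_simps)
  qed
qed

text \<open>For commuting \<open>S\<close> and \<open>R\<close> one has \<open>(S + R) (S - R) = S\<^sup>2 - R\<^sup>2 = 0\<close>. Hence \<open>S + R\<close> vanishes on the
  range of \<open>S - R\<close>, and by positivity so do \<open>S\<close> and \<open>R\<close>; thus \<open>(S - R)\<^sup>2 = 0\<close>.\<close>

lemma positive_sqrt_unique:
  fixes S R :: "'h::chilbert_space op"
  assumes S: "positive_op S" and R: "positive_op R" and eq: "S o\<^sub>L S = R o\<^sub>L R"
    and comm: "S o\<^sub>L R = R o\<^sub>L S"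
  shows "S = R"
proof (rule blinfun_eqI)
  fix x
  have eq': "S (S v) = R (R v)" and comm': "S (R v) = R (S v)" for v
    using eq comm by (metis blinfun_apply_blinfun_compose)+
  define y where "y = S x - R x"
  have "S y + R y = 0" by (simp add: y_def blinfun.bilinear_simps eq' comm')
  then have "rin (S y + R y) y = 0" by (simp add: rin_simps)
  then have "rin (S y) y + rin (R y) y = 0" by (simp only: rin.add_left)
  then have "rin (S y) y = 0" "rin (R y) y = 0" using S R unfolding positive_op_iff by (smt (verit))+
  then have "S y = 0" "R y = 0" using positive_null S R by auto
  have "selfadjoint (S - R)" using S R by (simp add: positive_op_iff selfadjoint_diff)
  then have "rin y y = rin x ((S - R) y)"
    using selfadjoint_rin[of "S - R" x y] by (simp add: y_def blinfun.bilinear_simps)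
  also have "\<dots> = 0" by (simp add: blinfun.bilinear_simps \<open>S y = 0\<close> \<open>R y = 0\<close> rin_simps)
  finally show "S x = R x" by (simp add: rin_self y_def)
qed

lemma abs_op_props:
  fixes T :: "'h::chilbert_space op"
  assumes T: "T \<in> bounded_ops"
  shows positive_abs_op: "positive_op (abs_op T)"
    and abs_op_sq: "abs_op T o\<^sub>L abs_op T = adj T o\<^sub>L T"
    and abs_op_commute: "S o\<^sub>L (adj T o\<^sub>L T) = (adj T o\<^sub>L T) o\<^sub>L S \<Longrightarrow> S o\<^sub>L abs_op T = abs_op T o\<^sub>L S"
proof -
  obtain R where R: "positive_op R" "R o\<^sub>L R = adj T o\<^sub>L T"
    and comm: "\<And>S. S o\<^sub>L (adj T o\<^sub>L T) = (adj T o\<^sub>L T) o\<^sub>L S \<Longrightarrow> S o\<^sub>L R = R o\<^sub>L S"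
    using ex_positive_sqrt[OF positive_adj_compose[OF T]] by blast
  have "Q = R" if "positive_op Q" "Q o\<^sub>L Q = adj T o\<^sub>L T" for Q
  proof (rule positive_sqrt_unique[OF that(1) R(1)])
    have "Q o\<^sub>L (Q o\<^sub>L Q) = (Q o\<^sub>L Q) o\<^sub>L Q" by (rule blinfun_eqI) simp
    then show "Q o\<^sub>L R = R o\<^sub>L Q" unfolding that(2) by (rule comm)
  qed (simp add: that R)
  then have "abs_op T = R" unfolding abs_op_def using R(1,2) by blast
  then show "positive_op (abs_op T)" "abs_op T o\<^sub>L abs_op T = adj T o\<^sub>L T"
    "S o\<^sub>L (adj T o\<^sub>L T) = (adj T o\<^sub>L T) o\<^sub>L S \<Longrightarrow> S o\<^sub>L abs_op T = abs_op T o\<^sub>L S"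
    using R(1,2) comm[of S] by blast+
qed

lemma norm_abs_op_apply:
  fixes T :: "'h::chilbert_space op"
  assumes T: "T \<in> bounded_ops"
  shows "norm (abs_op T x) = norm (T x)"
proof -
  have "abs_op T (abs_op T x) = adj T (T x)"
    using abs_op_sq[OF T] by (metis blinfun_apply_blinfun_compose)
  then have "rin (abs_op T x) (abs_op T x) = rin (T x) (T x)"
    using positive_abs_op[OF T] rin_adj_right[OF T, of x "T x"] selfadjoint_rin[of "abs_op T" x "abs_op T x"]
    by (simp add: positive_op_iff rin_adj_right T)
  then show ?thesis by (simp add: rin_self)
qed

section \<open>Von Neumann algebras and traces\<close>

locale vn_algebra =
  fixes M :: "'h::chilbert_space op set"
  assumes vn: "von_neumann_algebra M"
begin

lemma mem_bounded: "x \<in> M \<Longrightarrow> x \<in> bounded_ops"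
  and mem_id: "id_blinfun \<in> M"
  and mem_add: "x \<in> M \<Longrightarrow> y \<in> M \<Longrightarrow> x + y \<in> M"
  and mem_scale: "x \<in> M \<Longrightarrow> scale_op c x \<in> M"
  and mem_compose: "x \<in> M \<Longrightarrow> y \<in> M \<Longrightarrow> x o\<^sub>L y \<in> M"
  and mem_adj: "x \<in> M \<Longrightarrow> adj x \<in> M"
  using vn unfolding von_neumann_algebra_def star_subalgebra_def by blast+

lemma scaleR_eq_scale_op: "r *\<^sub>R x = scale_op (complex_of_real r) x"
  by (rule blinfun_eqI) (simp add: blinfun.bilinear_simps scaleC_of_real)

lemma mem_scaleR: "x \<in> M \<Longrightarrow> r *\<^sub>R x \<in> M"
  by (simp add: scaleR_eq_scale_op mem_scale)

lemma mem_diff: "x \<in> M \<Longrightarrow> y \<in> M \<Longrightarrow> x - y \<in> M"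
  using mem_add[of x "(-1) *\<^sub>R y"] mem_scaleR[of y "-1"] by simp

lemma mem_0: "0 \<in> M"
  using mem_scaleR[OF mem_id, of 0] by simp

lemma mem_sum: "(\<And>i. i \<in> I \<Longrightarrow> f i \<in> M) \<Longrightarrow> sum f I \<in> M"
  by (induction I rule: infinite_finite_induct) (auto simp: mem_0 mem_add)

lemmas mem_intros = mem_id mem_add mem_scale mem_compose mem_adj mem_scaleR mem_diff mem_0 mem_sum

lemma mem_bicommutant:
  assumes "T \<in> bounded_ops" and "\<And>S. \<lbrakk>\<And>x. x \<in> M \<Longrightarrow> S o\<^sub>L x = x o\<^sub>L S\<rbrakk> \<Longrightarrow> S o\<^sub>L T = T o\<^sub>L S"
  shows "T \<in> M"
proof -
  have "T \<in> commutant (commutant M)"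
    using assms unfolding commutant_def by auto
  then show ?thesis using vn unfolding von_neumann_algebra_def by simp
qed

lemma mem_strong_limit:
  fixes T :: "nat \<Rightarrow> 'h op" and T' :: "'h op"
  assumes lim: "\<And>x. (\<lambda>n. T n x) \<longlonglongrightarrow> blinfun_apply T' x" and T: "\<And>n. T n \<in> M"
  shows "T' \<in> M"
proof (rule mem_bicommutant)
  show "T' \<in> bounded_ops"
    using bounded_ops_strong_limit[OF lim] T mem_bounded by blast
  show "S o\<^sub>L T' = T' o\<^sub>L S" if "\<And>x. x \<in> M \<Longrightarrow> S o\<^sub>L x = x o\<^sub>L S" for S
    by (rule commute_strong_limit[OF lim]) (simp add: that T)
qed

lemma mem_norm_limit: "T \<longlonglongrightarrow> T' \<Longrightarrow> (\<And>n. T n \<in> M) \<Longrightarrow> T' \<in> M"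
  by (rule mem_strong_limit[OF tendsto_apply])

lemma ex_sqrt_mem:
  assumes T: "positive_op T" "T \<in> M"
  shows "\<exists>R\<in>M. positive_op R \<and> R o\<^sub>L R = T \<and> (\<forall>S. S o\<^sub>L T = T o\<^sub>L S \<longrightarrow> S o\<^sub>L R = R o\<^sub>L S)"
proof -
  obtain R where R: "positive_op R" "R o\<^sub>L R = T" "\<And>S. S o\<^sub>L T = T o\<^sub>L S \<Longrightarrow> S o\<^sub>L R = R o\<^sub>L S"
    using ex_positive_sqrt[OF T(1)] by blast
  have "R \<in> M"
  proof (rule mem_bicommutant)
    show "R \<in> bounded_ops" using R(1) by (simp add: positive_op_iff selfadjoint_iff)
    show "S o\<^sub>L R = R o\<^sub>L S" if "\<And>x. x \<in> M \<Longrightarrow> S o\<^sub>L x = x o\<^sub>L S" for S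
      by (rule R(3), rule that, rule T)
  qed
  then show ?thesis using R by blast
qed

lemma abs_op_mem: "T \<in> M \<Longrightarrow> abs_op T \<in> M"
proof (rule mem_bicommutant)
  assume T: "T \<in> M"
  then show "abs_op T \<in> bounded_ops"
    using positive_abs_op[OF mem_bounded] by (simp add: positive_op_iff selfadjoint_iff)
  show "S o\<^sub>L abs_op T = abs_op T o\<^sub>L S" if "\<And>x. x \<in> M \<Longrightarrow> S o\<^sub>L x = x o\<^sub>L S" for S
    by (rule abs_op_commute[OF mem_bounded[OF T]], rule that) (simp add: T mem_intros)
qed

text \<open>By the Cauchy--Schwarz inequality for the form of \<open>T m - T n \<ge> 0\<close>, the differences of the
  vectors \<open>T n x\<close> are controlled by those of the numbers \<open>\<langle>T n x, x\<rangle>\<close>, which increase and are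
  bounded.\<close>

lemma ex_monotone_strong_limit:
  fixes T :: "nat \<Rightarrow> 'h op"
  assumes T: "\<And>n. T n \<in> M" and sa: "\<And>n. selfadjoint (T n)"
    and mono: "\<And>n x. rin (T n x) x \<le> rin (T (Suc n) x) x"
    and lo: "\<And>n x. 0 \<le> rin (T n x) x" and up: "\<And>n x. rin (T n x) x \<le> (norm x)\<^sup>2"
  shows "\<exists>T'\<in>M. selfadjoint T' \<and> (\<forall>x. (\<lambda>n. T n x) \<longlonglongrightarrow> blinfun_apply T' x)"
proof -
  have pos: "positive_op (T n)" for n using sa lo by (simp add: positive_op_iff)
  have nT: "norm (T n) \<le> 1" for n by (rule positive_norm_le[OF pos]) (use up in auto)
  have "convergent (\<lambda>n. T n x)" for x
  proof -
    let ?a = "\<lambda>n. rin (T n x) x"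
    have inc: "incseq ?a" using mono by (auto intro: incseq_SucI)
    have "convergent ?a"
      by (rule incseq_convergent[OF inc, of "(norm x)\<^sup>2"]) (use up in \<open>auto simp: convergent_def\<close>)
    then have C: "Cauchy ?a" by (rule convergent_Cauchy)
    have key: "(norm (T m x - T n x))\<^sup>2 \<le> ?a m - ?a n" if "n \<le> m" for m n
    proof -
      have mono': "rin (T n v) v \<le> rin (T m v) v" for v
        using that lift_Suc_mono_le[of "\<lambda>n. rin (T n v) v"] mono by blast
      have "(norm ((T m - T n) x))\<^sup>2 \<le> 1 * rin ((T m - T n) x) x"
      proof (rule positive_norm_sq_le)
        show "positive_op (T m - T n)"
          using mono' by (simp add: positive_op_iff selfadjoint_diff sa blinfun.bilinear_simps rin_simps)
        show "rin ((T m - T n) v) v \<le> 1 * (norm v)\<^sup>2" for v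
          using up[of m v] lo[of n v] by (simp add: blinfun.bilinear_simps rin_simps)
      qed simp
      then show ?thesis by (simp add: blinfun.bilinear_simps rin_simps)
    qed
    have "Cauchy (\<lambda>n. T n x)"
    proof (rule CauchyI')
      fix e :: real assume e: "0 < e"
      then obtain N where N: "\<And>m n. m \<ge> N \<Longrightarrow> n \<ge> N \<Longrightarrow> norm (?a m - ?a n) < e\<^sup>2"
        using CauchyD[OF C, of "e\<^sup>2"] by auto
      have "norm (T m x - T n x) < e" if "N \<le> m" "m < n" for m n
      proof (rule power2_less_imp_less)
        have "(norm (T n x - T m x))\<^sup>2 \<le> \<bar>?a n - ?a m\<bar>" using key[of m n] that by linarith
        also have "\<dots> < e\<^sup>2" using N[of n m] that by simp
        finally show "(norm (T m x - T n x))\<^sup>2 < e\<^sup>2" by (simp add: norm_minus_commute)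
      qed (use e in simp)
      then show "\<exists>N. \<forall>m\<ge>N. \<forall>n>m. dist (T m x) (T n x) < e" unfolding dist_norm by blast
    qed
    then show ?thesis by (rule Cauchy_convergent)
  qed
  then obtain L where L: "\<And>x. (\<lambda>n. T n x) \<longlonglongrightarrow> L x" unfolding convergent_def by metis
  have "bounded_linear L"
  proof (rule bounded_linear_intro[where K = 1])
    show "L (x + y) = L x + L y" for x y
      by (rule LIMSEQ_unique[OF L]) (auto simp: blinfun.bilinear_simps intro!: tendsto_add L)
    show "L (r *\<^sub>R x) = r *\<^sub>R L x" for r x
      by (rule LIMSEQ_unique[OF L]) (auto simp: blinfun.bilinear_simps intro!: tendsto_intros L)
    fix x
    have "norm (T n x) \<le> norm x" for n
      using norm_blinfun[of "T n" x] mult_right_mono[OF nT[of n] norm_ge_zero[of x]] by simp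
    then show "norm (L x) \<le> norm x * 1"
      using LIMSEQ_le_const2[OF tendsto_norm[OF L[of x]]] by auto
  qed
  then have lim: "(\<lambda>n. T n x) \<longlonglongrightarrow> blinfun_apply (Blinfun L) x" for x using L by (simp add: bounded_linear_Blinfun_apply)
  show ?thesis
    using mem_strong_limit[OF lim T] selfadjoint_strong_limit[OF lim sa] lim by blast
qed

end

locale tracial_vn = vn_algebra +
  fixes \<tau> :: "'h::chilbert_space op \<Rightarrow> complex"
  assumes trace: "faithful_normal_tracial_state M \<tau>"
begin

definition tr :: "'h op \<Rightarrow> real" where "tr x = Re (\<tau> x)"

lemma tr_add: "x \<in> M \<Longrightarrow> y \<in> M \<Longrightarrow> tr (x + y) = tr x + tr y"
  and tr_id: "tr id_blinfun = 1"
  and tr_commute: "x \<in> M \<Longrightarrow> y \<in> M \<Longrightarrow> tr (x o\<^sub>L y) = tr (y o\<^sub>L x)"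
  and tr_nonneg: "x \<in> M \<Longrightarrow> positive_op x \<Longrightarrow> 0 \<le> tr x"
  using trace unfolding faithful_normal_tracial_state_def state_on_def tracial_on_def tr_def by auto

lemma tr_faithful: "x \<in> M \<Longrightarrow> positive_op x \<Longrightarrow> tr x = 0 \<Longrightarrow> x = 0"
  using trace unfolding faithful_normal_tracial_state_def state_on_def faithful_on_def tr_def
  by (metis complex_is_Real_iff complex_eq_iff zero_complex.simps)

lemma tr_scaleR: "x \<in> M \<Longrightarrow> tr (r *\<^sub>R x) = r * tr x"
  using trace unfolding faithful_normal_tracial_state_def state_on_def tr_def scaleR_eq_scale_op by simp

lemma tr_diff: "x \<in> M \<Longrightarrow> y \<in> M \<Longrightarrow> tr (x - y) = tr x - tr y"
  using tr_add[of x "(-1) *\<^sub>R y"] tr_scaleR[of y "-1"] mem_scaleR[of y "-1"] by simp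

lemma tr_0: "tr 0 = 0"
  using tr_scaleR[OF mem_id, of 0] by simp

lemma tr_sum: "(\<And>i. i \<in> I \<Longrightarrow> f i \<in> M) \<Longrightarrow> tr (sum f I) = (\<Sum>i\<in>I. tr (f i))"
  by (induction I rule: infinite_finite_induct) (auto simp: tr_0 tr_add mem_sum)

lemma tr_mono:
  assumes "x \<in> M" "y \<in> M" "selfadjoint x" "selfadjoint y" "\<And>v. rin (x v) v \<le> rin (y v) v"
  shows "tr x \<le> tr y"
proof -
  have "positive_op (y - x)"
    using assms by (simp add: positive_op_iff selfadjoint_diff blinfun.bilinear_simps rin_simps)
  then show ?thesis using tr_nonneg[of "y - x"] assms by (simp add: mem_diff tr_diff)
qed

text \<open>The strong limit of an increasing sequence is its least upper bound, which is where normality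
  applies.\<close>

lemma tr_monotone_limit:
  fixes T :: "nat \<Rightarrow> 'h op" and T' :: "'h op"
  assumes T: "\<And>n. T n \<in> M" and sa: "\<And>n. selfadjoint (T n)"
    and mono: "\<And>n x. rin (T n x) x \<le> rin (T (Suc n) x) x"
    and T': "T' \<in> M" and lim: "\<And>x. (\<lambda>n. T n x) \<longlonglongrightarrow> blinfun_apply T' x"
  shows "(\<lambda>n. tr (T n)) \<longlonglongrightarrow> tr T'"
proof -
  have sa': "selfadjoint T'" by (rule selfadjoint_strong_limit[OF lim sa])
  have inc: "incseq (\<lambda>n. rin (T n x) x)" for x using mono by (auto intro: incseq_SucI)
  have rlim: "(\<lambda>n. rin (T n x) x) \<longlonglongrightarrow> rin (T' x) x" for x by (intro rin.tendsto lim tendsto_const)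
  have le: "rin (T n x) x \<le> rin (T' x) x" for n x
    using incseq_le[OF inc rlim] .
  have lub: "is_lub_in M (range T) T'"
    unfolding is_lub_in_def
  proof (intro conjI ballI impI T' sa')
    show "op_le x T'" if "x \<in> range T" for x using that le by (auto simp: op_le_iff sa sa')
    fix t assume t: "t \<in> M" "selfadjoint t \<and> (\<forall>x\<in>range T. op_le x t)"
    then have "rin (T n x) x \<le> rin (t x) x" for n x by (auto simp: op_le_iff sa)
    then have "rin (T' x) x \<le> rin (t x) x" for x using LIMSEQ_le_const2[OF rlim] by blast
    then show "op_le T' t" using t by (simp add: op_le_iff sa')
  qed
  have dir: "\<forall>x\<in>range T. \<forall>y\<in>range T. \<exists>z\<in>range T. op_le x z \<and> op_le y z"
  proof clarsimp
    fix m n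
    have "op_le (T m) (T (max m n))" "op_le (T n) (T (max m n))"
      using incseqD[OF inc] by (auto simp: op_le_iff sa)
    then show "\<exists>k. op_le (T m) (T k) \<and> op_le (T n) (T k)" by blast
  qed
  have "normal_on M \<tau>" using trace by (simp add: faithful_normal_tracial_state_def)
  then have "tr T' = (SUP x\<in>range T. tr x)"
    unfolding normal_on_def tr_def using lub dir T sa
    by (elim allE[of _ "range T"] allE[of _ T']) blast
  moreover have "incseq (\<lambda>n. tr (T n))" using T sa mono by (auto intro!: incseq_SucI tr_mono)
  moreover have "bdd_above (range (\<lambda>n. tr (T n)))"
    using T T' sa sa' le by (auto intro!: bdd_aboveI[of _ "tr T'"] tr_mono)
  ultimately show ?thesis using LIMSEQ_incseq_SUP[of "\<lambda>n. tr (T n)"] by (simp add: image_image)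
qed

end

section \<open>Kernel projections, spectral projections and joins\<close>

primrec opow :: "'h::chilbert_space op \<Rightarrow> nat \<Rightarrow> 'h op" where
  "opow b 0 = id_blinfun"
| "opow b (Suc n) = b o\<^sub>L opow b n"

lemma opow_add: "opow b (m + n) x = opow b m (opow b n x)"
  by (induction m) auto

lemma opow_commute_apply:
  fixes S b :: "'h::chilbert_space op"
  assumes "\<And>x. S (b x) = b (S x)"
  shows "S (opow b n x) = opow b n (S x)"
  by (induction n) (auto simp: assms)

lemma selfadjoint_opow: "selfadjoint b \<Longrightarrow> selfadjoint (opow b n)"
proof (induction n)
  case (Suc n)
  have "b o\<^sub>L opow b n = opow b n o\<^sub>L b"
    by (rule blinfun_eqI) (simp add: opow_commute_apply[of b b])
  then show ?case using Suc by (simp add: selfadjoint_compose_commute)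
qed (simp add: selfadjoint_id)

text \<open>Half of the factors can be moved to the other side of the inner product; the remaining form is
  that of \<open>1\<close> or of \<open>b\<close>.\<close>

lemma positive_opow:
  assumes b: "positive_op b"
  shows "0 \<le> rin (opow b n x) x"
proof -
  define k where "k = n div 2"
  have sa: "rin (opow b k u) v = rin u (opow b k v)" for u v
    using b by (intro selfadjoint_rin selfadjoint_opow) (simp add: positive_op_iff)
  show ?thesis
  proof (cases "even n")
    case True
    then have "n = k + k" by (auto simp: k_def)
    then show ?thesis by (simp only: opow_add sa rin_self) simp
  next
    case False
    then have n: "n = k + Suc k" by (auto simp: k_def elim!: oddE)
    have "rin (opow b n x) x = rin (b (opow b k x)) (opow b k x)"
      unfolding n opow_add sa by simp
    then show ?thesis using b by (simp add: positive_op_iff)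
  qed
qed

lemma commute_apply:
  fixes S T :: "'h::chilbert_space op"
  shows "S o\<^sub>L T = T o\<^sub>L S \<Longrightarrow> S (T x) = T (S x)"
  by (metis blinfun_apply_blinfun_compose)

context vn_algebra
begin

lemma mem_opow: "b \<in> M \<Longrightarrow> opow b n \<in> M"
  by (induction n) (auto simp: mem_intros)

text \<open>Let \<open>b = 1 - s\<close> and let \<open>r\<close> be the positive root of \<open>s\<close>. The powers of \<open>b\<close> decrease because
  \<open>\<langle>b\<^sup>n s x, x\<rangle> = \<langle>b\<^sup>n r x, r x\<rangle> \<ge> 0\<close>, and their strong limit \<open>q\<close> satisfies \<open>b q = q\<close>; so \<open>q\<close> is
  the projection onto the kernel of \<open>s\<close>. The monotonicity is part of the conclusion because
  normality of the trace will be applied to these powers.\<close>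

lemma ex_kernel_projection:
  assumes s: "s \<in> M" "positive_op s" and le: "\<And>x. rin (s x) x \<le> (norm x)\<^sup>2"
  shows "\<exists>q\<in>M. projection q \<and> (\<forall>x. s (q x) = 0) \<and>
      (\<forall>x. (\<lambda>n. opow (id_blinfun - s) n x) \<longlonglongrightarrow> q x) \<and>
      (\<forall>n x. rin (opow (id_blinfun - s) (Suc n) x) x \<le> rin (opow (id_blinfun - s) n x) x)"
proof -
  define b where "b = id_blinfun - s"
  have bx: "b x = x - s x" for x by (simp add: b_def blinfun.bilinear_simps)
  have sab: "selfadjoint b" using s by (simp add: b_def selfadjoint_diff selfadjoint_id positive_op_iff)
  have posb: "positive_op b" using sab le by (simp add: positive_op_iff bx rin_simps rin_self)
  obtain r where r: "positive_op r" "r o\<^sub>L r = s" "\<And>S. S o\<^sub>L s = s o\<^sub>L S \<Longrightarrow> S o\<^sub>L r = r o\<^sub>L S"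
    using ex_sqrt_mem[OF s(2,1)] by blast
  have rr: "r (r x) = s x" for x using r(2) by (metis blinfun_apply_blinfun_compose)
  have "r (b x) = b (r x)" for x by (simp add: bx blinfun.bilinear_simps flip: rr)
  then have rb: "r (opow b n x) = opow b n (r x)" for n x by (rule opow_commute_apply)
  have dec: "rin (opow b (Suc n) x) x \<le> rin (opow b n x) x" for n x
  proof -
    have "opow b (Suc n) x = opow b n x - r (opow b n (r x))"
      by (simp add: bx rr flip: rb)
    moreover have "rin (r (opow b n (r x))) x = rin (opow b n (r x)) (r x)"
      using r(1) by (simp add: positive_op_iff selfadjoint_rin)
    ultimately show ?thesis using positive_opow[OF posb, of n "r x"] by (simp add: rin_simps)
  qed
  have up: "rin (opow b n x) x \<le> (norm x)\<^sup>2" for n x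
    by (induction n) (use dec[of _ x] in \<open>auto simp: rin_self intro: order_trans\<close>)
  have bM: "b \<in> M" using s by (simp add: b_def mem_intros)
  have "\<exists>T'\<in>M. selfadjoint T' \<and> (\<forall>x. (\<lambda>n. (id_blinfun - opow b n) x) \<longlonglongrightarrow> T' x)"
    using dec up positive_opow[OF posb] bM
    by (intro ex_monotone_strong_limit)
      (auto simp: mem_intros mem_opow selfadjoint_diff selfadjoint_id selfadjoint_opow sab
        blinfun.bilinear_simps rin_simps rin_self simp del: opow.simps(2))
  then obtain T' where T': "T' \<in> M" "selfadjoint T'" "\<And>x. (\<lambda>n. (id_blinfun - opow b n) x) \<longlonglongrightarrow> T' x"
    by blast
  define q where "q = id_blinfun - T'"
  have qx: "q x = x - T' x" for x by (simp add: q_def blinfun.bilinear_simps)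
  have lim: "(\<lambda>n. opow b n x) \<longlonglongrightarrow> q x" for x
    using tendsto_diff[OF tendsto_const[of x] T'(3)[of x]] by (simp add: qx blinfun.bilinear_simps)
  have bq: "b (q x) = q x" for x
  proof (rule LIMSEQ_unique[OF _ lim[THEN LIMSEQ_Suc]])
    show "(\<lambda>n. opow b (Suc n) x) \<longlonglongrightarrow> b (q x)" by (auto intro!: tendsto_intros lim)
  qed
  then have "opow b n (q x) = q x" for n x by (induction n) auto
  then have "q (q x) = q x" for x using lim[of "q x"] by (simp add: LIMSEQ_const_iff)
  then have "projection q" using T'(2) by (simp add: projection_iff q_def selfadjoint_diff selfadjoint_id)
  moreover have "s (q x) = 0" for x using bq[of x] bx[of "q x"] by simp
  moreover have "q \<in> M" using T' by (simp add: q_def mem_intros)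
  ultimately show ?thesis using lim dec unfolding b_def by blast
qed

text \<open>The spectral projection of \<open>s\<close> for the interval \<open>(d, \<infinity>)\<close>. With
  \<open>h = s - d\<close> and \<open>a = \<bar>h\<bar>\<close> one has \<open>(a - h) (a + h) = 0\<close>, so \<open>h = - a\<close> on the kernel of \<open>a + h\<close> and
  \<open>h = a\<close> on its orthogonal complement.\<close>

lemma ex_spectral_projection:
  assumes s: "s \<in> M" "positive_op s" and d: "0 < d"
  shows "\<exists>f\<in>M. projection f \<and> (\<forall>x. f (s x) = s (f x)) \<and> (\<forall>x. norm (s (x - f x)) \<le> d * norm x) \<and>
      (\<forall>x. d * (norm (f x))\<^sup>2 \<le> rin (s (f x)) (f x))"
proof -
  define h where "h = s - d *\<^sub>R id_blinfun"
  have hM: "h \<in> M" using s by (simp add: h_def mem_intros)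
  have hx: "h x = s x - d *\<^sub>R x" for x by (simp add: h_def blinfun.bilinear_simps)
  have sas: "selfadjoint s" using s by (simp add: positive_op_iff)
  then have sah: "selfadjoint h" by (simp add: h_def selfadjoint_diff selfadjoint_scaleR selfadjoint_id)
  have poshh: "positive_op (h o\<^sub>L h)"
    using sah by (auto simp: positive_op_iff selfadjoint_rin rin_self intro!: selfadjoint_compose_commute)
  obtain a where a: "a \<in> M" "positive_op a" "a o\<^sub>L a = h o\<^sub>L h"
    and comma: "\<And>S. S o\<^sub>L (h o\<^sub>L h) = (h o\<^sub>L h) o\<^sub>L S \<Longrightarrow> S o\<^sub>L a = a o\<^sub>L S"
    using ex_sqrt_mem[OF poshh mem_compose[OF hM hM]] by blast
  have aa: "a (a x) = h (h x)" for x using a(3) by (metis blinfun_apply_blinfun_compose)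
  have sh: "s (h x) = h (s x)" for x by (simp add: hx blinfun.bilinear_simps)
  have "h o\<^sub>L a = a o\<^sub>L h" "s o\<^sub>L a = a o\<^sub>L s"
    by (rule comma, rule blinfun_eqI, simp add: sh)+
  then have ha: "h (a x) = a (h x)" and sa: "s (a x) = a (s x)" for x
    by (simp_all add: commute_apply)
  define u where "u = a + h"
  have ux: "u x = a x + h x" for x by (simp add: u_def blinfun.bilinear_simps)
  have sau: "selfadjoint u" using a(2) sah by (simp add: u_def selfadjoint_add positive_op_iff)
  \<comment> \<open>\<open>u\<^sup>2\<close> has the kernel of \<open>u\<close> and is visibly positive; \<open>k\<close> scales it to a contraction\<close>
  define k where "k = 1 / (norm (u o\<^sub>L u) + 1)"
  have k: "0 < k" "k * norm (u o\<^sub>L u) \<le> 1"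
    by (simp_all add: k_def add_nonneg_pos divide_le_eq)
  define w where "w = k *\<^sub>R (u o\<^sub>L u)"
  have wx: "w x = k *\<^sub>R u (u x)" for x by (simp add: w_def blinfun.bilinear_simps)
  have wM: "w \<in> M" by (simp add: w_def u_def mem_intros a hM)
  have rw: "rin (w x) x = k * (norm (u x))\<^sup>2" for x
    by (simp add: wx rin_simps selfadjoint_rin[OF sau, of _ x] rin_self)
  have posw: "positive_op w"
    unfolding positive_op_iff rw using k sau
    by (auto simp: w_def intro!: selfadjoint_scaleR selfadjoint_compose_commute)
  have lew: "rin (w x) x \<le> (norm x)\<^sup>2" for x
  proof -
    have "rin (w x) x = k * rin ((u o\<^sub>L u) x) x" by (simp add: wx rin_simps)
    also have "\<dots> \<le> k * (norm (u o\<^sub>L u) * (norm x)\<^sup>2)"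
      using k rin_le_norm[of "u o\<^sub>L u" x] by (intro mult_left_mono) auto
    also have "\<dots> \<le> (norm x)\<^sup>2" using mult_right_mono[OF k(2), of "(norm x)\<^sup>2"] by (simp add: mult.assoc)
    finally show ?thesis .
  qed
  define b where "b = id_blinfun - w"
  have bx: "b x = x - w x" for x by (simp add: b_def blinfun.bilinear_simps)
  obtain q where q: "q \<in> M" "projection q" "\<And>x. w (q x) = 0" "\<And>x. (\<lambda>n. opow b n x) \<longlonglongrightarrow> q x"
    using ex_kernel_projection[OF wM posw lew] unfolding b_def by blast
  have uq: "u (q x) = 0" for x using rw[of "q x"] k by (simp add: q(3) rin_simps)
  have sw: "s (w x) = w (s x)" for x
    by (simp add: wx ux blinfun.bilinear_simps sh sa)
  then have "s (opow b n x) = opow b n (s x)" for n x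
    by (intro opow_commute_apply) (simp add: bx blinfun.bilinear_simps)
  then have "(\<lambda>n. s (opow b n x)) \<longlonglongrightarrow> q (s x)" for x using q(4)[of "s x"] by simp
  moreover have "(\<lambda>n. s (opow b n x)) \<longlonglongrightarrow> s (q x)" for x by (intro tendsto_intros q)
  ultimately have sq: "s (q x) = q (s x)" for x using LIMSEQ_unique by blast
  \<comment> \<open>\<open>a - h\<close> annihilates \<open>w\<close>, hence absorbs all powers of \<open>1 - w\<close>\<close>
  have "(a - h) (w x) = 0" for x
    by (simp add: wx ux blinfun.bilinear_simps ha aa)
  then have "(a - h) (opow b n x) = (a - h) x" for n x
    by (induction n) (simp_all add: bx blinfun.diff_right)
  then have "(a - h) x = (a - h) (q x)" for x
    using blinfun.tendsto[OF tendsto_const[of "a - h"] q(4)[of x]] by (simp add: LIMSEQ_const_iff)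
  then have ahf: "(a - h) (x - q x) = 0" for x by (simp add: blinfun.diff_right)
  define f where "f = id_blinfun - q"
  have fx: "f x = x - q x" for x by (simp add: f_def blinfun.bilinear_simps)
  have "norm (s o\<^sub>L q) \<le> d"
  proof (rule positive_norm_le)
    have saq: "selfadjoint q" using q(2) by (simp add: projection_iff)
    have "selfadjoint (s o\<^sub>L q)"
      by (rule selfadjoint_compose_commute[OF sas saq]) (rule blinfun_eqI, simp add: sq)
    have eq: "rin ((s o\<^sub>L q) x) x = rin (s (q x)) (q x)" for x
      using q(2) selfadjoint_rin[OF saq, of "s x" "q x"] by (simp add: sq projection_iff)
        (metis sq projection_iff selfadjoint_rin[OF saq])
    then show "positive_op (s o\<^sub>L q)"
      using \<open>selfadjoint (s o\<^sub>L q)\<close> s(2) by (simp add: positive_op_iff)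
    fix x
    have "h (q x) = - a (q x)" using uq[of x] by (simp add: ux add_eq_0_iff)
    then have "s (q x) = d *\<^sub>R q x - a (q x)" using hx[of "q x"] by (simp add: algebra_simps)
    then have "rin (s (q x)) (q x) = d * (norm (q x))\<^sup>2 - rin (a (q x)) (q x)"
      by (simp add: rin_simps rin_self)
    also have "\<dots> \<le> d * (norm (q x))\<^sup>2" using a(2) by (simp add: positive_op_iff)
    also have "\<dots> \<le> d * (norm x)\<^sup>2"
      using d projection_rin[OF q(2), of x] projection_rin_le[OF q(2), of x] by simp
    finally show "rin ((s o\<^sub>L q) x) x \<le> d * (norm x)\<^sup>2" unfolding eq .
  qed (use d in simp)
  then have "norm (s (x - f x)) \<le> d * norm x" for x
    using norm_blinfun[of "s o\<^sub>L q" x] mult_right_mono[of "norm (s o\<^sub>L q)" d "norm x"] by (simp add: fx)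
  moreover have "d * (norm (f x))\<^sup>2 \<le> rin (s (f x)) (f x)" for x
  proof -
    have "h (f x) = a (f x)" using ahf[of x] by (simp add: fx blinfun.diff_left)
    then have "s (f x) = d *\<^sub>R f x + a (f x)" using hx[of "f x"] by (simp add: algebra_simps)
    then have "rin (s (f x)) (f x) = d * (norm (f x))\<^sup>2 + rin (a (f x)) (f x)"
      by (simp add: rin_simps rin_self)
    then show ?thesis using a(2) by (simp add: positive_op_iff)
  qed
  moreover have "f \<in> M" "projection f" using q by (simp_all add: f_def mem_intros projection_complement)
  moreover have "f (s x) = s (f x)" for x by (simp add: fx sq blinfun.diff_right)
  ultimately show ?thesis by blast
qed

end

context tracial_vn
begin

text \<open>\<open>g = c f z f\<close> satisfies \<open>g\<^sup>2 \<le> g\<close>, because \<open>c f \<le> s\<close> and \<open>z s z \<le> z\<close>. A positive operator with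
  this property is a contraction, and so \<open>g = f g f \<le> f\<close>.\<close>

lemma tr_compress_le:
  assumes f: "f \<in> M" "projection f" and z: "z \<in> M" "positive_op z" and s: "selfadjoint s"
    and c: "0 \<le> c" "\<And>x. c * rin (f x) x \<le> rin (s x) x"
    and zsz: "\<And>x. rin (s (z x)) (z x) \<le> rin (z x) x"
  shows "c * tr (f o\<^sub>L z) \<le> tr f"
proof -
  have saf: "selfadjoint f" and ff: "f (f x) = f x" for x using f(2) by (auto simp: projection_iff)
  have saz: "selfadjoint z" using z(2) by (simp add: positive_op_iff)
  define g where "g = c *\<^sub>R (f o\<^sub>L z o\<^sub>L f)"
  have gx: "g x = c *\<^sub>R f (z (f x))" for x by (simp add: g_def blinfun.bilinear_simps)
  have gM: "g \<in> M" using f z by (simp add: g_def mem_intros)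
  have rg: "rin (g x) x = c * rin (z (f x)) (f x)" for x
    by (simp add: gx rin_simps selfadjoint_rin[OF saf, of _ x])
  have sag: "selfadjoint g"
    unfolding g_def selfadjoint_iff using f z
    by (auto simp: bounded_ops_scaleR bounded_ops_compose mem_bounded blinfun.bilinear_simps rin_simps
        selfadjoint_rin[OF saf] selfadjoint_rin[OF saz])
  have gg: "(norm (g x))\<^sup>2 \<le> rin (g x) x" for x
  proof -
    have "(norm (g x))\<^sup>2 = c * (c * rin (f (z (f x))) (z (f x)))"
      by (simp add: gx power_mult_distrib projection_rin[OF f(2)]) (simp add: power2_eq_square)
    also have "\<dots> \<le> c * rin (s (z (f x))) (z (f x))" using c by (intro mult_left_mono)
    also have "\<dots> \<le> c * rin (z (f x)) (f x)" using c zsz by (intro mult_left_mono)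
    finally show ?thesis by (simp add: rg)
  qed
  have ng: "norm (g x) \<le> norm x" for x
  proof -
    have "norm (g x) * norm (g x) \<le> norm (g x) * norm x"
      using gg[of x] rin_cauchy_schwarz[of "g x" x] by (simp add: power2_eq_square)
    then show ?thesis by (cases "g x = 0") auto
  qed
  have "rin (g x) x \<le> rin (f x) x" for x
  proof -
    have "rin (g x) x = rin (g (f x)) (f x)" by (simp add: rg ff)
    also have "\<dots> \<le> norm (g (f x)) * norm (f x)" using rin_cauchy_schwarz[of "g (f x)" "f x"] by simp
    also have "\<dots> \<le> norm (f x) * norm (f x)" using ng by (intro mult_right_mono) auto
    finally show ?thesis by (simp add: projection_rin[OF f(2)] power2_eq_square)
  qed
  then have "tr g \<le> tr f" using gM f sag saf by (intro tr_mono)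
  moreover have "tr g = c * tr (f o\<^sub>L z)"
  proof -
    have "tr (f o\<^sub>L z o\<^sub>L f) = tr (f o\<^sub>L (f o\<^sub>L z))" using f z by (intro tr_commute) (auto simp: mem_intros)
    also have "f o\<^sub>L (f o\<^sub>L z) = f o\<^sub>L z" by (rule blinfun_eqI) (simp add: ff)
    finally show ?thesis using f z by (simp add: g_def tr_scaleR mem_intros)
  qed
  ultimately show ?thesis by simp
qed

text \<open>\<open>\<tau> (r z) = \<tau> (w r w)\<close> for the positive root \<open>w\<close> of \<open>z\<close>, and \<open>w r w \<le> \<parallel>r\<parallel> z\<close>.\<close>

lemma tr_compose_le:
  assumes r: "r \<in> M" "selfadjoint r" and z: "z \<in> M" "positive_op z"
  shows "tr (r o\<^sub>L z) \<le> norm r * tr z"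
proof -
  obtain w where w: "w \<in> M" "positive_op w" "w o\<^sub>L w = z" using ex_sqrt_mem[OF z(2,1)] by blast
  have saw: "selfadjoint w" using w(2) by (simp add: positive_op_iff)
  have rz: "rin (z x) x = (norm (w x))\<^sup>2" for x
    using selfadjoint_rin[OF saw, of "w x" x] by (simp add: rin_self flip: w(3))
  have "tr (r o\<^sub>L z) = tr ((r o\<^sub>L w) o\<^sub>L w)"
    by (rule arg_cong[where f = tr]) (simp add: blinfun_eqI flip: w(3))
  also have "\<dots> = tr (w o\<^sub>L (r o\<^sub>L w))" using w r by (intro tr_commute) (auto simp: mem_intros)
  also have "\<dots> \<le> tr (norm r *\<^sub>R z)"
  proof (rule tr_mono)
    show "selfadjoint (w o\<^sub>L (r o\<^sub>L w))"
      unfolding selfadjoint_iff using r w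
      by (auto simp: bounded_ops_compose mem_bounded selfadjoint_rin[OF saw] selfadjoint_rin[OF r(2)])
    show "rin ((w o\<^sub>L (r o\<^sub>L w)) x) x \<le> rin ((norm r *\<^sub>R z) x) x" for x
      using rin_le_norm[of r "w x"]
      by (simp add: selfadjoint_rin[OF saw, of _ x] blinfun.bilinear_simps rin_simps rz)
  qed (use r w z in \<open>auto simp: mem_intros positive_op_iff selfadjoint_scaleR\<close>)
  finally show ?thesis using z by (simp add: tr_scaleR)
qed

text \<open>Countable subadditivity of the trace on the lattice of projections: \<open>1 - q\<close> is the join of
  the \<open>f n\<close>. It is the support of \<open>s = \<Sum>\<^sub>n 2\<^sup>-\<^sup>n\<^sup>-\<^sup>1 f n\<close>, that is, the increasing limit of
  \<open>1 - (1 - s)\<^sup>N = s z\<close>, and the trace of \<open>s z\<close> is estimated term by term.\<close>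

lemma ex_projection_avoiding:
  fixes f :: "nat \<Rightarrow> 'h op"
  assumes f: "\<And>n. f n \<in> M" "\<And>n. projection (f n)" and t: "\<And>N. (\<Sum>n<N. tr (f n)) \<le> t"
  shows "\<exists>q\<in>M. projection q \<and> (\<forall>n x. f n (q x) = 0) \<and> 1 - tr q \<le> t"
proof -
  define c where "c n = (1/2::real) ^ Suc n" for n
  have c0: "0 < c n" for n by (simp add: c_def)
  have csums: "c sums 1" unfolding c_def by (rule power_half_series)
  have saf: "selfadjoint (f n)" for n using f(2) by (simp add: projection_iff)
  have posf: "0 \<le> rin (f n x) x" for n x by (simp add: projection_rin f)
  define s where "s = (\<Sum>n. c n *\<^sub>R f n)"
  define p where "p m = (\<Sum>n<m. c n *\<^sub>R f n)" for m
  have "norm (c n *\<^sub>R f n) \<le> c n" for n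
    using projection_norm_le[OF f(2)[of n]] c0[of n] by simp
  then have "summable (\<lambda>n. c n *\<^sub>R f n)"
    by (intro summable_comparison_test'[OF sums_summable[OF csums], of 0])
  then have plim: "p \<longlonglongrightarrow> s" unfolding s_def p_def by (rule summable_LIMSEQ)
  have pM: "p m \<in> M" for m by (simp add: p_def mem_intros f)
  have sM: "s \<in> M" by (rule mem_norm_limit[OF plim pM])
  have rp: "rin (p m x) x = (\<Sum>n<m. c n * rin (f n x) x)" for m x
    by (simp add: p_def blinfun.sum_left rin.sum_left blinfun.bilinear_simps rin_simps)
  have sap: "selfadjoint (p m)" for m
    by (induction m) (auto simp: p_def selfadjoint_0 selfadjoint_add selfadjoint_scaleR saf)
  have sas: "selfadjoint s" by (rule selfadjoint_strong_limit[OF tendsto_apply[OF plim] sap])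
  have "(\<lambda>m. rin (p m x) x) \<longlonglongrightarrow> rin (s x) x" for x
    by (intro rin.tendsto tendsto_apply plim tendsto_const)
  then have rs: "(\<lambda>n. c n * rin (f n x) x) sums rin (s x) x" for x by (simp add: rp sums_def)
  have cf: "c n * rin (f n x) x \<le> rin (s x) x" for n x
    using sum_le_suminf[of "\<lambda>n. c n * rin (f n x) x" "{n}"] rs[of x] posf c0 by (simp add: sums_iff less_imp_le)
  have poss: "positive_op s"
    unfolding positive_op_iff
    using sas order_trans[OF mult_nonneg_nonneg[OF less_imp_le[OF c0[of 0]] posf[of 0]] cf[of 0]] by blast
  have les: "rin (s x) x \<le> (norm x)\<^sup>2" for x
  proof -
    have "rin (s x) x \<le> 1 * (norm x)\<^sup>2"
      by (rule sums_le[OF _ rs sums_mult2[OF csums]])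
        (intro mult_left_mono projection_rin_le f less_imp_le c0)
    then show ?thesis by simp
  qed
  define b where "b = id_blinfun - s"
  have bx: "b x = x - s x" for x by (simp add: b_def blinfun.bilinear_simps)
  have bM: "b \<in> M" by (simp add: b_def mem_intros sM)
  have sab: "selfadjoint b" by (simp add: b_def selfadjoint_diff selfadjoint_id sas)
  have posb: "positive_op b" using sab les by (simp add: positive_op_iff bx rin_simps rin_self)
  obtain q where q: "q \<in> M" "projection q" "\<And>x. s (q x) = 0" "\<And>x. (\<lambda>n. opow b n x) \<longlonglongrightarrow> q x"
    and dec: "\<And>n x. rin (opow b (Suc n) x) x \<le> rin (opow b n x) x"
    using ex_kernel_projection[OF sM poss les] unfolding b_def by blast
  have "f n (q x) = 0" for n x
  proof -
    have "c n * (norm (f n (q x)))\<^sup>2 \<le> 0"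
      using cf[of n "q x"] by (simp add: projection_rin f q rin_simps)
    then show ?thesis using c0[of n] by (simp add: mult_le_0_iff)
  qed
  moreover have "1 - tr (opow b N) \<le> t" for N
  proof -
    define z where "z = (\<Sum>j<N. opow b j)"
    have zx: "z x = (\<Sum>j<N. opow b j x)" for x by (simp add: z_def blinfun.sum_left)
    have zM: "z \<in> M" by (simp add: z_def mem_intros mem_opow bM)
    have saz: "selfadjoint z" unfolding z_def
      by (induction N) (auto simp: selfadjoint_0 selfadjoint_add selfadjoint_opow sab)
    have posz: "positive_op z"
      using saz by (auto simp: positive_op_iff zx rin.sum_left intro!: sum_nonneg positive_opow posb)
    have sz: "s (z x) = x - opow b N x" for x
      unfolding zx by (induction N) (simp_all add: blinfun.bilinear_simps bx)
    have zsz: "rin (s (z x)) (z x) \<le> rin (z x) x" for x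
    proof -
      have "rin (opow b N x) (z x) = (\<Sum>j<N. rin (opow b (N + j) x) x)"
        unfolding zx rin.sum_right
        by (intro sum.cong refl) (metis add.commute opow_add rin_commute selfadjoint_opow[OF sab] selfadjoint_rin)
      also have "\<dots> \<ge> 0" by (intro sum_nonneg positive_opow posb)
      finally show ?thesis by (simp add: sz rin_simps rin_commute[of x])
    qed
    \<comment> \<open>additivity of the trace handles the partial sum \<open>p m\<close>; the tail is small in norm\<close>
    have "tr (s o\<^sub>L z) \<le> t + norm (s - p m) * tr z" for m
    proof -
      have "s o\<^sub>L z = (p m o\<^sub>L z) + ((s - p m) o\<^sub>L z)"
        by (rule blinfun_eqI) (simp add: blinfun.bilinear_simps)
      then have "tr (s o\<^sub>L z) = tr (p m o\<^sub>L z) + tr ((s - p m) o\<^sub>L z)"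
        using sM pM zM by (simp add: tr_add mem_intros)
      moreover have "tr ((s - p m) o\<^sub>L z) \<le> norm (s - p m) * tr z"
        using sM pM zM sas sap posz by (intro tr_compose_le) (auto simp: mem_intros selfadjoint_diff)
      moreover have "p m o\<^sub>L z = (\<Sum>n<m. c n *\<^sub>R (f n o\<^sub>L z))"
        by (rule blinfun_eqI) (simp add: p_def blinfun.sum_left blinfun.bilinear_simps)
      then have "tr (p m o\<^sub>L z) = (\<Sum>n<m. c n * tr (f n o\<^sub>L z))"
        using f zM by (simp add: tr_sum tr_scaleR mem_intros)
      moreover have "\<dots> \<le> (\<Sum>n<m. tr (f n))"
        using f zM posz sas c0 cf zsz by (intro sum_mono tr_compress_le) (auto intro: less_imp_le)
      ultimately show ?thesis using t[of m] by linarith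
    qed
    moreover have "(\<lambda>m. t + norm (s - p m) * tr z) \<longlonglongrightarrow> t + norm (s - s) * tr z"
      by (intro tendsto_intros plim)
    ultimately have "tr (s o\<^sub>L z) \<le> t" using LIMSEQ_le_const by fastforce
    moreover have "s o\<^sub>L z = id_blinfun - opow b N"
      by (rule blinfun_eqI) (simp add: sz blinfun.bilinear_simps)
    ultimately show ?thesis using bM by (simp add: tr_diff tr_id mem_id mem_opow)
  qed
  moreover have "(\<lambda>N. 1 - tr (opow b N)) \<longlonglongrightarrow> 1 - tr q"
  proof -
    have "(\<lambda>N. tr (id_blinfun - opow b N)) \<longlonglongrightarrow> tr (id_blinfun - q)"
    proof (rule tr_monotone_limit)
      show "(\<lambda>N. (id_blinfun - opow b N) x) \<longlonglongrightarrow> (id_blinfun - q) x" for x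
        by (auto simp: blinfun.bilinear_simps intro!: tendsto_intros q)
    qed (use bM q sab dec in \<open>auto simp: mem_intros mem_opow selfadjoint_diff selfadjoint_id
        selfadjoint_opow blinfun.bilinear_simps rin_simps simp del: opow.simps(2)\<close>)
    then show ?thesis using bM q by (simp add: tr_diff tr_id mem_id mem_opow)
  qed
  ultimately have "1 - tr q \<le> t" by (intro LIMSEQ_le_const2) auto
  then show ?thesis using q \<open>\<And>n x. f n (q x) = 0\<close> by blast
qed

end

section \<open>Unitarily invariant norms\<close>

locale uinvariant_norm = tracial_vn M \<tau> for M :: "'h::chilbert_space op set" and \<tau> +
  fixes \<alpha> :: "'h op \<Rightarrow> real"
  assumes \<alpha>_norm_on: "norm_on M \<alpha>"
    and \<alpha>_id: "\<alpha> id_blinfun = 1"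
    and \<alpha>_unitary: "\<lbrakk>x \<in> M; u \<in> M; v \<in> M; unitary_op u; unitary_op v\<rbrakk> \<Longrightarrow> \<alpha> (u o\<^sub>L x o\<^sub>L v) = \<alpha> x"
    and \<alpha>_norm1: "x \<in> M \<Longrightarrow> norm1 \<tau> x \<le> \<alpha> x"
    and \<alpha>_continuous: "continuous_norm_on M \<tau> \<alpha>"
begin

lemma \<alpha>_nonneg: "x \<in> M \<Longrightarrow> 0 \<le> \<alpha> x"
  and \<alpha>_eq_0: "x \<in> M \<Longrightarrow> \<alpha> x = 0 \<longleftrightarrow> x = 0"
  and \<alpha>_scale: "x \<in> M \<Longrightarrow> \<alpha> (scale_op c x) = cmod c * \<alpha> x"
  and \<alpha>_triangle: "x \<in> M \<Longrightarrow> y \<in> M \<Longrightarrow> \<alpha> (x + y) \<le> \<alpha> x + \<alpha> y"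
  using \<alpha>_norm_on unfolding norm_on_def by auto

lemma \<alpha>_0: "\<alpha> 0 = 0"
  using \<alpha>_eq_0[OF mem_0] by simp

lemma \<alpha>_scaleR: "x \<in> M \<Longrightarrow> \<alpha> (r *\<^sub>R x) = \<bar>r\<bar> * \<alpha> x"
  by (simp add: scaleR_eq_scale_op \<alpha>_scale)

lemma \<alpha>_minus: "x \<in> M \<Longrightarrow> \<alpha> (- x) = \<alpha> x"
  using \<alpha>_scaleR[of x "-1"] by simp

lemma \<alpha>_diff_commute: "x \<in> M \<Longrightarrow> y \<in> M \<Longrightarrow> \<alpha> (x - y) = \<alpha> (y - x)"
  using \<alpha>_minus[of "x - y"] by (simp add: mem_diff)

lemma \<alpha>_triangle_diff: "x \<in> M \<Longrightarrow> y \<in> M \<Longrightarrow> z \<in> M \<Longrightarrow> \<alpha> (x - z) \<le> \<alpha> (x - y) + \<alpha> (y - z)"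
  using \<alpha>_triangle[of "x - y" "y - z"] by (simp add: mem_diff)

lemma \<alpha>_le_diff: "x \<in> M \<Longrightarrow> y \<in> M \<Longrightarrow> \<alpha> x \<le> \<alpha> (x - y) + \<alpha> y"
  using \<alpha>_triangle[of "x - y" y] by (simp add: mem_diff)

lemma compose_id [simp]: "x o\<^sub>L id_blinfun = (x :: 'h op)" "id_blinfun o\<^sub>L x = (x :: 'h op)"
  by (rule blinfun_eqI, simp)+

lemma unitary_op_id: "unitary_op (id_blinfun :: 'h op)"
proof -
  have "adj id_blinfun = (id_blinfun :: 'h op)" by (rule adj_eqI) (auto simp: bounded_ops_id)
  then show ?thesis by (simp add: unitary_op_def bounded_ops_id)
qed

text \<open>The unitaries are \<open>h \<plusminus> \<i> k\<close> with \<open>k\<close> the positive root of \<open>1 - h\<^sup>2\<close>, which commutes with \<open>h\<close>.\<close>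

lemma selfadjoint_contraction_mean_of_unitaries:
  assumes h: "h \<in> M" "selfadjoint h" and nh: "norm h \<le> 1"
  shows "\<exists>u\<in>M. \<exists>v\<in>M. unitary_op u \<and> unitary_op v \<and> h = (1/2) *\<^sub>R (u + v)"
proof -
  have hh: "(norm (h x))\<^sup>2 \<le> (norm x)\<^sup>2" for x
    using norm_blinfun[of h x] mult_right_mono[OF nh, of "norm x"] by (simp add: power_mono)
  have "positive_op (id_blinfun - (h o\<^sub>L h))"
    unfolding positive_op_iff using hh h(2)
    by (auto simp: blinfun.bilinear_simps rin_simps rin_self selfadjoint_rin
        intro!: selfadjoint_diff selfadjoint_id selfadjoint_compose_commute)
  then obtain k where k: "k \<in> M" "positive_op k" "k o\<^sub>L k = id_blinfun - (h o\<^sub>L h)"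
    and comm: "\<And>S. S o\<^sub>L (id_blinfun - (h o\<^sub>L h)) = (id_blinfun - (h o\<^sub>L h)) o\<^sub>L S \<Longrightarrow> S o\<^sub>L k = k o\<^sub>L S"
    using ex_sqrt_mem h by (metis mem_intros(1,4,7))
  have kk: "k (k x) = x - h (h x)" for x
    using arg_cong[OF k(3), of "\<lambda>T. blinfun_apply T x"] by (simp add: blinfun.bilinear_simps)
  have "h o\<^sub>L k = k o\<^sub>L h" by (rule comm, rule blinfun_eqI) (simp add: blinfun.bilinear_simps)
  then have hk: "h (k x) = k (h x)" for x by (rule commute_apply)
  have sak: "selfadjoint k" using k(2) by (simp add: positive_op_iff)
  define u where "u = h + scale_op \<i> k"
  define v where "v = h - scale_op \<i> k"
  have ux: "u x = h x + \<i> *\<^sub>C k x" and vx: "v x = h x - \<i> *\<^sub>C k x" for x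
    by (simp_all add: u_def v_def blinfun.bilinear_simps)
  have M: "u \<in> M" "v \<in> M" using h k by (simp_all add: u_def v_def mem_intros)
  have "adj u = v" "adj v = u"
    by (rule adj_eqI; simp add: M mem_bounded ux vx rin_simps selfadjoint_rin[OF h(2)]
        selfadjoint_rin[OF sak] rin_ii_swap bounded_opsD[OF mem_bounded[OF k(1)]])+
  moreover have cC: "h (\<i> *\<^sub>C x) = \<i> *\<^sub>C h x" "k (\<i> *\<^sub>C x) = \<i> *\<^sub>C k x" for x
    using h k by (simp_all add: bounded_opsD mem_bounded)
  have ii: "\<i> *\<^sub>C \<i> *\<^sub>C x = - x" for x :: 'h
    using scaleC_of_real[of "-1" x] by (simp add: scaleC_scaleC)
  have "u o\<^sub>L v = id_blinfun" "v o\<^sub>L u = id_blinfun"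
    by (rule blinfun_eqI; simp add: ux vx blinfun.bilinear_simps scaleC_simps cC ii kk hk)+
  ultimately have "unitary_op u" "unitary_op v"
    unfolding unitary_op_def using M by (auto simp: mem_bounded)
  moreover have "h = (1/2) *\<^sub>R (u + v)"
    by (simp add: u_def v_def flip: scaleR_2)
  ultimately show ?thesis using M by blast
qed

lemma \<alpha>_selfadjoint_mult_le:
  assumes h: "h \<in> M" "selfadjoint h" and x: "x \<in> M"
  shows "\<alpha> (h o\<^sub>L x) \<le> norm h * \<alpha> x" "\<alpha> (x o\<^sub>L h) \<le> norm h * \<alpha> x"
proof -
  have *: "\<alpha> (h o\<^sub>L x) \<le> \<alpha> x \<and> \<alpha> (x o\<^sub>L h) \<le> \<alpha> x" if h: "h \<in> M" "selfadjoint h" "norm h \<le> 1" for h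
  proof -
    obtain u v where uv: "u \<in> M" "v \<in> M" "unitary_op u" "unitary_op v" and hu: "h = (1/2) *\<^sub>R (u + v)"
      using selfadjoint_contraction_mean_of_unitaries[OF h] by blast
    have a: "\<alpha> (u o\<^sub>L x) = \<alpha> x" "\<alpha> (v o\<^sub>L x) = \<alpha> x" "\<alpha> (x o\<^sub>L u) = \<alpha> x" "\<alpha> (x o\<^sub>L v) = \<alpha> x"
      using \<alpha>_unitary[OF x _ mem_id _ unitary_op_id] \<alpha>_unitary[OF x mem_id _ unitary_op_id] uv
      by simp_all
    have "h o\<^sub>L x = (1/2) *\<^sub>R ((u o\<^sub>L x) + (v o\<^sub>L x))" "x o\<^sub>L h = (1/2) *\<^sub>R ((x o\<^sub>L u) + (x o\<^sub>L v))"
      unfolding hu by (rule blinfun_eqI, simp add: blinfun.bilinear_simps)+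
    moreover have "\<alpha> ((u o\<^sub>L x) + (v o\<^sub>L x)) \<le> \<alpha> x + \<alpha> x"
      using \<alpha>_triangle[of "u o\<^sub>L x" "v o\<^sub>L x"] uv x by (simp add: a mem_intros)
    moreover have "\<alpha> ((x o\<^sub>L u) + (x o\<^sub>L v)) \<le> \<alpha> x + \<alpha> x"
      using \<alpha>_triangle[of "x o\<^sub>L u" "x o\<^sub>L v"] uv x by (simp add: a mem_intros)
    ultimately show ?thesis using uv x by (simp add: \<alpha>_scaleR mem_intros)
  qed
  have "\<alpha> (h o\<^sub>L x) \<le> norm h * \<alpha> x \<and> \<alpha> (x o\<^sub>L h) \<le> norm h * \<alpha> x"
  proof (cases "h = 0")
    case True
    then have "h o\<^sub>L x = 0" "x o\<^sub>L h = 0" by (auto intro!: blinfun_eqI simp: blinfun.bilinear_simps)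
    then show ?thesis using True by (simp add: \<alpha>_0)
  next
    case False
    define h' where "h' = (1 / norm h) *\<^sub>R h"
    have h': "h' \<in> M" "selfadjoint h'" "norm h' \<le> 1"
      using h False by (simp_all add: h'_def mem_intros selfadjoint_scaleR)
    have "h o\<^sub>L x = norm h *\<^sub>R (h' o\<^sub>L x)" "x o\<^sub>L h = norm h *\<^sub>R (x o\<^sub>L h')"
      using False by (auto intro!: blinfun_eqI simp: h'_def blinfun.bilinear_simps)
    then show ?thesis using *[OF h'] h' x by (simp add: \<alpha>_scaleR mem_intros mult_left_mono)
  qed
  then show "\<alpha> (h o\<^sub>L x) \<le> norm h * \<alpha> x" "\<alpha> (x o\<^sub>L h) \<le> norm h * \<alpha> x" by auto
qed

lemma ex_cartesian_decomposition:
  assumes a: "a \<in> M"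
  shows "\<exists>h\<in>M. \<exists>k\<in>M. selfadjoint h \<and> selfadjoint k \<and> norm h \<le> norm a \<and> norm k \<le> norm a \<and>
      a = h + scale_op \<i> k"
proof -
  define h where "h = (1/2) *\<^sub>R (a + adj a)"
  define k where "k = scale_op (- \<i>) ((1/2) *\<^sub>R (a - adj a))"
  have b: "a \<in> bounded_ops" using a by (rule mem_bounded)
  have nx: "norm (adj a) \<le> norm a" by (rule norm_adj_le[OF b])
  have M: "h \<in> M" "k \<in> M" using a by (auto simp: h_def k_def mem_intros)
  have m1: "(- \<i>) *\<^sub>C x = - (\<i> *\<^sub>C x)" for x :: 'h
    by (metis mult_minus1 of_real_1 of_real_minus scaleC_of_real scaleC_scaleC scaleR_minus1_left)
  have "selfadjoint h"
    unfolding selfadjoint_iff using M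
    by (auto simp: mem_bounded h_def blinfun.bilinear_simps rin_simps rin_adj_left[OF b] rin_adj_right[OF b])
  moreover have "selfadjoint k"
    unfolding selfadjoint_iff using M
    by (auto simp: mem_bounded k_def blinfun.bilinear_simps rin_simps m1 scaleC_simps rin_ii_swap
        rin_adj_left[OF b] rin_adj_right[OF b] bounded_opsD[OF b]
        bounded_opsD[OF adj_bounded_ops[OF b], symmetric])
  moreover have "norm h \<le> norm a"
    using norm_triangle_ineq[of a "adj a"] nx by (simp add: h_def)
  moreover have "norm k \<le> norm a"
  proof (rule norm_blinfun_bound)
    fix x
    have "norm (k x) = (1/2) * norm ((a - adj a) x)"
      by (simp add: k_def norm_scaleC blinfun.bilinear_simps)
    also have "\<dots> \<le> (1/2) * (norm (a - adj a) * norm x)" using norm_blinfun[of "a - adj a" x] by simp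
    also have "\<dots> \<le> (1/2) * ((2 * norm a) * norm x)"
      using norm_triangle_ineq4[of a "adj a"] nx by (intro mult_left_mono mult_right_mono) auto
    finally show "norm (k x) \<le> norm a * norm x" by simp
  qed simp
  moreover have "a = h + scale_op \<i> k"
  proof (rule blinfun_eqI)
    fix x
    have "\<i> *\<^sub>C (- \<i>) *\<^sub>C y = y" for y :: 'h
      using scaleC_of_real[of 1 y] by (simp add: scaleC_scaleC)
    moreover have "(1/2) *\<^sub>R (y + z) + (1/2) *\<^sub>R (y - z) = y" for y z :: 'h
      unfolding scaleR_add_right[symmetric] by (simp flip: scaleR_2)
    ultimately show "a x = (h + scale_op \<i> k) x"
      unfolding h_def k_def by (simp only: blinfun.bilinear_simps scale_op_apply)
  qed
  ultimately show ?thesis using M by blast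
qed

text \<open>The factor \<open>2\<close> comes from estimating the two parts of the Cartesian decomposition separately. The
  bounds serve to show that multiplications are continuous for \<open>\<alpha>\<close>, and any constant would do.\<close>

lemma \<alpha>_mult_le:
  assumes a: "a \<in> M" and x: "x \<in> M"
  shows \<alpha>_mult_left_le: "\<alpha> (a o\<^sub>L x) \<le> 2 * norm a * \<alpha> x"
    and \<alpha>_mult_right_le: "\<alpha> (x o\<^sub>L a) \<le> 2 * norm a * \<alpha> x"
proof -
  obtain h k where hk: "h \<in> M" "k \<in> M" "selfadjoint h" "selfadjoint k" "norm h \<le> norm a" "norm k \<le> norm a"
    and eq: "a = h + scale_op \<i> k" using ex_cartesian_decomposition[OF a] by blast
  have l: "a o\<^sub>L x = (h o\<^sub>L x) + scale_op \<i> (k o\<^sub>L x)"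
    by (rule blinfun_eqI) (simp add: eq blinfun.bilinear_simps)
  have r: "x o\<^sub>L a = (x o\<^sub>L h) + scale_op \<i> (x o\<^sub>L k)"
    by (rule blinfun_eqI) (simp add: eq blinfun.bilinear_simps bounded_opsD[OF mem_bounded[OF x]])
  note s = \<alpha>_selfadjoint_mult_le[OF hk(1,3) x] \<alpha>_selfadjoint_mult_le[OF hk(2,4) x]
    mult_right_mono[OF hk(5) \<alpha>_nonneg[OF x]] mult_right_mono[OF hk(6) \<alpha>_nonneg[OF x]]
  show "\<alpha> (a o\<^sub>L x) \<le> 2 * norm a * \<alpha> x"
    using \<alpha>_triangle[of "h o\<^sub>L x" "scale_op \<i> (k o\<^sub>L x)"] s hk x unfolding l
    by (simp add: mem_intros \<alpha>_scale)
  show "\<alpha> (x o\<^sub>L a) \<le> 2 * norm a * \<alpha> x"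
    using \<alpha>_triangle[of "x o\<^sub>L h" "scale_op \<i> (x o\<^sub>L k)"] s hk x unfolding r
    by (simp add: mem_intros \<alpha>_scale)
qed

lemma \<alpha>_le_norm: "x \<in> M \<Longrightarrow> \<alpha> x \<le> 2 * norm x"
  using \<alpha>_mult_left_le[of x id_blinfun] by (simp add: mem_id \<alpha>_id)

lemma \<alpha>_tendsto_0_norm:
  assumes "\<And>n. X n \<in> M" "x \<in> M" "X \<longlonglongrightarrow> x"
  shows "(\<lambda>n. \<alpha> (X n - x)) \<longlonglongrightarrow> 0"
proof (rule tendsto_sandwich[of "\<lambda>_. 0" _ _ "\<lambda>n. 2 * norm (X n - x)"])
  have "(\<lambda>n. 2 * norm (X n - x)) \<longlonglongrightarrow> 2 * norm (x - x)" by (intro tendsto_intros assms)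
  then show "(\<lambda>n. 2 * norm (X n - x)) \<longlonglongrightarrow> 0" by simp
qed (use assms in \<open>auto intro!: always_eventually \<alpha>_nonneg \<alpha>_le_norm mem_diff\<close>)

text \<open>Chebyshev's inequality for \<open>s = \<bar>d\<bar>\<close>: the spectral projection \<open>f\<close> of \<open>s\<close> above \<open>\<delta>\<close> satisfies
  \<open>\<delta> f \<le> s\<close>, and \<open>\<tau> s = \<parallel>d\<parallel>\<^sub>1\<close> is at most \<open>\<alpha> d\<close>.\<close>

lemma ex_chebyshev_projection:
  assumes d: "d \<in> M" and \<delta>: "0 < \<delta>"
  shows "\<exists>f\<in>M. projection f \<and> tr f \<le> \<alpha> d / \<delta> \<and> (\<forall>x. norm (d (x - f x)) \<le> \<delta> * norm x)"
proof -
  define s where "s = abs_op d"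
  have s: "s \<in> M" "positive_op s"
    using d by (simp_all add: s_def abs_op_mem positive_abs_op mem_bounded)
  have ns: "norm (s x) = norm (d x)" for x unfolding s_def by (rule norm_abs_op_apply[OF mem_bounded[OF d]])
  obtain f where f: "f \<in> M" "projection f" and comm: "\<And>x. f (s x) = s (f x)"
    and small: "\<And>x. norm (s (x - f x)) \<le> \<delta> * norm x"
    and large: "\<And>x. \<delta> * (norm (f x))\<^sup>2 \<le> rin (s (f x)) (f x)"
    using ex_spectral_projection[OF s \<delta>] by blast
  have saf: "selfadjoint f" and ff: "f (f x) = f x" for x using f by (auto simp: projection_iff)
  have "\<delta> * tr f = tr (\<delta> *\<^sub>R f)" using f by (simp add: tr_scaleR)
  also have "\<dots> \<le> tr s"
  proof (rule tr_mono)
    fix x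
    have "rin (s (f x)) (x - f x) = rin (f (s (f x))) (x - f x)" by (simp add: comm ff)
    also have "\<dots> = 0" by (simp add: selfadjoint_rin[OF saf] blinfun.bilinear_simps ff rin_simps)
    finally have 1: "rin (s (f x)) (x - f x) = 0" .
    then have 2: "rin (s (x - f x)) (f x) = 0"
      using s by (metis positive_op_iff rin_commute selfadjoint_rin)
    have "rin (s x) x = rin (s (f x + (x - f x))) (f x + (x - f x))" by simp
    also have "\<dots> = rin (s (f x)) (f x) + rin (s (x - f x)) (x - f x)"
      unfolding blinfun.add_right rin.add_left rin.add_right 1 2 by simp
    also have "\<dots> \<ge> \<delta> * (norm (f x))\<^sup>2"
      using large[of x] s by (simp add: positive_op_iff add_increasing2)
    finally show "rin ((\<delta> *\<^sub>R f) x) x \<le> rin (s x) x"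
      by (simp add: blinfun.bilinear_simps rin_simps projection_rin[OF f(2)])
  qed (use s f saf \<delta> in \<open>auto simp: positive_op_iff mem_intros selfadjoint_scaleR\<close>)
  also have "\<dots> \<le> \<alpha> d" using \<alpha>_norm1[OF d] by (simp add: norm1_def s_def tr_def)
  finally have "tr f \<le> \<alpha> d / \<delta>" using \<delta> by (simp add: field_simps)
  then show ?thesis using f small ns by auto
qed

section \<open>The completion as classes of Cauchy sequences\<close>

abbreviation "C \<equiv> cauchy_seqs M \<alpha>"
definition class_of :: "(nat \<Rightarrow> 'h op) \<Rightarrow> 'h Lelem" where "class_of X = completion_rel M \<alpha> `` {X}"

lemma C_mem: "X \<in> C \<Longrightarrow> X n \<in> M"
  by (simp add: cauchy_seqs_def)

lemma C_cauchy: "X \<in> C \<Longrightarrow> 0 < \<epsilon> \<Longrightarrow> \<exists>k. \<forall>m\<ge>k. \<forall>n\<ge>k. \<alpha> (X m - X n) < \<epsilon>"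
  by (simp add: cauchy_seqs_def)

lemma C_lipschitz:
  assumes X: "X \<in> C" and Y: "\<And>n. Y n \<in> M" and K: "\<And>m n. \<alpha> (Y m - Y n) \<le> K * \<alpha> (X m - X n)"
  shows "Y \<in> C"
  unfolding cauchy_seqs_def
proof (intro CollectI conjI allI impI Y)
  fix \<epsilon> :: real assume \<epsilon>: "0 < \<epsilon>"
  obtain k where k: "\<And>m n. k \<le> m \<Longrightarrow> k \<le> n \<Longrightarrow> \<alpha> (X m - X n) < \<epsilon> / (\<bar>K\<bar> + 1)"
    using C_cauchy[OF X, of "\<epsilon> / (\<bar>K\<bar> + 1)"] \<epsilon> by (metis abs_ge_zero add_nonneg_pos divide_pos_pos zero_less_one)
  have "\<alpha> (Y m - Y n) < \<epsilon>" if "k \<le> m" "k \<le> n" for m n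
  proof -
    have nn: "0 \<le> \<alpha> (X m - X n)" using C_mem[OF X] by (simp add: \<alpha>_nonneg mem_diff)
    have "\<alpha> (Y m - Y n) \<le> K * \<alpha> (X m - X n)" by (rule K)
    also have "\<dots> \<le> (\<bar>K\<bar> + 1) * \<alpha> (X m - X n)" using nn by (intro mult_right_mono) auto
    also have "\<dots> < \<epsilon>" using k[OF that] by (simp add: field_simps)
    finally show ?thesis .
  qed
  then show "\<exists>k. \<forall>m\<ge>k. \<forall>n\<ge>k. \<alpha> (Y m - Y n) < \<epsilon>" by blast
qed

lemma C_const: "x \<in> M \<Longrightarrow> (\<lambda>_. x) \<in> C"
  by (auto simp: cauchy_seqs_def \<alpha>_0)

lemma C_add:
  assumes X: "X \<in> C" and Y: "Y \<in> C" shows "(\<lambda>n. X n + Y n) \<in> C"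
  unfolding cauchy_seqs_def
proof (intro CollectI conjI allI impI)
  show "X n + Y n \<in> M" for n using X Y by (simp add: C_mem mem_intros)
  fix \<epsilon> :: real assume "0 < \<epsilon>"
  then have \<epsilon>: "0 < \<epsilon> / 2" by simp
  obtain k where k: "\<And>m n. k \<le> m \<Longrightarrow> k \<le> n \<Longrightarrow> \<alpha> (X m - X n) < \<epsilon> / 2"
    using C_cauchy[OF X \<epsilon>] by blast
  obtain l where l: "\<And>m n. l \<le> m \<Longrightarrow> l \<le> n \<Longrightarrow> \<alpha> (Y m - Y n) < \<epsilon> / 2"
    using C_cauchy[OF Y \<epsilon>] by blast
  have "\<alpha> ((X m + Y m) - (X n + Y n)) < \<epsilon>" if "max k l \<le> m" "max k l \<le> n" for m n
    using \<alpha>_triangle[of "X m - X n" "Y m - Y n"] k[of m n] l[of m n] that X Y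
    by (simp add: C_mem mem_diff algebra_simps)
  then show "\<exists>k. \<forall>m\<ge>k. \<forall>n\<ge>k. \<alpha> ((X m + Y m) - (X n + Y n)) < \<epsilon>" by blast
qed

lemma C_scale: "X \<in> C \<Longrightarrow> (\<lambda>n. scale_op c (X n)) \<in> C"
proof (rule C_lipschitz[where K = "cmod c"])
  have "scale_op c x - scale_op c y = scale_op c (x - y)" for x y :: "'h op"
    by (rule blinfun_eqI) (simp add: blinfun.bilinear_simps scaleC_simps)
  then show "X \<in> C \<Longrightarrow> \<alpha> (scale_op c (X m) - scale_op c (X n)) \<le> cmod c * \<alpha> (X m - X n)" for m n
    by (simp add: \<alpha>_scale C_mem mem_diff)
qed (auto simp: C_mem mem_intros)

lemma compose_diff_right: "(a o\<^sub>L x) - (a o\<^sub>L y) = a o\<^sub>L (x - y)"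
  and compose_diff_left: "(x o\<^sub>L a) - (y o\<^sub>L a) = (x - y) o\<^sub>L a" for a x y :: "'h op"
  by (rule blinfun_eqI, simp add: blinfun.bilinear_simps)+

lemma C_left: "a \<in> M \<Longrightarrow> X \<in> C \<Longrightarrow> (\<lambda>n. a o\<^sub>L X n) \<in> C"
  by (rule C_lipschitz[where K = "2 * norm a"])
    (auto simp: C_mem mem_intros compose_diff_right intro!: \<alpha>_mult_left_le)

lemma C_right: "a \<in> M \<Longrightarrow> X \<in> C \<Longrightarrow> (\<lambda>n. X n o\<^sub>L a) \<in> C"
  by (rule C_lipschitz[where K = "2 * norm a"])
    (auto simp: C_mem mem_intros compose_diff_left intro!: \<alpha>_mult_right_le)

lemma C_diff:
  assumes "X \<in> C" "Y \<in> C" shows "(\<lambda>n. X n - Y n) \<in> C"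
proof -
  have "X n + scale_op (-1) (Y n) = X n - Y n" for n
    using scaleR_eq_scale_op[of "-1" "Y n"] by simp
  then show ?thesis using C_add[OF assms(1) C_scale[OF assms(2), of "-1"]] by simp
qed

lemma null_bound:
  assumes "(\<lambda>n. \<alpha> (X n)) \<longlonglongrightarrow> 0" "\<And>n. Y n \<in> M" "\<And>n. \<alpha> (Y n) \<le> K * \<alpha> (X n)"
  shows "(\<lambda>n. \<alpha> (Y n)) \<longlonglongrightarrow> 0"
proof (rule tendsto_sandwich[of "\<lambda>_. 0" _ _ "\<lambda>n. K * \<alpha> (X n)"])
  show "(\<lambda>n. K * \<alpha> (X n)) \<longlonglongrightarrow> 0" using tendsto_mult_left[OF assms(1), of K] by simp
qed (use assms in \<open>auto intro!: always_eventually \<alpha>_nonneg\<close>)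

lemma rel_iff: "(X, Y) \<in> completion_rel M \<alpha> \<longleftrightarrow> X \<in> C \<and> Y \<in> C \<and> (\<lambda>n. \<alpha> (X n - Y n)) \<longlonglongrightarrow> 0"
  by (simp add: completion_rel_def)

lemma equiv_rel: "equiv C (completion_rel M \<alpha>)"
proof (rule equivI)
  show "completion_rel M \<alpha> \<subseteq> C \<times> C" by (auto simp: completion_rel_def)
  show "refl_on C (completion_rel M \<alpha>)" by (auto simp: refl_on_def completion_rel_def \<alpha>_0)
  show "sym (completion_rel M \<alpha>)"
    by (auto simp: sym_def completion_rel_def \<alpha>_diff_commute C_mem)
  show "trans (completion_rel M \<alpha>)"
  proof (rule transI, unfold rel_iff, intro conjI; (elim conjE)?)
    fix X Y Z
    assume M: "X \<in> C" "Y \<in> C" "Z \<in> C"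
      and l: "(\<lambda>n. \<alpha> (X n - Y n)) \<longlonglongrightarrow> 0" "(\<lambda>n. \<alpha> (Y n - Z n)) \<longlonglongrightarrow> 0"
    have mem: "X n \<in> M" "Y n \<in> M" "Z n \<in> M" for n using M by (simp_all add: C_mem)
    show "(\<lambda>n. \<alpha> (X n - Z n)) \<longlonglongrightarrow> 0"
    proof (rule tendsto_sandwich[of "\<lambda>_. 0" _ _ "\<lambda>n. \<alpha> (X n - Y n) + \<alpha> (Y n - Z n)"])
      show "(\<lambda>n. \<alpha> (X n - Y n) + \<alpha> (Y n - Z n)) \<longlonglongrightarrow> 0" using tendsto_add[OF l] by simp
    qed (auto intro!: always_eventually \<alpha>_nonneg \<alpha>_triangle_diff mem_diff mem)
  qed
qed

lemma class_of_eq_iff: "X \<in> C \<Longrightarrow> Y \<in> C \<Longrightarrow> class_of X = class_of Y \<longleftrightarrow> (\<lambda>n. \<alpha> (X n - Y n)) \<longlonglongrightarrow> 0"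
  unfolding class_of_def by (simp add: eq_equiv_class_iff[OF equiv_rel] rel_iff)

lemma class_of_mem: "X \<in> C \<Longrightarrow> class_of X \<in> Lalpha M \<alpha>"
  by (simp add: class_of_def Lalpha_def completion_def quotientI)

lemma Lalpha_cases:
  assumes "\<xi> \<in> Lalpha M \<alpha>" obtains X where "X \<in> C" "\<xi> = class_of X"
  using assms unfolding Lalpha_def completion_def class_of_def by (elim quotientE) blast

text \<open>Lipschitz maps send equivalent sequences to equivalent sequences, so the union that defines the
  extended map is over copies of a single class.\<close>

lemma completion_map_class_of:
  assumes X: "X \<in> C" and f: "\<And>X. X \<in> C \<Longrightarrow> (\<lambda>n. f (X n)) \<in> C"
    and K: "\<And>x y. x \<in> M \<Longrightarrow> y \<in> M \<Longrightarrow> \<alpha> (f x - f y) \<le> K * \<alpha> (x - y)"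
  shows "completion_map M \<alpha> f (class_of X) = class_of (\<lambda>n. f (X n))"
  unfolding completion_map_def class_of_def
proof (rule UN_equiv_class[OF equiv_rel _ X])
  show "(\<lambda>X. completion_rel M \<alpha> `` {\<lambda>n. f (X n)}) respects completion_rel M \<alpha>"
  proof (rule congruentI)
    fix X Y assume "(X, Y) \<in> completion_rel M \<alpha>"
    then have M: "X \<in> C" "Y \<in> C" and l: "(\<lambda>n. \<alpha> (X n - Y n)) \<longlonglongrightarrow> 0" by (auto simp: rel_iff)
    have "f (X n) \<in> M" "f (Y n) \<in> M" for n
      using C_mem[OF f[OF M(1)], of n] C_mem[OF f[OF M(2)], of n] by simp_all
    then have "(\<lambda>n. \<alpha> (f (X n) - f (Y n))) \<longlonglongrightarrow> 0"
      by (intro null_bound[OF l _ K]) (use M in \<open>auto simp: C_mem mem_diff\<close>)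
    then show "completion_rel M \<alpha> `` {\<lambda>n. f (X n)} = completion_rel M \<alpha> `` {\<lambda>n. f (Y n)}"
      using class_of_eq_iff[OF f f] M by (simp add: class_of_def)
  qed
qed

lemma completion_map2_class_of:
  assumes X: "X \<in> C" and Y: "Y \<in> C" and f: "\<And>X Y. X \<in> C \<Longrightarrow> Y \<in> C \<Longrightarrow> (\<lambda>n. f (X n) (Y n)) \<in> C"
    and K: "\<And>x y x' y'. \<lbrakk>x \<in> M; y \<in> M; x' \<in> M; y' \<in> M\<rbrakk> \<Longrightarrow>
        \<alpha> (f x y - f x' y') \<le> \<alpha> (x - x') + \<alpha> (y - y')"
  shows "completion_map2 M \<alpha> f (class_of X) (class_of Y) = class_of (\<lambda>n. f (X n) (Y n))"
  unfolding completion_map2_def class_of_def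
proof (rule UN_equiv_class2[OF equiv_rel equiv_rel _ X Y])
  show "(\<lambda>X Y. completion_rel M \<alpha> `` {\<lambda>n. f (X n) (Y n)}) respects2 completion_rel M \<alpha>"
  proof (rule congruent2I')
    fix X X' Y Y' assume "(X, X') \<in> completion_rel M \<alpha>" "(Y, Y') \<in> completion_rel M \<alpha>"
    then have M: "X \<in> C" "X' \<in> C" "Y \<in> C" "Y' \<in> C"
      and l: "(\<lambda>n. \<alpha> (X n - X' n)) \<longlonglongrightarrow> 0" "(\<lambda>n. \<alpha> (Y n - Y' n)) \<longlonglongrightarrow> 0" by (auto simp: rel_iff)
    have mem: "X n \<in> M" "X' n \<in> M" "Y n \<in> M" "Y' n \<in> M" for n using M by (simp_all add: C_mem)
    have fmem: "f (X n) (Y n) \<in> M" "f (X' n) (Y' n) \<in> M" for n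
      using C_mem[OF f[OF M(1,3)], of n] C_mem[OF f[OF M(2,4)], of n] by simp_all
    have "(\<lambda>n. \<alpha> (f (X n) (Y n) - f (X' n) (Y' n))) \<longlonglongrightarrow> 0"
    proof (rule tendsto_sandwich[of "\<lambda>_. 0" _ _ "\<lambda>n. \<alpha> (X n - X' n) + \<alpha> (Y n - Y' n)"])
      show "(\<lambda>n. \<alpha> (X n - X' n) + \<alpha> (Y n - Y' n)) \<longlonglongrightarrow> 0" using tendsto_add[OF l] by simp
    qed (auto intro!: always_eventually \<alpha>_nonneg K mem_diff mem fmem)
    then show "completion_rel M \<alpha> `` {\<lambda>n. f (X n) (Y n)} = completion_rel M \<alpha> `` {\<lambda>n. f (X' n) (Y' n)}"
      using class_of_eq_iff[OF f f] M by (simp add: class_of_def)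
  qed
qed

lemma Ladd_class_of:
  assumes "X \<in> C" "Y \<in> C" shows "Ladd M \<alpha> (class_of X) (class_of Y) = class_of (\<lambda>n. X n + Y n)"
  unfolding Ladd_def
proof (rule completion_map2_class_of[OF assms C_add])
  fix x y x' y' assume "x \<in> M" "y \<in> M" "x' \<in> M" "y' \<in> M"
  then show "\<alpha> (x + y - (x' + y')) \<le> \<alpha> (x - x') + \<alpha> (y - y')"
    using \<alpha>_triangle[of "x - x'" "y - y'"] by (simp add: mem_diff algebra_simps)
qed

lemma Ldiff_class_of:
  assumes "X \<in> C" "Y \<in> C" shows "Ldiff M \<alpha> (class_of X) (class_of Y) = class_of (\<lambda>n. X n - Y n)"
  unfolding Ldiff_def
proof (rule completion_map2_class_of[OF assms C_diff])
  fix x y x' y' assume "x \<in> M" "y \<in> M" "x' \<in> M" "y' \<in> M"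
  then show "\<alpha> (x - y - (x' - y')) \<le> \<alpha> (x - x') + \<alpha> (y - y')"
    using \<alpha>_triangle[of "x - x'" "y' - y"] by (simp add: mem_diff algebra_simps \<alpha>_diff_commute[of y])
qed

lemma Lscale_class_of: "X \<in> C \<Longrightarrow> Lscale M \<alpha> c (class_of X) = class_of (\<lambda>n. scale_op c (X n))"
  unfolding Lscale_def
proof (rule completion_map_class_of[where K = "cmod c"])
  have "scale_op c x - scale_op c y = scale_op c (x - y)" for x y :: "'h op"
    by (rule blinfun_eqI) (simp add: blinfun.bilinear_simps scaleC_simps)
  then show "\<alpha> (scale_op c x - scale_op c y) \<le> cmod c * \<alpha> (x - y)" if "x \<in> M" "y \<in> M" for x y
    using that by (simp add: \<alpha>_scale mem_diff)
qed (auto simp: C_scale)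

lemma left_mult_class_of: "a \<in> M \<Longrightarrow> X \<in> C \<Longrightarrow> left_mult M \<alpha> a (class_of X) = class_of (\<lambda>n. a o\<^sub>L X n)"
  unfolding left_mult_def
  by (rule completion_map_class_of[where K = "2 * norm a"])
    (auto simp: C_left compose_diff_right mem_intros intro!: \<alpha>_mult_left_le)

lemma right_mult_class_of: "a \<in> M \<Longrightarrow> X \<in> C \<Longrightarrow> right_mult M \<alpha> (class_of X) a = class_of (\<lambda>n. X n o\<^sub>L a)"
  unfolding right_mult_def
  by (rule completion_map_class_of[where K = "2 * norm a"])
    (auto simp: C_right compose_diff_left mem_intros intro!: \<alpha>_mult_right_le)

lemma completion_norm_class_of:
  assumes X: "X \<in> C"
  shows "(\<lambda>n. \<alpha> (X n)) \<longlonglongrightarrow> completion_norm \<alpha> (class_of X)"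
proof -
  have tri: "\<bar>\<alpha> x - \<alpha> y\<bar> \<le> \<alpha> (x - y)" if "x \<in> M" "y \<in> M" for x y
    using \<alpha>_le_diff[OF that] \<alpha>_le_diff[OF that(2,1)] \<alpha>_diff_commute[OF that] by linarith
  have "Cauchy (\<lambda>n. \<alpha> (X n))"
  proof (rule metric_CauchyI)
    fix e :: real assume "0 < e"
    then obtain k where k: "\<And>m n. k \<le> m \<Longrightarrow> k \<le> n \<Longrightarrow> \<alpha> (X m - X n) < e"
      using C_cauchy[OF X] by blast
    have "dist (\<alpha> (X m)) (\<alpha> (X n)) < e" if "k \<le> m" "k \<le> n" for m n
      using k[OF that] tri[OF C_mem[OF X, of m] C_mem[OF X, of n]] by (simp add: dist_real_def)
    then show "\<exists>k. \<forall>m\<ge>k. \<forall>n\<ge>k. dist (\<alpha> (X m)) (\<alpha> (X n)) < e" by blast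
  qed
  then obtain r where r: "(\<lambda>n. \<alpha> (X n)) \<longlonglongrightarrow> r" using Cauchy_convergent convergent_def by blast
  have all: "(\<lambda>n. \<alpha> (Y n)) \<longlonglongrightarrow> r" if "Y \<in> class_of X" for Y
  proof -
    have Y: "Y \<in> C" and l: "(\<lambda>n. \<alpha> (X n - Y n)) \<longlonglongrightarrow> 0" using that by (auto simp: class_of_def rel_iff)
    have "(\<lambda>n. \<alpha> (X n) - \<alpha> (Y n)) \<longlonglongrightarrow> 0"
      by (rule Lim_null_comparison[OF _ l]) (use X Y in \<open>auto intro!: always_eventually tri C_mem\<close>)
    from tendsto_diff[OF r this] show ?thesis by simp
  qed
  have "X \<in> class_of X" using X by (simp add: class_of_def rel_iff \<alpha>_0)
  then have "completion_norm \<alpha> (class_of X) = r"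
    unfolding completion_norm_def using all by (intro the_equality) (auto intro: LIMSEQ_unique)
  then show ?thesis using r by simp
qed

end

context uinvariant_norm
begin

section \<open>Cutting down to bounded elements\<close>

lemma ex_fast_subsequence:
  assumes X: "X \<in> C"
  shows "\<exists>r. strict_mono r \<and> (\<forall>n. \<alpha> (X (r (Suc n)) - X (r n)) \<le> (1/4) ^ n)"
proof -
  have "\<exists>k. \<forall>i\<ge>k. \<forall>j\<ge>k. \<alpha> (X i - X j) < (1/4) ^ n" for n
    by (rule C_cauchy[OF X]) simp
  then obtain N where N: "\<And>n i j. N n \<le> i \<Longrightarrow> N n \<le> j \<Longrightarrow> \<alpha> (X i - X j) < (1/4) ^ n" by metis
  define r where "r = rec_nat (N 0) (\<lambda>n k. max (Suc k) (N (Suc n)))"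
  have r: "r 0 = N 0" "\<And>n. r (Suc n) = max (Suc (r n)) (N (Suc n))" by (simp_all add: r_def)
  have "r n < r (Suc n)" for n by (simp add: r)
  then have "strict_mono r" by (simp add: strict_mono_Suc_iff)
  moreover have "N n \<le> r n" for n by (cases n) (auto simp: r)
  then have "\<alpha> (X (r (Suc n)) - X (r n)) \<le> (1/4) ^ n" for n
    using \<open>r n < r (Suc n)\<close> less_imp_le[OF N] by (meson less_imp_le order_trans)
  ultimately show ?thesis by blast
qed

lemma convergent_of_geometric_steps:
  fixes V :: "nat \<Rightarrow> 'h op"
  assumes "\<And>n. norm (V (Suc n) - V n) \<le> (1/2) ^ n"
  shows "convergent V"
proof -
  have "summable (\<lambda>n. V (Suc n) - V n)"
    by (rule summable_comparison_test'[of "\<lambda>n. (1/2::real) ^ n" 0]) (use assms in \<open>auto intro: summable_geometric\<close>)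
  then have "convergent (\<lambda>n. \<Sum>i<n. V (Suc i) - V i)" by (simp add: summable_iff_convergent)
  then have "convergent (\<lambda>n. V n - V 0)" by (simp add: sum_lessThan_telescope)
  then show ?thesis using convergent_add[OF _ convergent_const[of "V 0"]] by fastforce
qed

text \<open>An Egorov argument: if \<open>X\<close> moves by at most \<open>4\<^sup>-\<^sup>n\<close> for \<open>\<alpha>\<close> at step \<open>n\<close>, then off a projection of
  trace at most \<open>2\<^sup>-\<^sup>n\<close> it moves by at most \<open>2\<^sup>-\<^sup>n\<close> in operator norm. Discarding the exceptional
  projections from step \<open>k\<close> on leaves a projection \<open>q k\<close> of trace close to \<open>1\<close> such that \<open>X n q k\<close>
  converges in operator norm. The rate \<open>4\<^sup>-\<^sup>n\<close> is what Chebyshev's inequality with threshold \<open>2\<^sup>-\<^sup>n\<close>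
  turns into the trace bound \<open>2\<^sup>-\<^sup>n\<close>.\<close>

lemma egorov:
  assumes X: "X \<in> C" and fast: "\<And>n. \<alpha> (X (Suc n) - X n) \<le> (1/4) ^ n"
  shows "\<exists>q\<in>M. projection q \<and> 1 - tr q \<le> 2 * (1/2) ^ k \<and> (\<exists>y\<in>M. (\<lambda>n. X n o\<^sub>L q) \<longlonglongrightarrow> y)"
proof -
  have XM: "X n \<in> M" for n using X by (rule C_mem)
  have "\<exists>f\<in>M. projection f \<and> tr f \<le> (1/2) ^ n \<and> (\<forall>x. norm ((X (Suc n) - X n) (x - f x)) \<le> (1/2) ^ n * norm x)" for n
  proof -
    obtain f where f: "f \<in> M" "projection f" "tr f \<le> \<alpha> (X (Suc n) - X n) / (1/2) ^ n"
      "\<And>x. norm ((X (Suc n) - X n) (x - f x)) \<le> (1/2) ^ n * norm x"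
      using ex_chebyshev_projection[of "X (Suc n) - X n" "(1/2) ^ n"] XM by (auto simp: mem_diff)
    have "\<alpha> (X (Suc n) - X n) / (1/2) ^ n \<le> (1/4) ^ n / (1/2) ^ n"
      using fast by (intro divide_right_mono) auto
    also have "\<dots> = (1/2) ^ n" by (simp flip: power_divide)
    finally show ?thesis using f by (meson order_trans)
  qed
  then obtain f where f: "\<And>n. f n \<in> M" "\<And>n. projection (f n)" "\<And>n. tr (f n) \<le> (1/2) ^ n"
    and small: "\<And>n x. norm ((X (Suc n) - X n) (x - f n x)) \<le> (1/2) ^ n * norm x" by metis
  have "(\<Sum>n<N. tr (f (n + k))) \<le> 2 * (1/2) ^ k" for N
  proof -
    have "(\<Sum>n<N. tr (f (n + k))) \<le> (\<Sum>n<N. (1/2) ^ k * (1/2) ^ n)"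
      using f(3)[of "_ + k"] by (intro sum_mono) (simp add: power_add mult.commute)
    also have "\<dots> = (1/2) ^ k * (\<Sum>n<N. (1/2) ^ n)" by (simp add: sum_distrib_left)
    also have "\<dots> \<le> (1/2) ^ k * 2" by (intro mult_left_mono) (auto simp: sum_gp_strict)
    finally show ?thesis by simp
  qed
  then obtain q where q: "q \<in> M" "projection q" "1 - tr q \<le> 2 * (1/2) ^ k"
    and avoid: "\<And>n x. f (n + k) (q x) = 0"
    using ex_projection_avoiding[of "\<lambda>n. f (n + k)"] f by metis
  define V where "V n = X (n + k) o\<^sub>L q" for n
  have "norm (V (Suc n) - V n) \<le> (1/2) ^ n" for n
  proof (rule norm_blinfun_bound)
    fix x
    have "norm ((V (Suc n) - V n) x) = norm ((X (Suc (n + k)) - X (n + k)) (q x - f (n + k) (q x)))"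
      by (simp add: V_def avoid blinfun.bilinear_simps)
    also have "\<dots> \<le> (1/2) ^ (n + k) * norm (q x)" by (rule small)
    also have "\<dots> \<le> (1/2) ^ n * norm x"
    proof (rule mult_mono)
      show "(1/2::real) ^ (n + k) \<le> (1/2) ^ n" by (rule power_decreasing) auto
      show "norm (q x) \<le> norm x"
        using norm_blinfun[of q x] mult_right_mono[OF projection_norm_le[OF q(2)], of "norm x"] by simp
    qed auto
    finally show "norm ((V (Suc n) - V n) x) \<le> (1/2) ^ n * norm x" .
  qed simp
  then have "convergent V" by (rule convergent_of_geometric_steps)
  then obtain y where y: "V \<longlonglongrightarrow> y" by (auto simp: convergent_def)
  have "y \<in> M" by (rule mem_norm_limit[OF y]) (simp add: V_def XM q mem_intros)
  moreover have "(\<lambda>n. X n o\<^sub>L q) \<longlonglongrightarrow> y"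
    using y unfolding V_def by (rule LIMSEQ_offset)
  ultimately show ?thesis using q by blast
qed

text \<open>Not all the norm limits \<open>y k\<close> of \<open>X n q k\<close> can vanish, because the continuity of \<open>\<alpha>\<close> makes
  \<open>\<alpha> (X m (1 - q k))\<close> small for a fixed \<open>m\<close> and large \<open>k\<close>.\<close>

lemma ex_nonzero_bounded_cut:
  assumes X: "X \<in> C" and nz: "\<not> (\<lambda>n. \<alpha> (X n)) \<longlonglongrightarrow> 0"
  shows "\<exists>r. \<exists>q\<in>M. \<exists>y\<in>M. strict_mono r \<and> y \<noteq> 0 \<and> (\<lambda>n. X (r n) o\<^sub>L q) \<longlonglongrightarrow> y"
proof (rule ccontr)
  assume none: "\<not> ?thesis"
  obtain r where r: "strict_mono r" and fast: "\<And>n. \<alpha> (X (r (Suc n)) - X (r n)) \<le> (1/4) ^ n"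
    using ex_fast_subsequence[OF X] by blast
  define Z where "Z n = X (r n)" for n
  have XM: "X n \<in> M" for n using X by (rule C_mem)
  have ZM: "Z n \<in> M" for n by (simp add: Z_def XM)
  have rn: "n \<le> r n" for n using r by (rule seq_suble)
  have Z: "Z \<in> C"
    unfolding cauchy_seqs_def
  proof (intro CollectI conjI allI impI ZM)
    fix \<epsilon> :: real assume "0 < \<epsilon>"
    then obtain k where "\<forall>m\<ge>k. \<forall>n\<ge>k. \<alpha> (X m - X n) < \<epsilon>" using C_cauchy[OF X] by blast
    then show "\<exists>k. \<forall>m\<ge>k. \<forall>n\<ge>k. \<alpha> (Z m - Z n) < \<epsilon>" unfolding Z_def by (meson order_trans rn)
  qed
  have "\<exists>q\<in>M. projection q \<and> 1 - tr q \<le> 2 * (1/2) ^ k \<and> (\<lambda>n. Z n o\<^sub>L q) \<longlonglongrightarrow> 0" for k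
  proof -
    obtain q y where q: "q \<in> M" "projection q" "1 - tr q \<le> 2 * (1/2) ^ k"
      and y: "y \<in> M" "(\<lambda>n. Z n o\<^sub>L q) \<longlonglongrightarrow> y"
      using egorov[OF Z fast[folded Z_def], of k] by blast
    then have "y = 0" using none r unfolding Z_def by blast
    then show ?thesis using q y by blast
  qed
  then obtain q where q: "\<And>k. q k \<in> M" "\<And>k. projection (q k)" "\<And>k. 1 - tr (q k) \<le> 2 * (1/2) ^ k"
    and lim: "\<And>k. (\<lambda>n. Z n o\<^sub>L q k) \<longlonglongrightarrow> 0" by metis
  have "\<exists>N. \<forall>n\<ge>N. \<alpha> (X n) < \<epsilon>" if \<epsilon>: "0 < \<epsilon>" for \<epsilon>
  proof -
    \<comment> \<open>\<open>\<alpha> (X n)\<close> is split into \<open>\<alpha> (X n - X m)\<close>, \<open>\<alpha> (X m (1 - q k))\<close>, \<open>\<alpha> ((X m - X (r j)) (q k))\<close> and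
      \<open>\<alpha> (X (r j) (q k))\<close>, bounded by \<open>1\<close>, \<open>1\<close>, \<open>2\<close> and \<open>1\<close> times \<open>\<epsilon>'\<close>\<close>
    define \<epsilon>' where "\<epsilon>' = \<epsilon> / 5"
    have \<epsilon>': "0 < \<epsilon>'" "\<epsilon> = 5 * \<epsilon>'" using \<epsilon> by (simp_all add: \<epsilon>'_def)
    obtain N where N: "\<And>m n. N \<le> m \<Longrightarrow> N \<le> n \<Longrightarrow> \<alpha> (X m - X n) < \<epsilon>'"
      using C_cauchy[OF X \<epsilon>'(1)] by blast
    define m where "m = r N"
    have Nm: "N \<le> m" using rn by (simp add: m_def)
    define \<epsilon>'' where "\<epsilon>'' = \<epsilon>' / (2 * (norm (X m) + 1))"
    have \<epsilon>'': "0 < \<epsilon>''" "2 * norm (X m) * \<epsilon>'' \<le> \<epsilon>'"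
      using \<epsilon>' by (auto simp: \<epsilon>''_def field_simps add_pos_nonneg intro!: divide_pos_pos)
    obtain \<delta> where \<delta>: "0 < \<delta>" "\<And>e. e \<in> M \<Longrightarrow> projection e \<Longrightarrow> tr e < \<delta> \<Longrightarrow> \<alpha> e < \<epsilon>''"
      using \<alpha>_continuous \<epsilon>''(1) unfolding continuous_norm_on_def tr_def by blast
    obtain k where "(1/2::real) ^ k < \<delta> / 2" using real_arch_pow_inv[of "\<delta> / 2" "1/2"] \<delta>(1) by auto
    then have "tr (id_blinfun - q k) < \<delta>" using q(3)[of k] q(1) by (simp add: tr_diff tr_id mem_id)
    then have \<alpha>q: "\<alpha> (id_blinfun - q k) < \<epsilon>''"
      using \<delta>(2) q by (simp add: mem_intros projection_complement)
    have "(\<lambda>n. \<alpha> ((Z n o\<^sub>L q k) - 0)) \<longlonglongrightarrow> 0"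
      by (rule \<alpha>_tendsto_0_norm[OF _ mem_0 lim]) (simp add: ZM q mem_intros)
    then have "eventually (\<lambda>n. \<alpha> (Z n o\<^sub>L q k) < \<epsilon>') sequentially" using \<epsilon>'(1) by (auto intro: order_tendstoD)
    then obtain L where L: "\<And>n. L \<le> n \<Longrightarrow> \<alpha> (Z n o\<^sub>L q k) < \<epsilon>'" by (auto simp: eventually_sequentially)
    define j where "j = max L N"
    have Nj: "N \<le> r j" using rn[of j] by (simp add: j_def)
    have Xq: "\<alpha> (X m o\<^sub>L q k) < 3 * \<epsilon>'"
    proof -
      have "\<alpha> (X m o\<^sub>L q k) \<le> \<alpha> ((X m - X (r j)) o\<^sub>L q k) + \<alpha> (X (r j) o\<^sub>L q k)"
        using \<alpha>_le_diff[of "X m o\<^sub>L q k" "X (r j) o\<^sub>L q k"] XM q by (simp add: mem_intros compose_diff_left)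
      moreover have "\<alpha> ((X m - X (r j)) o\<^sub>L q k) \<le> 2 * norm (q k) * \<alpha> (X m - X (r j))"
        using XM q by (intro \<alpha>_mult_right_le) (auto simp: mem_diff)
      moreover have "2 * norm (q k) * \<alpha> (X m - X (r j)) \<le> 2 * 1 * \<alpha> (X m - X (r j))"
        using XM projection_norm_le[OF q(2)[of k]] by (intro mult_right_mono) (auto intro: \<alpha>_nonneg mem_diff)
      moreover have "\<alpha> (X m - X (r j)) < \<epsilon>'" using N Nm Nj by blast
      moreover have "\<alpha> (X (r j) o\<^sub>L q k) < \<epsilon>'" using L[of j] by (simp add: j_def Z_def)
      ultimately show ?thesis by linarith
    qed
    have Xm: "\<alpha> (X m) < 4 * \<epsilon>'"
    proof -
      have "X m - (X m o\<^sub>L q k) = X m o\<^sub>L (id_blinfun - q k)"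
        by (rule blinfun_eqI) (simp add: blinfun.bilinear_simps)
      then have "\<alpha> (X m) \<le> \<alpha> (X m o\<^sub>L (id_blinfun - q k)) + \<alpha> (X m o\<^sub>L q k)"
        using \<alpha>_le_diff[of "X m" "X m o\<^sub>L q k"] XM q by (simp add: mem_intros)
      moreover have "\<alpha> (X m o\<^sub>L (id_blinfun - q k)) \<le> 2 * norm (X m) * \<alpha> (id_blinfun - q k)"
        using XM q by (intro \<alpha>_mult_left_le) (auto simp: mem_intros)
      moreover have "\<dots> \<le> 2 * norm (X m) * \<epsilon>''" using \<alpha>q by (intro mult_left_mono) auto
      ultimately show ?thesis using Xq \<epsilon>''(2) by linarith
    qed
    have "\<alpha> (X n) < \<epsilon>" if "N \<le> n" for n
      using \<alpha>_le_diff[OF XM[of n] XM[of m]] N[OF that Nm] Xm \<epsilon>' by linarith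
    then show ?thesis by blast
  qed
  then have "(\<lambda>n. \<alpha> (X n)) \<longlonglongrightarrow> 0"
    using XM by (auto simp: LIMSEQ_def dist_real_def \<alpha>_nonneg)
  then show False using nz by simp
qed

end

section \<open>Closed right-invariant subspaces\<close>

locale right_invariant_subspace = uinvariant_norm M \<tau> \<alpha>
  for M :: "'h::chilbert_space op set" and \<tau> and \<alpha> +
  fixes W :: "'h Lelem set"
  assumes W_subspace: "Lsubspace M \<alpha> W" and W_closed: "Lclosed M \<alpha> W"
    and W_right: "\<And>\<xi> a. \<xi> \<in> W \<Longrightarrow> a \<in> M \<Longrightarrow> right_mult M \<alpha> \<xi> a \<in> W"
begin

text \<open>On representatives, the operations of the completion are termwise operations in \<open>M\<close>.\<close>

definition CW :: "(nat \<Rightarrow> 'h op) set" where "CW = {X \<in> C. class_of X \<in> W}"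

lemma CW_C: "X \<in> CW \<Longrightarrow> X \<in> C"
  by (simp add: CW_def)

lemma CW_equiv: "X \<in> CW \<Longrightarrow> Y \<in> C \<Longrightarrow> (\<lambda>n. \<alpha> (X n - Y n)) \<longlonglongrightarrow> 0 \<Longrightarrow> Y \<in> CW"
  unfolding CW_def using class_of_eq_iff[of X Y] by auto

lemma CW_0: "(\<lambda>_. 0) \<in> CW"
  using W_subspace by (simp add: CW_def C_const mem_0 class_of_def Lsubspace_def Lzero_def)

lemma CW_add: "X \<in> CW \<Longrightarrow> Y \<in> CW \<Longrightarrow> (\<lambda>n. X n + Y n) \<in> CW"
  using W_subspace by (simp add: CW_def C_add Lsubspace_def Ladd_class_of[symmetric])

lemma CW_scale: "X \<in> CW \<Longrightarrow> (\<lambda>n. scale_op c (X n)) \<in> CW"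
  using W_subspace by (simp add: CW_def C_scale Lsubspace_def Lscale_class_of[symmetric])

lemma CW_scaleR: "X \<in> CW \<Longrightarrow> (\<lambda>n. r *\<^sub>R X n) \<in> CW"
  unfolding scaleR_eq_scale_op by (rule CW_scale)

lemma CW_diff: "X \<in> CW \<Longrightarrow> Y \<in> CW \<Longrightarrow> (\<lambda>n. X n - Y n) \<in> CW"
  using CW_add[of X "\<lambda>n. (-1) *\<^sub>R Y n"] CW_scaleR[of Y "-1"] by simp

lemma CW_right: "X \<in> CW \<Longrightarrow> a \<in> M \<Longrightarrow> (\<lambda>n. X n o\<^sub>L a) \<in> CW"
  using W_right[of "class_of X" a] right_mult_class_of[of a X] by (auto simp: CW_def C_right)

lemma CW_closed:
  assumes X: "X \<in> C" and appr: "\<And>\<epsilon>. 0 < \<epsilon> \<Longrightarrow> \<exists>Y\<in>CW. \<exists>k. \<forall>n\<ge>k. \<alpha> (X n - Y n) \<le> \<epsilon>"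
  shows "X \<in> CW"
proof -
  have "\<exists>\<eta>\<in>W. completion_norm \<alpha> (Ldiff M \<alpha> (class_of X) \<eta>) < \<epsilon>" if \<epsilon>: "0 < \<epsilon>" for \<epsilon>
  proof -
    obtain Y k where Y: "Y \<in> CW" and k: "\<forall>n\<ge>k. \<alpha> (X n - Y n) \<le> \<epsilon> / 2"
      using appr[OF half_gt_zero[OF \<epsilon>]] by blast
    have "completion_norm \<alpha> (class_of (\<lambda>n. X n - Y n)) \<le> \<epsilon> / 2"
      using k by (intro LIMSEQ_le_const2[OF completion_norm_class_of[OF C_diff[OF X CW_C[OF Y]]]]) blast
    then show ?thesis using Y \<epsilon> Ldiff_class_of[OF X CW_C[OF Y]]
      by (intro bexI[of _ "class_of Y"]) (auto simp: CW_def)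
  qed
  then have "class_of X \<in> W" using W_closed class_of_mem[OF X] by (simp add: Lclosed_def)
  then show ?thesis using X by (simp add: CW_def)
qed

lemma CW_const_limit:
  assumes x: "\<And>n. (\<lambda>_::nat. x n) \<in> CW" and y: "y \<in> M" and lim: "(\<lambda>n. \<alpha> (y - x n)) \<longlonglongrightarrow> 0"
  shows "(\<lambda>_::nat. y) \<in> CW"
proof (rule CW_closed[OF C_const[OF y]])
  fix \<epsilon> :: real assume "0 < \<epsilon>"
  then have "eventually (\<lambda>n. \<alpha> (y - x n) < \<epsilon>) sequentially" using lim by (auto intro: order_tendstoD)
  then obtain n where "\<alpha> (y - x n) < \<epsilon>" by (auto simp: eventually_sequentially)
  then show "\<exists>Y\<in>CW. \<exists>k. \<forall>m\<ge>k. \<alpha> (y - Y m) \<le> \<epsilon>"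
    using x[of n] by (intro bexI[of _ "\<lambda>_. x n"]) auto
qed

lemma CW_const_norm_limit:
  assumes x: "\<And>n. (\<lambda>_::nat. x n) \<in> CW" and lim: "x \<longlonglongrightarrow> y"
  shows "(\<lambda>_::nat. y) \<in> CW"
proof (rule CW_const_limit[OF x])
  have xM: "x n \<in> M" for n using C_mem[OF CW_C[OF x]] .
  then show yM: "y \<in> M" by (intro mem_norm_limit[OF lim])
  show "(\<lambda>n. \<alpha> (y - x n)) \<longlonglongrightarrow> 0"
    using \<alpha>_tendsto_0_norm[OF xM yM lim] by (simp add: \<alpha>_diff_commute[OF yM xM])
qed

text \<open>The norm limit \<open>y\<close> of a bounded cut \<open>X (r n) q\<close> represents the same class as \<open>X q\<close>, which lies in
  \<open>W\<close> by right invariance; and left multiplication by \<open>e\<close> is norm continuous.\<close>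

lemma ex_bounded_element:
  assumes X: "X \<in> CW" and nz: "\<not> (\<lambda>n. \<alpha> (X n)) \<longlonglongrightarrow> 0" and e: "\<And>n. e o\<^sub>L X n = 0"
  shows "\<exists>y\<in>M. y \<noteq> 0 \<and> (\<lambda>_. y) \<in> CW \<and> e o\<^sub>L y = 0"
proof -
  have XC: "X \<in> C" and XM: "X n \<in> M" for n using X by (auto dest: CW_C intro: C_mem)
  obtain r q y where r: "strict_mono r" and q: "q \<in> M" and y: "y \<in> M" "y \<noteq> 0"
    and lim: "(\<lambda>n. X (r n) o\<^sub>L q) \<longlonglongrightarrow> y"
    using ex_nonzero_bounded_cut[OF XC nz] by blast
  have "(\<lambda>n. X n o\<^sub>L q) \<in> CW" using X q by (rule CW_right)
  then have "(\<lambda>_. y) \<in> CW"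
  proof (rule CW_equiv[OF _ C_const[OF y(1)]])
    have Xq: "(\<lambda>n. X n o\<^sub>L q) \<in> C" using XC q by (simp add: C_right)
    have l: "(\<lambda>n. \<alpha> ((X (r n) o\<^sub>L q) - y)) \<longlonglongrightarrow> 0"
      using XM q y lim by (intro \<alpha>_tendsto_0_norm) (auto simp: mem_intros)
    show "(\<lambda>n. \<alpha> ((X n o\<^sub>L q) - y)) \<longlonglongrightarrow> 0"
    proof (rule LIMSEQ_I)
      fix \<epsilon> :: real assume "0 < \<epsilon>"
      then have \<epsilon>: "0 < \<epsilon> / 2" by simp
      obtain k where k: "\<And>m n. k \<le> m \<Longrightarrow> k \<le> n \<Longrightarrow> \<alpha> ((X m o\<^sub>L q) - (X n o\<^sub>L q)) < \<epsilon> / 2"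
        using C_cauchy[OF Xq \<epsilon>] by blast
      have "eventually (\<lambda>n. \<alpha> ((X (r n) o\<^sub>L q) - y) < \<epsilon> / 2 \<and> k \<le> n) sequentially"
        using order_tendstoD(2)[OF l \<epsilon>] eventually_ge_at_top by (rule eventually_conj)
      then obtain j where j: "\<alpha> ((X (r j) o\<^sub>L q) - y) < \<epsilon> / 2" "k \<le> j"
        by (auto simp: eventually_sequentially)
      have kr: "k \<le> r j" using j(2) seq_suble[OF r] order_trans by blast
      have "norm (\<alpha> ((X n o\<^sub>L q) - y) - 0) < \<epsilon>" if "k \<le> n" for n
        using \<alpha>_triangle_diff[of "X n o\<^sub>L q" "X (r j) o\<^sub>L q" y] k[OF that kr] j(1) XM q y
          \<alpha>_nonneg[of "(X n o\<^sub>L q) - y"] by (simp add: mem_intros)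
      then show "\<exists>k. \<forall>n\<ge>k. norm (\<alpha> ((X n o\<^sub>L q) - y) - 0) < \<epsilon>" by blast
    qed
  qed
  moreover have "e o\<^sub>L y = 0"
  proof (rule LIMSEQ_unique)
    show "(\<lambda>n. e o\<^sub>L (X (r n) o\<^sub>L q)) \<longlonglongrightarrow> (e o\<^sub>L y)" by (intro tendsto_compose lim tendsto_const)
    have "e (X n x) = 0" for n x using arg_cong[OF e[of n], of "\<lambda>T. blinfun_apply T x"] by simp
    then have "e o\<^sub>L (X (r n) o\<^sub>L q) = 0" for n by (intro blinfun_eqI) simp
    then show "(\<lambda>n. e o\<^sub>L (X (r n) o\<^sub>L q)) \<longlonglongrightarrow> 0" by simp
  qed
  ultimately show ?thesis using y by blast
qed

definition W_projections :: "'h op set" where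
  "W_projections = {p \<in> M. projection p \<and> (\<lambda>_. p) \<in> CW}"

text \<open>A spectral projection \<open>f\<close> of \<open>s = y y\<^sup>*\<close> away from \<open>0\<close>: on its range \<open>s\<close> is bounded below, so
  \<open>f\<close> is the norm limit of \<open>f - (1 - c s)\<^sup>n f\<close>, which lies in \<open>y M\<close>.\<close>

lemma ex_nonzero_projection:
  assumes y: "y \<in> M" "y \<noteq> 0" "(\<lambda>_. y) \<in> CW" and e: "selfadjoint e" "e o\<^sub>L y = 0"
  shows "\<exists>f\<in>W_projections. f \<noteq> 0 \<and> (\<forall>x. blinfun_apply e (blinfun_apply f x) = 0)"
proof -
  have yb: "y \<in> bounded_ops" using y by (simp add: mem_bounded)
  define s where "s = y o\<^sub>L adj y"
  have sM: "s \<in> M" using y by (simp add: s_def mem_intros)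
  have poss: "positive_op s"
    using positive_adj_compose[OF adj_bounded_ops[OF yb]] by (simp add: s_def adj_adj[OF yb])
  have "s \<noteq> 0"
  proof
    assume "s = 0"
    have "rin (s x) x = (norm (adj y x))\<^sup>2" for x
      by (simp add: s_def rin_self flip: rin_adj_right[OF yb])
    then have ax: "adj y x = 0" for x by (simp add: \<open>s = 0\<close> rin_simps)
    have "y = 0"
    proof (rule op_ext_rin)
      show "rin (y x) v = rin ((0::'h op) x) v" for x v
        using rin_adj_right[OF yb, of x v] by (simp add: ax rin_simps)
    qed
    then show False using y(2) by simp
  qed
  then have ns: "0 < norm s" by simp
  define d where "d = norm s / 2"
  have d: "0 < d" using ns by (simp add: d_def)
  obtain f where f: "f \<in> M" "projection f" and comm: "\<And>x. f (s x) = s (f x)"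
    and small: "\<And>x. norm (s (x - f x)) \<le> d * norm x"
    and large: "\<And>x. d * (norm (f x))\<^sup>2 \<le> rin (s (f x)) (f x)"
    using ex_spectral_projection[OF sM poss d] by blast
  have saf: "selfadjoint f" and ff: "f (f x) = f x" for x using f by (auto simp: projection_iff)
  have "f \<noteq> 0"
  proof
    assume "f = 0"
    then have "norm s \<le> d" using small d by (intro norm_blinfun_bound) auto
    then show False using ns by (simp add: d_def)
  qed
  moreover have "e (f x) = 0" for x
  proof -
    have ey: "e (y v) = 0" for v using arg_cong[OF e(2), of "\<lambda>T. blinfun_apply T v"] by simp
    have "adj y (e v) = 0" for v
      by (rule rin_ext) (simp add: rin_adj_left[OF yb] selfadjoint_rin[OF e(1)] ey rin_simps)
    then have "s (f (e v)) = 0" for v by (simp flip: comm) (simp add: s_def)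
    then have fe: "f (e v) = 0" for v using large[of "e v"] d by (simp add: rin_simps mult_le_0_iff)
    show ?thesis
      by (rule rin_ext) (simp add: selfadjoint_rin[OF e(1)] selfadjoint_rin[OF saf] fe rin_simps)
  qed
  moreover have "(\<lambda>_. f) \<in> CW"
  proof -
    define c where "c = 1 / norm s"
    have c: "0 < c" "c * d = 1/2" using ns by (simp_all add: c_def d_def)
    define b where "b = id_blinfun - c *\<^sub>R s"
    have bx: "b x = x - c *\<^sub>R s x" for x by (simp add: b_def blinfun.bilinear_simps)
    have bM: "b \<in> M" by (simp add: b_def mem_intros sM)
    have fb: "f (b x) = b (f x)" for x by (simp add: bx blinfun.bilinear_simps comm)
    have "norm (b o\<^sub>L f) \<le> 1/2"
    proof (rule positive_norm_le)
      have eq: "rin ((b o\<^sub>L f) x) x = (norm (f x))\<^sup>2 - c * rin (s (f x)) (f x)" for x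
      proof -
        have "rin (b (f x)) x = rin (f (b (f x))) x" by (simp add: fb ff)
        also have "\<dots> = rin (b (f x)) (f x)" by (simp add: selfadjoint_rin[OF saf])
        finally show ?thesis by (simp add: bx rin_simps rin_self)
      qed
      have "c * rin (s v) v \<le> (norm v)\<^sup>2" for v
        using rin_le_norm[of s v] ns by (simp add: c_def field_simps)
      moreover have "selfadjoint (b o\<^sub>L f)"
        using poss saf by (intro selfadjoint_compose_commute)
          (auto simp: b_def positive_op_iff selfadjoint_diff selfadjoint_id selfadjoint_scaleR
            blinfun.bilinear_simps comm intro!: blinfun_eqI)
      ultimately show "positive_op (b o\<^sub>L f)" unfolding positive_op_iff eq by simp
      fix x
      have "c * (d * (norm (f x))\<^sup>2) \<le> c * rin (s (f x)) (f x)" using c large by (intro mult_left_mono) auto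
      then have "(1/2) * (norm (f x))\<^sup>2 \<le> c * rin (s (f x)) (f x)" by (simp only: mult.assoc[symmetric] c)
      then have "rin ((b o\<^sub>L f) x) x \<le> (1/2) * (norm (f x))\<^sup>2" unfolding eq by linarith
      also have "\<dots> \<le> (1/2) * (norm x)\<^sup>2"
        using projection_rin_le[OF f(2), of x] by (simp add: projection_rin[OF f(2)])
      finally show "rin ((b o\<^sub>L f) x) x \<le> (1/2) * (norm x)\<^sup>2" .
    qed simp
    then have half: "norm (b (f x)) \<le> (1/2) * norm x" for x
      using norm_blinfun[of "b o\<^sub>L f" x] mult_right_mono[of "norm (b o\<^sub>L f)" "1/2" "norm x"] by simp
    have fp: "f (opow b n x) = opow b n (f x)" for n x by (rule opow_commute_apply) (rule fb)
    have "norm (opow b n (f x)) \<le> (1/2) ^ n * norm x" for n x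
    proof (induction n)
      case 0
      show ?case
        using norm_blinfun[of f x] mult_right_mono[OF projection_norm_le[OF f(2)], of "norm x"] by simp
    next
      case (Suc n)
      have "norm (opow b (Suc n) (f x)) = norm (b (f (opow b n (f x))))" by (simp add: fp ff)
      also have "\<dots> \<le> (1/2) * norm (opow b n (f x))" by (rule half)
      finally show ?case using Suc by simp
    qed
    then have n: "norm (opow b n o\<^sub>L f) \<le> (1/2) ^ n" for n by (intro norm_blinfun_bound) auto
    have "(\<lambda>n. opow b n o\<^sub>L f) \<longlonglongrightarrow> 0"
      by (rule Lim_null_comparison[OF always_eventually LIMSEQ_power_zero[of "1/2::real"]]) (auto simp: n)
    then have lim: "(\<lambda>n. f - (opow b n o\<^sub>L f)) \<longlonglongrightarrow> f" using tendsto_diff[OF tendsto_const[of f]] by fastforce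
    have "(\<lambda>_. f - (opow b n o\<^sub>L f)) \<in> CW" for n
    proof (induction n)
      case (Suc n)
      have "(\<lambda>_. y o\<^sub>L (adj y o\<^sub>L (opow b n o\<^sub>L f))) \<in> CW"
        by (rule CW_right[OF y(3)]) (use y f bM in \<open>simp add: mem_intros mem_opow\<close>)
      from CW_add[OF Suc CW_scaleR[OF this, of c]]
      have "(\<lambda>_. f - (opow b n o\<^sub>L f) + c *\<^sub>R (y o\<^sub>L (adj y o\<^sub>L (opow b n o\<^sub>L f)))) \<in> CW" .
      moreover have "f - (opow b n o\<^sub>L f) + c *\<^sub>R (y o\<^sub>L (adj y o\<^sub>L (opow b n o\<^sub>L f))) = f - (opow b (Suc n) o\<^sub>L f)"
        by (rule blinfun_eqI) (simp add: blinfun.bilinear_simps bx s_def)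
      ultimately show ?case by simp
    qed (simp add: CW_0)
    then show ?thesis using lim by (rule CW_const_norm_limit)
  qed
  ultimately show ?thesis using f unfolding W_projections_def by blast
qed

lemma orthogonal_commute:
  fixes e f :: "'h op"
  assumes "selfadjoint e" "selfadjoint f" "\<And>x. e (f x) = 0"
  shows "f (e x) = 0"
  by (rule rin_ext) (simp add: selfadjoint_rin[OF assms(1)] selfadjoint_rin[OF assms(2)] assms(3) rin_simps)

lemma W_projections_add:
  assumes e: "e \<in> W_projections" and f: "f \<in> W_projections" and ef: "\<And>x. e (f x) = 0"
  shows "e + f \<in> W_projections"
proof -
  have p: "projection e" "projection f" using e f by (auto simp: W_projections_def)
  then have "f (e x) = 0" for x using ef by (intro orthogonal_commute[of e f]) (auto simp: projection_iff)
  then have "projection (e + f)"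
    using p by (simp add: projection_iff selfadjoint_add blinfun.bilinear_simps ef)
  then show ?thesis using e f by (auto simp: W_projections_def mem_add intro: CW_add)
qed

lemma projection_0: "projection 0"
  by (simp add: projection_iff selfadjoint_0)

text \<open>Exhaustion: adding at each step an orthogonal projection of at least half the possible trace,
  the traces of the added projections tend to \<open>0\<close>. By normality and the continuity of \<open>\<alpha>\<close> the limit
  is again in \<open>W\<close>.\<close>

lemma ex_maximal_projection:
  "\<exists>e\<in>W_projections. \<forall>f\<in>W_projections. (\<forall>x. blinfun_apply e (blinfun_apply f x) = 0) \<longrightarrow> f = 0"
proof -
  have P0: "0 \<in> W_projections" by (simp add: W_projections_def mem_0 projection_0 CW_0)
  have PM: "p \<in> M" and Pp: "projection p" and PW: "(\<lambda>_. p) \<in> CW" if "p \<in> W_projections" for p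
    using that by (auto simp: W_projections_def)
  have tr01: "0 \<le> tr p \<and> tr p \<le> 1" if "p \<in> W_projections" for p
    using tr_nonneg[of p] tr_nonneg[of "id_blinfun - p"] PM[OF that] Pp[OF that]
    by (simp add: projection_positive projection_complement mem_intros tr_diff tr_id)
  have "\<exists>f. e \<in> W_projections \<longrightarrow> f \<in> W_projections \<and> (\<forall>x. blinfun_apply e (blinfun_apply f x) = 0) \<and>
      (\<forall>f'\<in>W_projections. (\<forall>x. blinfun_apply e (blinfun_apply f' x) = 0) \<longrightarrow> tr f' \<le> 2 * tr f)" for e
  proof -
    define S where "S = tr ` {f \<in> W_projections. \<forall>x. blinfun_apply e (blinfun_apply f x) = 0}"
    have bdd: "bdd_above S" using tr01 by (auto simp: S_def intro!: bdd_aboveI[of _ 1])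
    have ne: "S \<noteq> {}" using P0 by (auto simp: S_def intro!: exI[of _ 0])
    have le: "tr f' \<le> Sup S" if "f' \<in> W_projections" "\<forall>x. blinfun_apply e (blinfun_apply f' x) = 0" for f'
      using bdd that by (intro cSup_upper) (auto simp: S_def)
    show ?thesis
    proof (cases "Sup S \<le> 0")
      case True
      then show ?thesis using P0 le tr_0 by (intro exI[of _ 0]) force
    next
      case False
      then have "Sup S / 2 < Sup S" by simp
      then obtain f where "f \<in> W_projections" "\<forall>x. blinfun_apply e (blinfun_apply f x) = 0" "Sup S / 2 < tr f"
        using less_cSup_iff[OF ne bdd] unfolding S_def by blast
      then show ?thesis using le by (intro exI[of _ f]) force
    qed
  qed
  then obtain g where "\<And>e. e \<in> W_projections \<longrightarrow> g e \<in> W_projections \<and> (\<forall>x. blinfun_apply e (blinfun_apply (g e) x) = 0) \<and>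
      (\<forall>f'\<in>W_projections. (\<forall>x. blinfun_apply e (blinfun_apply f' x) = 0) \<longrightarrow> tr f' \<le> 2 * tr (g e))"
    by metis
  then have g: "\<And>e. e \<in> W_projections \<Longrightarrow> g e \<in> W_projections" "\<And>e x. e \<in> W_projections \<Longrightarrow> blinfun_apply e (blinfun_apply (g e) x) = 0"
    and gmax: "\<And>e f. e \<in> W_projections \<Longrightarrow> f \<in> W_projections \<Longrightarrow> (\<And>x. blinfun_apply e (blinfun_apply f x) = 0) \<Longrightarrow> tr f \<le> 2 * tr (g e)"
    by blast+
  define E where "E = rec_nat 0 (\<lambda>_ e. e + g e)"
  have E: "E 0 = 0" "\<And>n. E (Suc n) = E n + g (E n)" by (simp_all add: E_def)
  have EP: "E n \<in> W_projections" for n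
    by (induction n) (auto simp: E P0 g intro!: W_projections_add)
  have EM: "E n \<in> M" and pE: "projection (E n)" and saE: "selfadjoint (E n)" for n
    using EP[of n] by (auto simp: W_projections_def projection_iff)
  have trE: "tr (E n) = (\<Sum>i<n. tr (g (E i)))" for n
    by (induction n) (simp_all add: E tr_0 tr_add EM PM[OF g(1)] EP)
  have "(\<lambda>n. tr (g (E n))) \<longlonglongrightarrow> 0"
  proof (rule summable_LIMSEQ_zero, rule summableI_nonneg_bounded)
    show "0 \<le> tr (g (E n))" for n using tr01 g EP by blast
    show "(\<Sum>i<n. tr (g (E i))) \<le> 1" for n using tr01[OF EP[of n]] by (simp add: trE)
  qed
  then have g0: "(\<lambda>n. 2 * tr (g (E n))) \<longlonglongrightarrow> 0" using tendsto_mult_left[of _ 0 _ 2] by fastforce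
  have EE: "E n (E (n + k) x) = E n x" for n k x
  proof (induction k arbitrary: x)
    case 0
    show ?case using pE by (simp add: projection_iff)
  next
    case (Suc k)
    have "E n (g (E (n + k)) x) = E n (E (n + k) (g (E (n + k)) x))" by (simp only: Suc)
    also have "\<dots> = 0" by (simp add: g(2)[OF EP])
    finally show ?case by (simp add: E blinfun.bilinear_simps Suc)
  qed
  have EE': "E (n + k) (E n x) = E n x" for n k x
    by (rule rin_ext) (simp add: selfadjoint_rin[OF saE] EE)
  have Emono: "rin (E n x) x \<le> rin (E (Suc n) x) x" for n x
    using projection_positive[OF Pp[OF g(1)[OF EP[of n]]]]
    by (simp add: E blinfun.bilinear_simps rin_simps positive_op_iff)
  obtain e where e: "e \<in> M" "selfadjoint e" "\<And>x. (\<lambda>n. E n x) \<longlonglongrightarrow> e x"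
    using ex_monotone_strong_limit[of E] EM saE Emono projection_rin_le[OF pE] projection_positive[OF pE]
    by (auto simp: positive_op_iff)
  have Ee: "E n (e x) = E n x" for n x
  proof (rule LIMSEQ_unique)
    show "(\<lambda>k. E n (E (k + n) x)) \<longlonglongrightarrow> E n (e x)"
      by (rule blinfun.tendsto[OF tendsto_const LIMSEQ_ignore_initial_segment[OF e(3)]])
    show "(\<lambda>k. E n (E (k + n) x)) \<longlonglongrightarrow> E n x"
      unfolding add.commute[of _ n] EE by (rule tendsto_const)
  qed
  have eE: "e (E n x) = E n x" for n x
  proof (rule LIMSEQ_unique)
    show "(\<lambda>k. E (k + n) (E n x)) \<longlonglongrightarrow> e (E n x)" by (rule LIMSEQ_ignore_initial_segment[OF e(3)])
    show "(\<lambda>k. E (k + n) (E n x)) \<longlonglongrightarrow> E n x"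
      unfolding add.commute[of _ n] EE' by (rule tendsto_const)
  qed
  have "e (e x) = e x" for x
    using e(3)[of "e x"] e(3)[of x] unfolding Ee by (rule LIMSEQ_unique)
  then have pe: "projection e" using e by (simp add: projection_iff)
  have "(\<lambda>n. \<alpha> (e - E n)) \<longlonglongrightarrow> 0"
  proof (rule LIMSEQ_I)
    fix \<epsilon> :: real assume "0 < \<epsilon>"
    then obtain \<delta> where \<delta>: "0 < \<delta>" "\<And>p. p \<in> M \<Longrightarrow> projection p \<Longrightarrow> tr p < \<delta> \<Longrightarrow> \<alpha> p < \<epsilon>"
      using \<alpha>_continuous unfolding continuous_norm_on_def tr_def by blast
    have "(\<lambda>n. tr (E n)) \<longlonglongrightarrow> tr e" by (rule tr_monotone_limit[OF EM saE Emono e(1,3)])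
    from LIMSEQ_D[OF this \<delta>(1)] obtain N where N: "\<And>n. N \<le> n \<Longrightarrow> norm (tr (E n) - tr e) < \<delta>" by blast
    have "norm (\<alpha> (e - E n) - 0) < \<epsilon>" if "N \<le> n" for n
    proof -
      have "projection (e - E n)"
        using pe pE by (simp add: projection_iff selfadjoint_diff blinfun.bilinear_simps Ee eE)
      moreover have "tr (e - E n) < \<delta>" using N[OF that] e EM by (simp add: tr_diff)
      ultimately show ?thesis using \<delta>(2)[of "e - E n"] e EM by (simp add: mem_diff \<alpha>_nonneg)
    qed
    then show "\<exists>N. \<forall>n\<ge>N. norm (\<alpha> (e - E n) - 0) < \<epsilon>" by blast
  qed
  then have "(\<lambda>_. e) \<in> CW" by (rule CW_const_limit[OF PW[OF EP] e(1)])
  then have "e \<in> W_projections" using e pe by (simp add: W_projections_def)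
  moreover have "f = 0" if f: "f \<in> W_projections" and ef: "\<forall>x. e (f x) = 0" for f
  proof -
    have "E n (f x) = 0" for n x using Ee[of n "f x"] ef by simp
    then have "tr f \<le> 2 * tr (g (E n))" for n using gmax[OF EP f] by blast
    then have "tr f \<le> 0" using LIMSEQ_le_const[OF g0] by blast
    then have "tr f = 0" using tr01[OF f] by simp
    then show ?thesis using tr_faithful[OF PM[OF f] projection_positive[OF Pp[OF f]]] by blast
  qed
  ultimately show ?thesis by blast
qed

text \<open>\<open>e M \<subseteq> W\<close> by right invariance, and \<open>e M\<close> is dense in \<open>e L\<^sup>\<alpha>\<close>.\<close>

lemma principal_right_ideal_in_W:
  assumes e: "e \<in> W_projections" and X: "X \<in> C"
  shows "(\<lambda>n. e o\<^sub>L X n) \<in> CW"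
proof -
  have eM: "e \<in> M" and pe: "projection e" and eW: "(\<lambda>_. e) \<in> CW" using e by (auto simp: W_projections_def)
  have XM: "X n \<in> M" for n using X by (rule C_mem)
  show ?thesis
  proof (rule CW_closed)
    show "(\<lambda>n. e o\<^sub>L X n) \<in> C" using eM X by (rule C_left)
    fix \<epsilon> :: real assume "0 < \<epsilon>"
    then have "0 < \<epsilon> / 2" by simp
    then obtain k where k: "\<And>m n. k \<le> m \<Longrightarrow> k \<le> n \<Longrightarrow> \<alpha> (X m - X n) < \<epsilon> / 2" using C_cauchy[OF X] by blast
    have "\<alpha> ((e o\<^sub>L X n) - (e o\<^sub>L X k)) \<le> \<epsilon>" if "k \<le> n" for n
    proof -
      have "\<alpha> (e o\<^sub>L (X n - X k)) \<le> 2 * norm e * \<alpha> (X n - X k)"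
        using eM XM by (intro \<alpha>_mult_left_le) (auto simp: mem_diff)
      also have "\<dots> \<le> 2 * 1 * \<alpha> (X n - X k)"
        using XM projection_norm_le[OF pe] by (intro mult_right_mono) (auto intro: \<alpha>_nonneg mem_diff)
      finally show ?thesis using k[OF that order_refl] by (simp add: compose_diff_right)
    qed
    then show "\<exists>Y\<in>CW. \<exists>k. \<forall>n\<ge>k. \<alpha> ((e o\<^sub>L X n) - Y n) \<le> \<epsilon>"
      using CW_right[OF eW XM[of k]] by (intro bexI[of _ "\<lambda>_. e o\<^sub>L X k"]) auto
  qed
qed

text \<open>For \<open>\<xi> \<in> W\<close> the difference \<open>\<xi> - e \<xi>\<close> lies in \<open>W\<close> and is killed by \<open>e\<close>. Were it nonzero, it would
  give rise to a nonzero projection in \<open>W\<close> orthogonal to \<open>e\<close>, against the choice of \<open>e\<close>.\<close>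

lemma ex_generating_projection:
  "\<exists>e\<in>M. projection e \<and> W = left_mult M \<alpha> e ` Lalpha M \<alpha>"
proof -
  obtain e where e: "e \<in> W_projections" and max: "\<And>f. f \<in> W_projections \<Longrightarrow> (\<And>x. blinfun_apply e (blinfun_apply f x) = 0) \<Longrightarrow> f = 0"
    using ex_maximal_projection by blast
  have eM: "e \<in> M" and pe: "projection e" using e by (auto simp: W_projections_def)
  have "left_mult M \<alpha> e \<xi> \<in> W" if "\<xi> \<in> Lalpha M \<alpha>" for \<xi>
  proof -
    obtain X where X: "X \<in> C" "\<xi> = class_of X" using \<open>\<xi> \<in> Lalpha M \<alpha>\<close> by (rule Lalpha_cases)
    then show ?thesis using principal_right_ideal_in_W[OF e X(1)] eM by (simp add: left_mult_class_of CW_def)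
  qed
  moreover have "\<xi> \<in> left_mult M \<alpha> e ` Lalpha M \<alpha>" if \<xi>: "\<xi> \<in> W" for \<xi>
  proof -
    have "\<xi> \<in> Lalpha M \<alpha>" using \<xi> W_subspace by (auto simp: Lsubspace_def)
    then obtain X where X: "X \<in> C" "\<xi> = class_of X" by (rule Lalpha_cases)
    then have XW: "X \<in> CW" using \<xi> by (simp add: CW_def)
    define Y where "Y n = X n - (e o\<^sub>L X n)" for n
    have Y: "Y \<in> CW" unfolding Y_def by (rule CW_diff[OF XW principal_right_ideal_in_W[OF e X(1)]])
    have eY: "e o\<^sub>L Y n = 0" for n
      using pe by (intro blinfun_eqI) (simp add: Y_def blinfun.bilinear_simps projection_iff)
    have "(\<lambda>n. \<alpha> (Y n)) \<longlonglongrightarrow> 0"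
    proof (rule ccontr)
      assume "\<not> (\<lambda>n. \<alpha> (Y n)) \<longlonglongrightarrow> 0"
      then obtain y where "y \<in> M" "y \<noteq> 0" "(\<lambda>_. y) \<in> CW" "e o\<^sub>L y = 0"
        using ex_bounded_element[OF Y _ eY] by blast
      then show False using ex_nonzero_projection[of y e] pe max by (auto simp: projection_iff)
    qed
    then have "class_of X = class_of (\<lambda>n. e o\<^sub>L X n)" using X(1) eM by (simp add: class_of_eq_iff C_left Y_def)
    then have "\<xi> = left_mult M \<alpha> e (class_of X)" unfolding left_mult_class_of[OF eM X(1)] X(2) .
    then show ?thesis using class_of_mem[OF X(1)] by blast
  qed
  ultimately show ?thesis using eM pe by blast
qed

end

theorem corollary5p8:
  fixes M :: "'h::chilbert_space op set"
    and \<tau> :: "'h op \<Rightarrow> complex"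
    and \<alpha> :: "'h op \<Rightarrow> real"
    and W :: "'h Lelem set"
  assumes "finite_von_neumann_algebra M"
    and "faithful_normal_tracial_state M \<tau>"
    and "norm_on M \<alpha>"
    and "normalized_norm \<alpha>"
    and "unitarily_invariant_on M \<alpha>"
    and "norm1_dominating_on M \<tau> \<alpha>"
    and "continuous_norm_on M \<tau> \<alpha>"
    and "Lsubspace M \<alpha> W"
    and "Lclosed M \<alpha> W"
    and "\<And>\<xi> a. \<xi> \<in> W \<Longrightarrow> a \<in> M \<Longrightarrow> right_mult M \<alpha> \<xi> a \<in> W"
  shows "\<exists>e\<in>M. projection e \<and> W = left_mult M \<alpha> e ` Lalpha M \<alpha>"
proof -
  interpret right_invariant_subspace M \<tau> \<alpha> W
    using assms
    by unfold_locales
      (auto simp: finite_von_neumann_algebra_def normalized_norm_def unitarily_invariant_on_def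
        norm1_dominating_on_def)
  show ?thesis by (rule ex_generating_projection)
qed

end
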